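(* Let $n\ge 3$ and let $\ell=(\ell_1,\ldots,\ell_n)$ be a generic length vector with $\overline M(\ell)$ nonempty. Then $\overline M(\ell)$ is orientable if and only if $n$ is even or $\overline M(\ell)$ is diffeomorphic to $(S^1)^{n-3}$.
   Context: A length vector $\ell=(\ell_1,\ldots,\ell_n)$ is an $n$-tuple of positive real numbers; it is generic if there is no $S\subset\{1,\ldots,n\}$ with $\sum_{i\in S}\ell_i=\sum_{i\notin S}\ell_i$. $M(\ell)$ is the space of $n$-gons in the plane with successive side lengths $\ell_1,\ldots,\ell_n$, identified under oriented (orientation-preserving) isometry; concretely $M(\ell)=F^{-1}(\ell_n)$ where $F:(S^1)^{n-1}\to\mathbb C$, $F(z_1,\ldots,z_{n-1})=\sum_{j=1}^{n-1}\ell_jz_j$. $\overline M(\ell)$ is the space of such $n$-gons identified under all isometries; concretely it is the quotient of $M(\ell)$ by the involution $\phi(z_1,\ldots,z_{n-1})=(\bar z_1,\ldots,\bar z_{n-1})$ (complex conjugation), which is free when $\ell$ is generic. For generic $\ell$ both are closed smooth $(n-3)$-manifolds. *)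

theory Defs
  imports "HOL-Analysis.Analysis" "Jordan_Normal_Form.Determinant"
begin

section \<open>Smooth maps between open subsets of Euclidean spaces\<close>

text \<open>
  The model of \<open>d\<close>-dimensional space, including \<open>d = 0\<close>, is the library's
  \<^const>\<open>Euclidean_space\<close>: functions \<open>x :: nat \<Rightarrow> real\<close> with \<open>x i = 0\<close> for all \<open>i \<ge> d\<close>.
  The notions below are meant for sets \<open>U\<close> that are open in that space. A function is \<open>C\<close>-infinity
  iff all its iterated partial derivatives exist and are continuous.
\<close>

definition partial_derivative ::
    "nat \<Rightarrow> ((nat \<Rightarrow> real) \<Rightarrow> 'b::real_normed_vector) \<Rightarrow> (nat \<Rightarrow> real) \<Rightarrow> 'b" where
  "partial_derivative i f x = vector_derivative (\<lambda>t. f (x(i := t))) (at (x i))"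

primrec times_continuously_differentiable ::
    "nat \<Rightarrow> nat \<Rightarrow> (nat \<Rightarrow> real) set \<Rightarrow> ((nat \<Rightarrow> real) \<Rightarrow> 'b::real_normed_vector) \<Rightarrow> bool" where
  "times_continuously_differentiable d 0 U f \<longleftrightarrow> continuous_on U f"
| "times_continuously_differentiable d (Suc k) U f \<longleftrightarrow>
     continuous_on U f \<and>
     (\<forall>i<d. (\<forall>x\<in>U. (\<lambda>t. f (x(i := t))) differentiable at (x i)) \<and>
            times_continuously_differentiable d k U (partial_derivative i f))"

definition smooth ::
    "nat \<Rightarrow> (nat \<Rightarrow> real) set \<Rightarrow> ((nat \<Rightarrow> real) \<Rightarrow> 'b::real_normed_vector) \<Rightarrow> bool" where
  "smooth d U f \<longleftrightarrow> (\<forall>k. times_continuously_differentiable d k U f)"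

definition smooth_map ::
    "nat \<Rightarrow> (nat \<Rightarrow> real) set \<Rightarrow> ((nat \<Rightarrow> real) \<Rightarrow> (nat \<Rightarrow> 'b::real_normed_vector)) \<Rightarrow> bool" where
  "smooth_map d U f \<longleftrightarrow> (\<forall>j. smooth d U (\<lambda>x. f x j))"

definition immersion ::
    "nat \<Rightarrow> (nat \<Rightarrow> real) set \<Rightarrow> ((nat \<Rightarrow> real) \<Rightarrow> (nat \<Rightarrow> 'b::real_normed_vector)) \<Rightarrow> bool" where
  "immersion d U f \<longleftrightarrow>
     smooth_map d U f \<and>
     (\<forall>x\<in>U. \<forall>v :: nat \<Rightarrow> real.
        (\<forall>j. (\<Sum>i<d. v i *\<^sub>R partial_derivative i (\<lambda>y. f y j) x) = 0) \<longrightarrow> (\<forall>i<d. v i = 0))"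

definition jacobian_det ::
    "nat \<Rightarrow> ((nat \<Rightarrow> real) \<Rightarrow> (nat \<Rightarrow> real)) \<Rightarrow> (nat \<Rightarrow> real) \<Rightarrow> real" where
  "jacobian_det d f x =
     Determinant.det (Matrix.mat d d (\<lambda>(i, j). partial_derivative j (\<lambda>y. f y i) x))"

section \<open>Smooth manifolds given by charts\<close>

type_synonym 'a chart = "'a set \<times> ('a \<Rightarrow> nat \<Rightarrow> real)"

record 'a smooth_space =
  dimension :: nat
  topology_of :: "'a topology"
  charts :: "'a chart set"

definition is_chart :: "nat \<Rightarrow> 'a topology \<Rightarrow> 'a chart \<Rightarrow> bool" where
  "is_chart d X = (\<lambda>(U, \<phi>).
     openin X U \<and> openin (Euclidean_space d) (\<phi> ` U) \<and>
     homeomorphic_map (subtopology X U) (subtopology (Euclidean_space d) (\<phi> ` U)) \<phi>)"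

definition overlap :: "'a chart \<Rightarrow> 'a chart \<Rightarrow> (nat \<Rightarrow> real) set" where
  "overlap = (\<lambda>(U, \<phi>) (V, \<psi>). \<phi> ` (U \<inter> V))"

definition transition :: "'a chart \<Rightarrow> 'a chart \<Rightarrow> (nat \<Rightarrow> real) \<Rightarrow> (nat \<Rightarrow> real)" where
  "transition = (\<lambda>(U, \<phi>) (V, \<psi>). \<psi> \<circ> inv_into U \<phi>)"

definition compatible :: "nat \<Rightarrow> 'a chart \<Rightarrow> 'a chart \<Rightarrow> bool" where
  "compatible d c c' \<longleftrightarrow>
     smooth_map d (overlap c c') (transition c c') \<and>
     smooth_map d (overlap c' c) (transition c' c)"

definition smooth_atlas :: "nat \<Rightarrow> 'a topology \<Rightarrow> 'a chart set \<Rightarrow> bool" where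
  "smooth_atlas d X A \<longleftrightarrow>
     (\<forall>c\<in>A. is_chart d X c) \<and> \<Union>(fst ` A) = topspace X \<and>
     (\<forall>c\<in>A. \<forall>c'\<in>A. compatible d c c')"

text \<open>
  Orientability: the smooth structure contains an atlas all of whose transition maps have
  positive Jacobian determinant. In dimension 0 the determinant of the empty matrix is 1.
\<close>

definition oriented_atlas :: "nat \<Rightarrow> 'a topology \<Rightarrow> 'a chart set \<Rightarrow> bool" where
  "oriented_atlas d X B \<longleftrightarrow>
     smooth_atlas d X B \<and>
     (\<forall>c\<in>B. \<forall>c'\<in>B. \<forall>x\<in>overlap c c'. jacobian_det d (transition c c') x > 0)"

definition orientable :: "'a smooth_space \<Rightarrow> bool" where
  "orientable M \<longleftrightarrow>
     (\<exists>B. oriented_atlas (dimension M) (topology_of M) B \<and>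
          (\<forall>c\<in>B. \<forall>c'\<in>charts M. compatible (dimension M) c c'))"

definition smooth_between :: "'a smooth_space \<Rightarrow> 'b smooth_space \<Rightarrow> ('a \<Rightarrow> 'b) \<Rightarrow> bool" where
  "smooth_between M N f \<longleftrightarrow>
     continuous_map (topology_of M) (topology_of N) f \<and>
     (\<forall>(U, \<phi>)\<in>charts M. \<forall>(V, \<psi>)\<in>charts N.
        smooth_map (dimension M) (\<phi> ` (U \<inter> f -` V)) (\<psi> \<circ> f \<circ> inv_into U \<phi>))"

definition diffeomorphic :: "'a smooth_space \<Rightarrow> 'b smooth_space \<Rightarrow> bool" where
  "diffeomorphic M N \<longleftrightarrow>
     (\<exists>f g. homeomorphic_maps (topology_of M) (topology_of N) f g \<and>
            smooth_between M N f \<and> smooth_between N M g)"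

text \<open>
  The smooth structure of a \<open>d\<close>-dimensional embedded submanifold \<open>S\<close> of a complex coordinate space,
  regarded as a real vector space. Its charts are the inverses of the regular parametrizations, that
  is, of the smooth immersions of open subsets of \<open>d\<close>-space that are homeomorphisms onto open subsets
  of \<open>S\<close>. Points of the coordinate space over a finite index set \<open>I\<close> are functions that are
  \<^const>\<open>undefined\<close> off \<open>I\<close>; these constant coordinates affect neither the topology nor smoothness.
\<close>

definition submanifold :: "nat \<Rightarrow> (nat \<Rightarrow> complex) set \<Rightarrow> (nat \<Rightarrow> complex) smooth_space" where
  "submanifold d S =
     \<lparr> dimension = d,
       topology_of = top_of_set S,
       charts = {(U, \<phi>). is_chart d (top_of_set S) (U, \<phi>) \<and>
                         immersion d (\<phi> ` U) (inv_into U \<phi>)} \<rparr>"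

definition quotient_topology :: "'a topology \<Rightarrow> ('a \<Rightarrow> 'b) \<Rightarrow> 'b topology" where
  "quotient_topology X p =
     topology (\<lambda>V. V \<subseteq> p ` topspace X \<and> openin X {x \<in> topspace X. p x \<in> V})"

lemma openin_quotient_topology:
  "openin (quotient_topology X p) V \<longleftrightarrow>
     V \<subseteq> p ` topspace X \<and> openin X {x \<in> topspace X. p x \<in> V}"
proof -
  have "istopology (\<lambda>V. V \<subseteq> p ` topspace X \<and> openin X {x \<in> topspace X. p x \<in> V})"
    unfolding istopology_def
  proof (intro conjI allI impI)
    fix V W
    assume V: "V \<subseteq> p ` topspace X \<and> openin X {x \<in> topspace X. p x \<in> V}"
      and W: "W \<subseteq> p ` topspace X \<and> openin X {x \<in> topspace X. p x \<in> W}"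
    have "{x \<in> topspace X. p x \<in> V \<inter> W} =
        {x \<in> topspace X. p x \<in> V} \<inter> {x \<in> topspace X. p x \<in> W}"
      by blast
    then show "openin X {x \<in> topspace X. p x \<in> V \<inter> W}"
      using V W by (simp add: openin_Int)
    show "V \<inter> W \<subseteq> p ` topspace X"
      using V by blast
  next
    fix \<V>
    assume *: "\<forall>V\<in>\<V>. V \<subseteq> p ` topspace X \<and> openin X {x \<in> topspace X. p x \<in> V}"
    have "{x \<in> topspace X. p x \<in> \<Union>\<V>} = (\<Union>V\<in>\<V>. {x \<in> topspace X. p x \<in> V})"
      by blast
    then show "openin X {x \<in> topspace X. p x \<in> \<Union>\<V>}"
      using * by auto
    show "\<Union>\<V> \<subseteq> p ` topspace X"
      using * by blast
  qed
  then show ?thesis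
    by (simp add: quotient_topology_def)
qed

lemma topspace_quotient_topology: "topspace (quotient_topology X p) = p ` topspace X"
proof (rule antisym)
  show "topspace (quotient_topology X p) \<subseteq> p ` topspace X"
    using openin_quotient_topology[of X p] openin_topspace by blast
  have "{x \<in> topspace X. p x \<in> p ` topspace X} = topspace X"
    by blast
  then have "openin (quotient_topology X p) (p ` topspace X)"
    by (simp add: openin_quotient_topology)
  then show "p ` topspace X \<subseteq> topspace (quotient_topology X p)"
    by (rule openin_subset)
qed

text \<open>
  The quotient of a manifold by a free action of a finite group of diffeomorphisms, with \<open>p\<close> the
  orbit map. The charts of the quotient are the charts of the manifold whose domain \<open>U\<close> meets each
  orbit at most once, pushed down along \<open>p\<close>; this makes \<open>p\<close> a local diffeomorphism.
\<close>

definition quotient_manifold :: "'a smooth_space \<Rightarrow> ('a \<Rightarrow> 'b) \<Rightarrow> 'b smooth_space" where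
  "quotient_manifold M p =
     \<lparr> dimension = dimension M,
       topology_of = quotient_topology (topology_of M) p,
       charts = {(p ` U, \<phi> \<circ> inv_into U p) | U \<phi>. (U, \<phi>) \<in> charts M \<and> inj_on p U} \<rparr>"

section \<open>Planar polygon spaces\<close>

definition length_vector :: "nat \<Rightarrow> (nat \<Rightarrow> real) \<Rightarrow> bool" where
  "length_vector n l \<longleftrightarrow> (\<forall>i\<in>{1..n}. l i > 0)"

definition generic :: "nat \<Rightarrow> (nat \<Rightarrow> real) \<Rightarrow> bool" where
  "generic n l \<longleftrightarrow> \<not> (\<exists>S\<subseteq>{1..n}. (\<Sum>i\<in>S. l i) = (\<Sum>i\<in>{1..n} - S. l i))"

definition torus_set :: "nat \<Rightarrow> (nat \<Rightarrow> complex) set" where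
  "torus_set d = PiE {1..d} (\<lambda>_. sphere 0 1)"

definition torus :: "nat \<Rightarrow> (nat \<Rightarrow> complex) smooth_space" where
  "torus d = submanifold d (torus_set d)"

definition polygon_set :: "nat \<Rightarrow> (nat \<Rightarrow> real) \<Rightarrow> (nat \<Rightarrow> complex) set" where
  "polygon_set n l =
     {z \<in> torus_set (n - 1). (\<Sum>j=1..n-1. complex_of_real (l j) * z j) = complex_of_real (l n)}"

definition polygon_space :: "nat \<Rightarrow> (nat \<Rightarrow> real) \<Rightarrow> (nat \<Rightarrow> complex) smooth_space" where
  "polygon_space n l = submanifold (n - 3) (polygon_set n l)"

definition conjugation :: "nat \<Rightarrow> (nat \<Rightarrow> complex) \<Rightarrow> (nat \<Rightarrow> complex)" where
  "conjugation n z = (\<lambda>j\<in>{1..n-1}. cnj (z j))"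

definition isometry_class :: "nat \<Rightarrow> (nat \<Rightarrow> complex) \<Rightarrow> (nat \<Rightarrow> complex) set" where
  "isometry_class n z = {z, conjugation n z}"

definition reduced_polygon_space ::
    "nat \<Rightarrow> (nat \<Rightarrow> real) \<Rightarrow> (nat \<Rightarrow> complex) set smooth_space" where
  "reduced_polygon_space n l = quotient_manifold (polygon_space n l) (isometry_class n)"

end

theory Submission
  imports Defs
begin

text \<open>
  The polygon space is the preimage of a regular value of a map from the torus to the plane. Its normal
  bundle in the torus has a frame, the gradients of the two components of the closing condition, and
  the torus is parallelizable; so the polygon space carries a nowhere vanishing volume form. Complex
  conjugation reverses the \<open>n - 3\<close> tangential directions and the gradient of the real component, and
  fixes the gradient of the imaginary component. Hence it multiplies the form by \<open>(-1)\<^sup>n\<close>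
  (lemma \<open>conjugate_chart\<close>).

  If \<open>n\<close> is even, the form descends to the quotient and orients it (\<open>orientable_if_sign\<close>). If \<open>n\<close> is odd,
  an orientation of the quotient, lifted to the polygon space, differs from the form by a locally
  constant sign that changes under conjugation; so there is none as soon as a connected set contains
  a polygon and its mirror image (\<open>not_orientable_if_connected\<close>).

  The combinatorics of long and short sets of edges leaves two cases
  (\<open>three_long_edges_or_minimal_long\<close>). If any two of some three edges are together longer than
  the rest, then the directions of the other edges relative to the third of these are arbitrary
  and determine the class of the polygon; this is a diffeomorphism of the quotient with a torus
  (\<open>diffeomorphic_torus\<close>). Otherwise there is a minimal long set with at least three elements. Grouping
  its edges into three rigid bars, and the remaining edges into a fourth, yields a quadrilateral linkage
  that can be moved into its mirror image (\<open>connected_to_conjugate\<close>); so for odd \<open>n\<close> the quotient is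
  not orientable. As a torus is orientable and orientability is invariant under diffeomorphisms
  (\<open>orientable_if_diffeomorphic\<close>), the two cases give the equivalence.

  Smoothness, defined by iterated partial derivatives, requires some calculus: the chain rule and the
  smoothness of the inverse of a regular homeomorphism (\<open>smooth_map_inverse\<close>). The latter shows that maps into
  the polygon space or the torus are smooth in every chart if they are smooth as maps to the ambient
  space (\<open>smooth_map_chart_comp\<close>).
\<close>

section \<open>Calculus in coordinates\<close>

subsection \<open>Open sets of the coordinate spaces\<close>

abbreviation coord_space :: "nat \<Rightarrow> (nat \<Rightarrow> real) set" where
  "coord_space d \<equiv> topspace (Euclidean_space d)"

lemma coord_space_iff: "x \<in> coord_space d \<longleftrightarrow> (\<forall>i\<ge>d. x i = 0)"
  by (simp add: topspace_Euclidean_space)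

lemma Euclidean_space_eq: "Euclidean_space d = top_of_set (coord_space d)"
  by (simp add: Euclidean_space_def euclidean_product_topology)

lemma openin_Euclidean_space_open:
  "openin (Euclidean_space d) U \<longleftrightarrow> (\<exists>T. open T \<and> U = coord_space d \<inter> T)"
  by (subst Euclidean_space_eq) (simp add: openin_open)

lemma openin_Euclidean_space_trans:
  "openin (top_of_set U) V \<Longrightarrow> openin (Euclidean_space d) U \<Longrightarrow> openin (Euclidean_space d) V"
  using openin_trans[of U V "coord_space d"] by (simp add: Euclidean_space_eq[symmetric])

lemma openin_Euclidean_space_iff:
  "openin (Euclidean_space d) U \<longleftrightarrow> U \<subseteq> coord_space d \<and>
     (\<forall>x\<in>U. \<exists>r>0. \<forall>y\<in>coord_space d. (\<forall>i<d. \<bar>y i - x i\<bar> < r) \<longrightarrow> y \<in> U)"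
  (is "_ \<longleftrightarrow> _ \<and> (\<forall>x\<in>U. ?P x)")
proof (intro iffI conjI ballI)
  assume U: "openin (Euclidean_space d) U"
  show "U \<subseteq> coord_space d" using U by (rule openin_subset)
  fix x assume x: "x \<in> U"
  obtain T where T: "open T" "U = coord_space d \<inter> T"
    using U unfolding openin_Euclidean_space_open by blast
  have "openin (product_topology (\<lambda>i. euclidean) UNIV) T"
    using T by (simp add: euclidean_product_topology)
  then obtain X where X: "x \<in> PiE UNIV X" "\<And>i. open (X i)" "PiE UNIV X \<subseteq> T"
    using product_topology_open_contains_basis[of "\<lambda>i. euclidean" UNIV T x] x T by auto
  have "\<exists>r>0. \<forall>t. \<bar>t - x i\<bar> < r \<longrightarrow> t \<in> X i" for i
    using X(1) X(2)[of i] unfolding open_dist by (auto simp: dist_real_def PiE_iff)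
  then obtain r where r: "\<And>i. r i > 0" "\<And>i t. \<bar>t - x i\<bar> < r i \<Longrightarrow> t \<in> X i"
    by metis
  let ?R = "Min (insert 1 (r ` {..<d}))"
  have R: "?R > 0" "\<And>i. i < d \<Longrightarrow> ?R \<le> r i"
    using r(1) by (auto simp: Min_gr_iff)
  show "?P x"
  proof (intro exI[of _ ?R] conjI ballI impI)
    show "?R > 0" by (rule R)
    fix y assume y: "y \<in> coord_space d" "\<forall>i<d. \<bar>y i - x i\<bar> < ?R"
    have "y i \<in> X i" for i
    proof (cases "i < d")
      case True
      then show ?thesis using y(2) R(2)[of i] r(2)[of "y i" i] by fastforce
    next
      case False
      then have "y i = x i" using y(1) x T(2) by (auto simp: coord_space_iff)
      then show ?thesis using X(1) by auto
    qed
    then have "y \<in> PiE UNIV X" by auto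
    then show "y \<in> U" using X(3) T(2) y(1) by blast
  qed
next
  assume *: "U \<subseteq> coord_space d \<and> (\<forall>x\<in>U. ?P x)"
  show "openin (Euclidean_space d) U"
  proof (subst openin_subopen, intro ballI)
    fix x assume x: "x \<in> U"
    then obtain r where r: "r > 0" "\<And>y. y \<in> coord_space d \<Longrightarrow> (\<forall>i<d. \<bar>y i - x i\<bar> < r) \<Longrightarrow> y \<in> U"
      using * by blast
    let ?T = "\<Inter>i\<in>{..<d}. {y. \<bar>y i - x i\<bar> < r}"
    have "open {y. \<bar>y i - x i\<bar> < r}" for i
      by (intro open_Collect_less continuous_intros continuous_on_product_coordinates)
    then have "open ?T" by (intro open_INT) auto
    then have "openin (Euclidean_space d) (coord_space d \<inter> ?T)"
      unfolding openin_Euclidean_space_open by blast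
    moreover have "x \<in> coord_space d \<inter> ?T" "coord_space d \<inter> ?T \<subseteq> U"
      using x * r by auto
    ultimately show "\<exists>T. openin (Euclidean_space d) T \<and> x \<in> T \<and> T \<subseteq> U" by blast
  qed
qed

lemma eventually_line_in_open:
  assumes "openin (Euclidean_space d) U" "x \<in> U" "i < d"
  shows "\<forall>\<^sub>F t in nhds (x i). x(i := t) \<in> U"
proof -
  obtain r where r: "r > 0" "\<And>y. y \<in> coord_space d \<Longrightarrow> (\<forall>i<d. \<bar>y i - x i\<bar> < r) \<Longrightarrow> y \<in> U"
    and U: "U \<subseteq> coord_space d"
    using assms(1,2) unfolding openin_Euclidean_space_iff by blast
  show ?thesis
    unfolding eventually_nhds_metric
  proof (intro exI[of _ r] conjI allI impI r(1))
    fix t assume "dist t (x i) < r"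
    then have "\<forall>j<d. \<bar>(x(i := t)) j - x j\<bar> < r" using r(1) by (auto simp: dist_real_def)
    moreover have "x(i := t) \<in> coord_space d" using assms U by (auto simp: coord_space_iff)
    ultimately show "x(i := t) \<in> U" using r(2) by blast
  qed
qed

lemma continuous_on_box:
  assumes U: "openin (Euclidean_space d) U" and f: "continuous_on U f" and x: "x \<in> U" and e: "e > 0"
  shows "\<exists>r>0. \<forall>y\<in>coord_space d. (\<forall>i<d. \<bar>y i - x i\<bar> < r) \<longrightarrow> y \<in> U \<and> dist (f y) (f x) < e"
proof -
  have "openin (top_of_set U) (U \<inter> f -` ball (f x) e)"
    using continuous_openin_preimage_gen[OF f] open_ball by blast
  then have "openin (Euclidean_space d) (U \<inter> f -` ball (f x) e)"
    using U by (rule openin_Euclidean_space_trans)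
  moreover have "x \<in> U \<inter> f -` ball (f x) e" using x e by simp
  ultimately obtain r where r: "r > 0"
    "\<And>y. y \<in> coord_space d \<Longrightarrow> (\<forall>i<d. \<bar>y i - x i\<bar> < r) \<Longrightarrow> y \<in> U \<inter> f -` ball (f x) e"
    unfolding openin_Euclidean_space_iff by meson
  then show ?thesis by (intro exI[of _ r]) (simp add: dist_commute)
qed

text \<open>
  The sets concerned are open only relative to the coordinate space, so the familiar local
  characterizations of continuity for open sets do not apply literally.
\<close>

lemma continuous_on_Euclidean_local:
  assumes U: "U \<subseteq> coord_space d"
    and *: "\<And>x. x \<in> U \<Longrightarrow> \<exists>V. openin (Euclidean_space d) V \<and> x \<in> V \<and> continuous_on V f"
  shows "continuous_on U f"
  unfolding continuous_on_eq_continuous_within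
proof
  fix x assume x: "x \<in> U"
  obtain V where V: "openin (Euclidean_space d) V" "x \<in> V" "continuous_on V f" using *[OF x] by blast
  then obtain T where T: "open T" "V = coord_space d \<inter> T"
    unfolding openin_Euclidean_space_open by blast
  have "continuous (at x within V) f" using V by (simp add: continuous_on_eq_continuous_within)
  moreover have "T \<inter> U \<subseteq> V" using T U by blast
  ultimately have "continuous (at x within (T \<inter> U)) f" using continuous_within_subset by blast
  moreover have "at x within (T \<inter> U) = at x within U"
    using T V by (intro at_within_nhd[of _ T]) auto
  ultimately show "continuous (at x within U) f" by simp
qed

subsection \<open>Algebra of differentiable functions\<close>

abbreviation tcd ::
    "nat \<Rightarrow> nat \<Rightarrow> (nat \<Rightarrow> real) set \<Rightarrow> ((nat \<Rightarrow> real) \<Rightarrow> 'b::real_normed_vector) \<Rightarrow> bool" where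
  "tcd \<equiv> times_continuously_differentiable"

abbreviation has_partial ::
    "((nat \<Rightarrow> real) \<Rightarrow> 'b::real_normed_vector) \<Rightarrow> nat \<Rightarrow> (nat \<Rightarrow> real) \<Rightarrow> 'b \<Rightarrow> bool" where
  "has_partial f i x D \<equiv> ((\<lambda>t. f (x(i := t))) has_vector_derivative D) (at (x i))"

lemma partial_derivative_eqI: "has_partial f i x D \<Longrightarrow> partial_derivative i f x = D"
  unfolding partial_derivative_def by (rule vector_derivative_at)

lemma tcd_has_partial:
  "tcd d (Suc k) U f \<Longrightarrow> x \<in> U \<Longrightarrow> i < d \<Longrightarrow> has_partial f i x (partial_derivative i f x)"
  by (simp add: partial_derivative_def vector_derivative_works[symmetric])

lemma tcd_partial: "tcd d (Suc k) U f \<Longrightarrow> i < d \<Longrightarrow> tcd d k U (partial_derivative i f)"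
  by simp

lemma tcd_continuous_on: "tcd d k U f \<Longrightarrow> continuous_on U f"
  by (cases k) auto

lemma tcd_subset: "tcd d k U f \<Longrightarrow> V \<subseteq> U \<Longrightarrow> tcd d k V f"
  by (induction k arbitrary: f) (auto intro: continuous_on_subset)

lemma tcd_SucD: "tcd d (Suc k) U f \<Longrightarrow> tcd d k U f"
  by (induction k arbitrary: f) auto

lemma tcd_mono: "tcd d k U f \<Longrightarrow> l \<le> k \<Longrightarrow> tcd d l U f"
  by (induction k) (auto simp del: times_continuously_differentiable.simps(2) simp: le_Suc_eq dest: tcd_SucD)

lemma has_partial_cong:
  assumes "openin (Euclidean_space d) U" "\<And>y. y \<in> U \<Longrightarrow> f y = g y" "x \<in> U" "i < d"
  shows "has_partial f i x D \<longleftrightarrow> has_partial g i x D"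
proof (rule has_vector_derivative_cong_ev)
  have "\<forall>\<^sub>F t in nhds (x i). f (x(i := t)) = g (x(i := t))"
    using eventually_line_in_open[OF assms(1,3,4)] by eventually_elim (use assms in auto)
  then show "\<forall>\<^sub>F t in nhds (x i). t \<in> UNIV \<longrightarrow> f (x(i := t)) = g (x(i := t))" by simp
  show "f (x(i := x i)) = g (x(i := x i))" using assms by simp
qed

lemma partial_derivative_cong:
  assumes "openin (Euclidean_space d) U" "\<And>y. y \<in> U \<Longrightarrow> f y = g y" "x \<in> U" "i < d"
  shows "partial_derivative i f x = partial_derivative i g x"
proof -
  have "has_partial f i x D \<longleftrightarrow> has_partial g i x D" for D
    using assms by (rule has_partial_cong)
  then show ?thesis unfolding partial_derivative_def vector_derivative_def by presburger
qed

text \<open>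
  A function is differentiable once more as soon as it has some partial derivatives of the right
  regularity. Passing to the operator \<^const>\<open>partial_derivative\<close>, which is determined by the function
  only inside \<open>U\<close>, needs invariance under change of the function off \<open>U\<close>. That invariance is itself
  proved by this step of the induction, so here it is a hypothesis.
\<close>

lemma tcd_SucI_aux:
  assumes U: "openin (Euclidean_space d) U" and f: "continuous_on U f"
    and "\<And>i. i < d \<Longrightarrow> \<exists>f'. (\<forall>x\<in>U. has_partial f i x (f' x)) \<and> tcd d k U f'"
    and cong: "\<And>f g :: _ \<Rightarrow> 'b. (\<And>x. x \<in> U \<Longrightarrow> f x = g x) \<Longrightarrow> tcd d k U f \<Longrightarrow> tcd d k U g"
  shows "tcd d (Suc k) U (f :: _ \<Rightarrow> 'b :: real_normed_vector)"
proof -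
  { fix i assume i: "i < d"
    then obtain f' where f': "\<forall>x\<in>U. has_partial f i x (f' x)" "tcd d k U f'" using assms(3) by blast
    then have "tcd d k U (partial_derivative i f)"
      by (intro cong[OF _ f'(2)]) (auto intro!: partial_derivative_eqI[symmetric])
    moreover have "\<forall>x\<in>U. (\<lambda>t. f (x(i := t))) differentiable at (x i)"
      using f' differentiableI_vector by blast
    ultimately have "(\<forall>x\<in>U. (\<lambda>t. f (x(i := t))) differentiable at (x i)) \<and>
      tcd d k U (partial_derivative i f)" by blast }
  then show ?thesis using f by simp
qed

lemma tcd_cong:
  assumes U: "openin (Euclidean_space d) U"
  shows "(\<And>x. x \<in> U \<Longrightarrow> f x = g x) \<Longrightarrow> tcd d k U f \<Longrightarrow> tcd d k U g"
proof (induction k arbitrary: f g)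
  case 0
  then show ?case using continuous_on_cong[of U U f g] by simp
next
  case (Suc k)
  show ?case
  proof (rule tcd_SucI_aux[OF U])
    have "continuous_on U f" using Suc.prems(2) by simp
    then show "continuous_on U g" using Suc.prems(1) continuous_on_cong[of U U f g] by simp
    show "\<exists>f'. (\<forall>x\<in>U. has_partial g i x (f' x)) \<and> tcd d k U f'" if i: "i < d" for i
    proof (intro exI[of _ "partial_derivative i f"] conjI ballI)
      show "has_partial g i x (partial_derivative i f x)" if "x \<in> U" for x
        using has_partial_cong[where f = f and g = g, OF U Suc.prems(1) that i] tcd_has_partial[OF Suc.prems(2) that i] by blast
      show "tcd d k U (partial_derivative i f)" using Suc.prems(2) i by simp
    qed
    show "tcd d k U f \<Longrightarrow> tcd d k U g" if "\<And>x. x \<in> U \<Longrightarrow> f x = g x" for f g :: "_ \<Rightarrow> 'a"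
      using Suc.IH that by blast
  qed
qed

lemma tcd_SucI:
  assumes U: "openin (Euclidean_space d) U" and "continuous_on U f"
    and "\<And>i. i < d \<Longrightarrow> \<exists>f'. (\<forall>x\<in>U. has_partial f i x (f' x)) \<and> tcd d k U f'"
  shows "tcd d (Suc k) U f"
  by (rule tcd_SucI_aux[OF assms], assumption) (erule tcd_cong[OF U, rotated], blast)

lemma tcd_local:
  assumes U: "openin (Euclidean_space d) U"
    and *: "\<And>x. x \<in> U \<Longrightarrow> \<exists>V. openin (Euclidean_space d) V \<and> x \<in> V \<and> tcd d k V f"
  shows "tcd d k U f"
  using *
proof (induction k arbitrary: f)
  case 0
  have "continuous_on U f"
    by (rule continuous_on_Euclidean_local[OF openin_subset[OF U]]) (metis 0 tcd_continuous_on)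
  then show ?case by simp
next
  case (Suc k)
  show ?case
  proof (rule tcd_SucI[OF U])
    show "continuous_on U f"
      by (rule continuous_on_Euclidean_local[OF openin_subset[OF U]]) (metis Suc.prems tcd_continuous_on)
    show "\<exists>f'. (\<forall>x\<in>U. has_partial f i x (f' x)) \<and> tcd d k U f'" if i: "i < d" for i
    proof (intro exI[of _ "partial_derivative i f"] conjI ballI)
      show "has_partial f i x (partial_derivative i f x)" if "x \<in> U" for x
        using Suc.prems[OF that] tcd_has_partial i by blast
      show "tcd d k U (partial_derivative i f)"
        using Suc.prems tcd_partial[OF _ i] by (intro Suc.IH) blast
    qed
  qed
qed

lemma tcd_const [simp]: "openin (Euclidean_space d) U \<Longrightarrow> tcd d k U (\<lambda>x. c)"
proof (induction k arbitrary: c)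
  case (Suc k)
  show ?case
    by (rule tcd_SucI[OF Suc.prems])
      (auto intro!: exI[of _ "\<lambda>x. 0"] Suc has_vector_derivative_const)
qed simp

lemma tcd_coord:
  assumes U: "openin (Euclidean_space d) U" shows "tcd d k U (\<lambda>x. x j)"
proof (cases k)
  case 0
  then show ?thesis by (simp add: continuous_on_subset[OF continuous_on_product_coordinates])
next
  case (Suc k)
  show ?thesis unfolding Suc
  proof (rule tcd_SucI[OF U])
    show "continuous_on U (\<lambda>x. x j)"
      by (simp add: continuous_on_subset[OF continuous_on_product_coordinates])
    show "\<exists>f'. (\<forall>x\<in>U. has_partial (\<lambda>x. x j) i x (f' x)) \<and> tcd d k U f'" if i: "i < d" for i
    proof (intro exI[of _ "\<lambda>x. if i = j then 1 else 0"] conjI ballI)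
      show "has_partial (\<lambda>x. x j) i x (if i = j then 1 else 0)" for x
        by (cases "i = j") (auto intro: has_vector_derivative_const simp: has_vector_derivative_id)
    qed (simp add: U)
  qed
qed

lemma tcd_add:
  assumes U: "openin (Euclidean_space d) U"
  shows "tcd d k U f \<Longrightarrow> tcd d k U g \<Longrightarrow> tcd d k U (\<lambda>x. f x + g x)"
proof (induction k arbitrary: f g)
  case (Suc k)
  show ?case
  proof (rule tcd_SucI[OF U])
    show "continuous_on U (\<lambda>x. f x + g x)" using Suc.prems by (auto intro: continuous_intros)
    show "\<exists>f'. (\<forall>x\<in>U. has_partial (\<lambda>x. f x + g x) i x (f' x)) \<and> tcd d k U f'" if i: "i < d" for i
      by (intro exI[of _ "\<lambda>x. partial_derivative i f x + partial_derivative i g x"] conjI ballI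
          has_vector_derivative_add tcd_has_partial[OF Suc.prems(1) _ i] tcd_has_partial[OF Suc.prems(2) _ i]
          Suc.IH tcd_partial[OF Suc.prems(1) i] tcd_partial[OF Suc.prems(2) i])
  qed
qed (auto intro: continuous_intros)

lemma tcd_linear:
  assumes U: "openin (Euclidean_space d) U" and L: "bounded_linear L"
  shows "tcd d k U f \<Longrightarrow> tcd d k U (\<lambda>x. L (f x))"
proof (induction k arbitrary: f)
  case 0 then show ?case by (auto intro: bounded_linear.continuous_on[OF L])
next
  case (Suc k)
  show ?case
  proof (rule tcd_SucI[OF U])
    show "continuous_on U (\<lambda>x. L (f x))" using Suc.prems by (auto intro: bounded_linear.continuous_on[OF L])
    show "\<exists>f'. (\<forall>x\<in>U. has_partial (\<lambda>x. L (f x)) i x (f' x)) \<and> tcd d k U f'" if i: "i < d" for i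
      by (intro exI[of _ "\<lambda>x. L (partial_derivative i f x)"] conjI ballI
          bounded_linear.has_vector_derivative[OF L] tcd_has_partial[OF Suc.prems(1) _ i]
          Suc.IH tcd_partial[OF Suc.prems(1) i])
  qed
qed

lemma tcd_bilinear:
  assumes U: "openin (Euclidean_space d) U" and B: "bounded_bilinear B"
  shows "tcd d k U f \<Longrightarrow> tcd d k U g \<Longrightarrow> tcd d k U (\<lambda>x. B (f x) (g x))"
proof (induction k arbitrary: f g)
  case 0 then show ?case by (auto intro: bounded_bilinear.continuous_on[OF B])
next
  case (Suc k)
  show ?case
  proof (rule tcd_SucI[OF U])
    show "continuous_on U (\<lambda>x. B (f x) (g x))"
      using Suc.prems by (auto intro: bounded_bilinear.continuous_on[OF B])
    show "\<exists>f'. (\<forall>x\<in>U. has_partial (\<lambda>x. B (f x) (g x)) i x (f' x)) \<and> tcd d k U f'" if i: "i < d" for i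
    proof (intro exI[of _ "\<lambda>x. B (f x) (partial_derivative i g x) + B (partial_derivative i f x) (g x)"]
        conjI ballI)
      fix x assume x: "x \<in> U"
      show "has_partial (\<lambda>x. B (f x) (g x)) i x
         (B (f x) (partial_derivative i g x) + B (partial_derivative i f x) (g x))"
        using bounded_bilinear.has_vector_derivative[OF B tcd_has_partial[OF Suc.prems(1) x i]
            tcd_has_partial[OF Suc.prems(2) x i]] by (simp only: fun_upd_triv)
    next
      show "tcd d k U (\<lambda>x. B (f x) (partial_derivative i g x) + B (partial_derivative i f x) (g x))"
        by (intro tcd_add[OF U] Suc.IH tcd_SucD[OF Suc.prems(1)] tcd_SucD[OF Suc.prems(2)]
            tcd_partial[OF Suc.prems(1) i] tcd_partial[OF Suc.prems(2) i])
    qed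
  qed
qed

lemmas tcd_mult = tcd_bilinear[OF _ bounded_bilinear_mult]
lemmas tcd_scaleR = tcd_bilinear[OF _ bounded_bilinear_scaleR]

lemma tcd_minus: "openin (Euclidean_space d) U \<Longrightarrow> tcd d k U f \<Longrightarrow> tcd d k U (\<lambda>x. - f x)"
  by (rule tcd_linear[OF _ bounded_linear_minus[OF bounded_linear_ident]])

lemma tcd_diff:
  "openin (Euclidean_space d) U \<Longrightarrow> tcd d k U f \<Longrightarrow> tcd d k U g \<Longrightarrow> tcd d k U (\<lambda>x. f x - g x)"
  using tcd_add[of d U k f "\<lambda>x. - g x"] tcd_minus[of d U k g] by simp

lemma tcd_sum:
  assumes U: "openin (Euclidean_space d) U"
  shows "(\<And>a. a \<in> A \<Longrightarrow> tcd d k U (f a)) \<Longrightarrow> tcd d k U (\<lambda>x. \<Sum>a\<in>A. f a x)"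
proof (induction A rule: infinite_finite_induct)
  case (insert a A)
  then show ?case by (simp add: tcd_add[OF U])
qed (simp_all add: U)

lemma tcd_prod:
  fixes f :: "'a \<Rightarrow> _ \<Rightarrow> 'b::{real_normed_algebra,comm_ring_1}"
  assumes U: "openin (Euclidean_space d) U"
  shows "(\<And>a. a \<in> A \<Longrightarrow> tcd d k U (f a)) \<Longrightarrow> tcd d k U (\<lambda>x. \<Prod>a\<in>A. f a x)"
proof (induction A rule: infinite_finite_induct)
  case (insert a A)
  then show ?case by (simp add: tcd_mult[OF U])
qed (simp_all add: U)

lemma tcd_inverse:
  fixes f :: "_ \<Rightarrow> real"
  assumes U: "openin (Euclidean_space d) U" and nz: "\<And>x. x \<in> U \<Longrightarrow> f x \<noteq> 0"
  shows "tcd d k U f \<Longrightarrow> tcd d k U (\<lambda>x. inverse (f x))"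
proof (induction k)
  case 0 then show ?case using nz by (auto intro!: continuous_intros)
next
  case (Suc k)
  show ?case
  proof (rule tcd_SucI[OF U])
    show "continuous_on U (\<lambda>x. inverse (f x))" using Suc.prems nz by (auto intro!: continuous_intros)
    show "\<exists>f'. (\<forall>x\<in>U. has_partial (\<lambda>x. inverse (f x)) i x (f' x)) \<and> tcd d k U f'" if i: "i < d" for i
    proof (intro exI[of _ "\<lambda>x. - (inverse (f x) * partial_derivative i f x * inverse (f x))"] conjI ballI)
      fix x assume x: "x \<in> U"
      have "((\<lambda>t. f (x(i := t))) has_real_derivative (partial_derivative i f x)) (at (x i))"
        using tcd_has_partial[OF Suc.prems x i] by (simp only: has_real_derivative_iff_has_vector_derivative)
      from DERIV_inverse'[OF this, unfolded fun_upd_triv, OF nz[OF x]]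
      show "has_partial (\<lambda>x. inverse (f x)) i x (- (inverse (f x) * partial_derivative i f x * inverse (f x)))"
        by (simp only: has_real_derivative_iff_has_vector_derivative)
    next
      show "tcd d k U (\<lambda>x. - (inverse (f x) * partial_derivative i f x * inverse (f x)))"
        by (intro tcd_minus[OF U] tcd_mult[OF U] Suc.IH tcd_SucD[OF Suc.prems(1)] tcd_partial[OF Suc.prems i])
    qed
  qed
qed

lemma tcd_sqrt:
  fixes f :: "_ \<Rightarrow> real"
  assumes U: "openin (Euclidean_space d) U" and nz: "\<And>x. x \<in> U \<Longrightarrow> f x > 0"
  shows "tcd d k U f \<Longrightarrow> tcd d k U (\<lambda>x. sqrt (f x))"
proof (induction k)
  case 0 then show ?case by (auto intro!: continuous_intros)
next
  case (Suc k)
  show ?case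
  proof (rule tcd_SucI[OF U])
    show "continuous_on U (\<lambda>x. sqrt (f x))" using Suc.prems nz by (auto intro!: continuous_intros)
    show "\<exists>f'. (\<forall>x\<in>U. has_partial (\<lambda>x. sqrt (f x)) i x (f' x)) \<and> tcd d k U f'" if i: "i < d" for i
    proof (intro exI[of _ "\<lambda>x. inverse (2 * sqrt (f x)) * partial_derivative i f x"] conjI ballI)
      fix x assume x: "x \<in> U"
      have *: "((\<lambda>t. f (x(i := t))) has_real_derivative (partial_derivative i f x)) (at (x i))"
        using tcd_has_partial[OF Suc.prems x i] by (simp only: has_real_derivative_iff_has_vector_derivative)
      have "((\<lambda>t. sqrt (f (x(i := t)))) has_real_derivative
          (inverse (sqrt (f x)) / 2 * partial_derivative i f x)) (at (x i))"
        using DERIV_chain2[OF DERIV_real_sqrt *] nz[OF x] by (simp only: fun_upd_triv)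
      moreover have "inverse (sqrt (f x)) / 2 = inverse (2 * sqrt (f x))" by simp
      ultimately show "has_partial (\<lambda>x. sqrt (f x)) i x (inverse (2 * sqrt (f x)) * partial_derivative i f x)"
        by (simp only: has_real_derivative_iff_has_vector_derivative)
    next
      have "2 * sqrt (f x) \<noteq> 0" if "x \<in> U" for x using nz[OF that] by simp
      then show "tcd d k U (\<lambda>x. inverse (2 * sqrt (f x)) * partial_derivative i f x)"
        by (intro tcd_mult[OF U] tcd_inverse[OF U] tcd_const U Suc.IH tcd_SucD[OF Suc.prems(1)] tcd_partial[OF Suc.prems i])
    qed
  qed
qed

lemma tcd_det:
  fixes A :: "_ \<Rightarrow> nat \<Rightarrow> nat \<Rightarrow> real"
  assumes U: "openin (Euclidean_space d) U"
    and A: "\<And>i j. i < n \<Longrightarrow> j < n \<Longrightarrow> tcd d k U (\<lambda>x. A x i j)"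
  shows "tcd d k U (\<lambda>x. Determinant.det (Matrix.mat n n (\<lambda>(i, j). A x i j)))"
proof -
  have eq: "Determinant.det (Matrix.mat n n (\<lambda>(i, j). A x i j)) =
    (\<Sum>p\<in>{p. p permutes {0..<n}}. signof p * (\<Prod>i=0..<n. A x i (p i)))" for x
    unfolding det_def'[OF mat_carrier]
    by (intro sum.cong prod.cong arg_cong2[where f = "(*)"] refl)
      (auto simp: permutes_in_image dest: permutes_in_image)
  show ?thesis unfolding eq
    by (intro tcd_sum[OF U] tcd_mult[OF U] tcd_const U tcd_prod[OF U])
      (auto intro!: A dest: permutes_in_image)
qed

subsection \<open>The chain rule\<close>

lemma has_vector_derivative_little_o:
  "(g has_vector_derivative g') (at t0) \<longleftrightarrow>
    (\<forall>e>0. \<forall>\<^sub>F t in nhds t0. norm (g t - g t0 - (t - t0) *\<^sub>R g') \<le> e * \<bar>t - t0\<bar>)"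
  unfolding has_vector_derivative_def has_derivative_within_alt2 eventually_at_filter
  by (auto simp: bounded_linear_scaleR_left elim!: eventually_mono)

lemma uniform_radius:
  assumes "\<And>i. i < (d::nat) \<Longrightarrow> \<exists>r>0. Q i (r::real)" "\<And>i r s. Q i r \<Longrightarrow> s \<le> r \<Longrightarrow> Q i s"
  shows "\<exists>r>0. \<forall>i<d. Q i r"
  using assms(1)
proof (induction d)
  case 0
  show ?case by (intro exI[of _ 1]) simp
next
  case (Suc d)
  then obtain r s where "r > 0" "\<forall>i<d. Q i r" "s > 0" "Q d s" by (metis less_Suc_eq)
  then show ?case
    by (intro exI[of _ "min r s"]) (auto simp: less_Suc_eq intro: assms(2))
qed

lemma onorm_scaleR_bound: "norm v \<le> e \<Longrightarrow> onorm (\<lambda>h::real. h *\<^sub>R v) \<le> e"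
  by (rule onorm_le) (simp add: mult.commute[of e] mult_left_mono)

text \<open>
  Continuous partial derivatives make a function differentiable: moving from \<open>x\<close> to \<open>y\<close> along
  one coordinate at a time, the mean value inequality controls each of the steps.
\<close>

lemma total_differential:
  assumes U: "openin (Euclidean_space d) U" and f: "tcd d (Suc 0) U f" and x: "x \<in> U" and e: "e > 0"
  shows "\<exists>r>0. \<forall>y\<in>coord_space d. (\<forall>i<d. \<bar>y i - x i\<bar> < r) \<longrightarrow>
     norm (f y - f x - (\<Sum>i<d. (y i - x i) *\<^sub>R partial_derivative i f x)) \<le> e * (\<Sum>i<d. \<bar>y i - x i\<bar>)"
proof -
  define Q where "Q i r \<longleftrightarrow> (\<forall>y\<in>coord_space d. (\<forall>i<d. \<bar>y i - x i\<bar> < r) \<longrightarrow>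
      y \<in> U \<and> dist (partial_derivative i f y) (partial_derivative i f x) < e)" for i r
  have "\<exists>r>0. Q i r" if "i < d" for i
    unfolding Q_def using f that by (intro continuous_on_box[OF U _ x e]) simp
  moreover have "Q i s" if "Q i r" "s \<le> r" for i r s
    unfolding Q_def
  proof (intro ballI impI)
    fix y assume y: "y \<in> coord_space d" "\<forall>i<d. \<bar>y i - x i\<bar> < s"
    then have "\<forall>i<d. \<bar>y i - x i\<bar> < r" using that(2) by fastforce
    then show "y \<in> U \<and> dist (partial_derivative i f y) (partial_derivative i f x) < e"
      using that(1) y(1) unfolding Q_def by blast
  qed
  ultimately obtain r where r: "r > 0" "\<forall>i<d. Q i r" using uniform_radius[of d Q] by blast
  have xE: "x \<in> coord_space d" using openin_subset[OF U] x by blast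
  show ?thesis
  proof (intro exI[of _ r] conjI ballI impI r(1))
    fix y assume y: "y \<in> coord_space d" "\<forall>i<d. \<bar>y i - x i\<bar> < r"
    define p where "p k = (\<lambda>i. if i < k then y i else x i)" for k
    let ?L = "\<lambda>k. partial_derivative k f x"
    have p0: "p 0 = x" by (auto simp: p_def)
    have pd: "p d = y" using y(1) xE by (fastforce simp: p_def coord_space_iff)
    have step: "norm (f (p (Suc k)) - f (p k) - (y k - x k) *\<^sub>R ?L k) \<le> e * \<bar>y k - x k\<bar>" if k: "k < d" for k
    proof -
      define q where "q t = (p k)(k := t)" for t
      have q1: "q (y k) = p (Suc k)" "q (x k) = p k" by (auto simp: p_def q_def fun_eq_iff)
      have near: "q t \<in> U \<and> dist (partial_derivative k f (q t)) (?L k) < e"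
        if t: "t \<in> closed_segment (x k) (y k)" for t
      proof -
        have "\<bar>t - x k\<bar> \<le> \<bar>y k - x k\<bar>"
          using t by (auto simp: closed_segment_eq_real_ivl split: if_splits)
        then have "\<bar>q t i - x i\<bar> < r" if "i < d" for i
          using y(2) that k r(1) by (auto simp: q_def p_def intro: le_less_trans)
        moreover have "q t \<in> coord_space d"
          using y(1) xE k by (auto simp: q_def p_def coord_space_iff)
        ultimately show ?thesis using r(2) k unfolding Q_def by blast
      qed
      let ?g = "\<lambda>t. f (q t) - t *\<^sub>R ?L k"
      have "norm (?g (y k) - ?g (x k)) \<le> e * norm (y k - x k)"
      proof (rule differentiable_bound[where S = "closed_segment (x k) (y k)"
            and f' = "\<lambda>t h. h *\<^sub>R (partial_derivative k f (q t) - ?L k)"])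
        fix t assume t: "t \<in> closed_segment (x k) (y k)"
        have "has_partial f k (q t) (partial_derivative k f (q t))"
          using tcd_has_partial[OF f _ k] near[OF t] by blast
        then have "((\<lambda>t. f (q t)) has_vector_derivative partial_derivative k f (q t)) (at t)"
          by (simp add: q_def)
        moreover have "((\<lambda>t. t *\<^sub>R ?L k) has_vector_derivative ?L k) (at t)"
          using has_vector_derivative_scaleR[OF DERIV_ident has_vector_derivative_const, of "?L k" t] by simp
        ultimately have "(?g has_vector_derivative (partial_derivative k f (q t) - ?L k)) (at t)"
          by (rule has_vector_derivative_diff)
        then show "(?g has_derivative (\<lambda>h. h *\<^sub>R (partial_derivative k f (q t) - ?L k)))
            (at t within closed_segment (x k) (y k))"
          by (simp add: has_vector_derivative_def has_derivative_at_withinI)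
        show "onorm (\<lambda>h. h *\<^sub>R (partial_derivative k f (q t) - ?L k)) \<le> e"
          using near[OF t] by (intro onorm_scaleR_bound) (simp add: dist_norm)
      qed auto
      then show ?thesis by (simp add: q1 algebra_simps)
    qed
    have "f y - f x = (\<Sum>k<d. f (p (Suc k)) - f (p k))"
      using sum_lessThan_telescope[of "\<lambda>k. f (p k)" d] by (simp only: pd p0)
    then have "norm (f y - f x - (\<Sum>i<d. (y i - x i) *\<^sub>R ?L i))
        = norm (\<Sum>k<d. f (p (Suc k)) - f (p k) - (y k - x k) *\<^sub>R ?L k)"
      by (simp add: sum_subtractf)
    also have "\<dots> \<le> (\<Sum>k<d. e * \<bar>y k - x k\<bar>)"
      by (rule sum_norm_le) (use step in auto)
    finally show "norm (f y - f x - (\<Sum>i<d. (y i - x i) *\<^sub>R ?L i)) \<le> e * (\<Sum>i<d. \<bar>y i - x i\<bar>)"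
      by (simp add: sum_distrib_left)
  qed
qed

lemma has_vector_derivative_lipschitz:
  assumes "(g has_vector_derivative g') (at t0)"
  shows "\<forall>\<^sub>F t in nhds t0. norm (g t - g t0) \<le> (norm g' + 1) * \<bar>t - t0\<bar>"
proof -
  have "\<forall>\<^sub>F t in nhds t0. norm (g t - g t0 - (t - t0) *\<^sub>R g') \<le> 1 * \<bar>t - t0\<bar>"
    using assms unfolding has_vector_derivative_little_o by (elim allE[of _ 1]) simp
  then show ?thesis
  proof eventually_elim
    case (elim t)
    have "norm (g t - g t0) \<le> norm (g t - g t0 - (t - t0) *\<^sub>R g') + norm ((t - t0) *\<^sub>R g')"
      by (metis diff_add_cancel norm_triangle_ineq)
    moreover have "norm ((t - t0) *\<^sub>R g') = norm g' * \<bar>t - t0\<bar>" by simp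
    ultimately show ?case using elim by (simp only: distrib_right)
  qed
qed

text \<open>
  The chain rule is needed only along curves, because a partial derivative of a composite is the
  derivative along the image of a coordinate line.
\<close>

lemma has_vector_derivative_along_curve:
  assumes U: "openin (Euclidean_space d) U" and f: "tcd d (Suc 0) U f" and x: "c t0 \<in> U"
    and c: "\<forall>\<^sub>F t in nhds t0. c t \<in> coord_space d"
    and c': "\<And>j. j < d \<Longrightarrow> ((\<lambda>t. c t j) has_vector_derivative c' j) (at t0)"
  shows "((\<lambda>t. f (c t)) has_vector_derivative (\<Sum>j<d. c' j *\<^sub>R partial_derivative j f (c t0))) (at t0)"
proof -
  let ?L = "\<lambda>j. partial_derivative j f (c t0)"
  define R where "R t = f (c t) - f (c t0) - (\<Sum>j<d. (c t j - c t0 j) *\<^sub>R ?L j)" for t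
  have lin: "((\<lambda>t. \<Sum>j<d. (c t j - c t0 j) *\<^sub>R ?L j) has_vector_derivative (\<Sum>j<d. c' j *\<^sub>R ?L j)) (at t0)"
  proof (rule has_vector_derivative_sum)
    fix j assume "j \<in> {..<d}"
    then have "((\<lambda>t. c t j) has_real_derivative c' j) (at t0)"
      using c' by (simp add: has_real_derivative_iff_has_vector_derivative)
    then have "((\<lambda>t. c t j - c t0 j) has_real_derivative c' j) (at t0)"
      using DERIV_diff[OF _ DERIV_const, of "\<lambda>t. c t j" "c' j"] by simp
    from has_vector_derivative_scaleR[OF this has_vector_derivative_const]
    show "((\<lambda>t. (c t j - c t0 j) *\<^sub>R ?L j) has_vector_derivative c' j *\<^sub>R ?L j) (at t0)"
      by simp
  qed
  define K where "K = (\<Sum>j<d. norm (c' j) + 1)"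
  have K: "K \<ge> 0" by (auto simp: K_def intro!: sum_nonneg)
  have lip: "\<forall>\<^sub>F t in nhds t0. \<forall>j\<in>{..<d}. norm (c t j - c t0 j) \<le> (norm (c' j) + 1) * \<bar>t - t0\<bar>"
    by (intro eventually_ball_finite ballI has_vector_derivative_lipschitz c') auto
  have tend: "\<forall>\<^sub>F t in nhds t0. \<forall>j\<in>{..<d}. \<bar>c t j - c t0 j\<bar> < r" if "r > 0" for r
  proof (intro eventually_ball_finite ballI)
    fix j assume "j \<in> {..<d}"
    then have "isCont (\<lambda>t. c t j) t0"
      using c' has_vector_derivative_continuous by blast
    then have "((\<lambda>t. c t j) \<longlongrightarrow> c t0 j) (nhds t0)"
      using tendsto_at_iff_tendsto_nhds[of "\<lambda>t. c t j" t0] by (simp add: continuous_at)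
    then show "\<forall>\<^sub>F t in nhds t0. \<bar>c t j - c t0 j\<bar> < r"
      using that unfolding tendsto_iff dist_real_def by blast
  qed simp
  have "(R has_vector_derivative 0) (at t0)"
    unfolding has_vector_derivative_little_o
  proof (intro allI impI)
    fix e :: real assume e: "e > 0"
    define e' where "e' = e / (K + 1)"
    have e': "e' > 0" "e' * K \<le> e" using e K by (auto simp: e'_def field_simps)
    obtain r where r: "r > 0" "\<forall>y\<in>coord_space d. (\<forall>i<d. \<bar>y i - c t0 i\<bar> < r) \<longrightarrow>
     norm (f y - f (c t0) - (\<Sum>i<d. (y i - c t0 i) *\<^sub>R ?L i)) \<le> e' * (\<Sum>i<d. \<bar>y i - c t0 i\<bar>)"
      using total_differential[OF U f x e'(1)] by blast
    show "\<forall>\<^sub>F t in nhds t0. norm (R t - R t0 - (t - t0) *\<^sub>R 0) \<le> e * \<bar>t - t0\<bar>"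
      using tend[OF r(1)] lip c
    proof eventually_elim
      case (elim t)
      have "norm (R t) \<le> e' * (\<Sum>i<d. \<bar>c t i - c t0 i\<bar>)"
        using r(2) elim(1,3) by (auto simp: R_def)
      also have "\<dots> \<le> e' * (\<Sum>i<d. (norm (c' i) + 1) * \<bar>t - t0\<bar>)"
        using elim(2) e'(1) by (intro mult_left_mono sum_mono) auto
      also have "\<dots> = (e' * K) * \<bar>t - t0\<bar>"
        by (simp add: K_def sum_distrib_right)
      also have "\<dots> \<le> e * \<bar>t - t0\<bar>" using e'(2) by (intro mult_right_mono) auto
      finally show ?case by (simp add: R_def[of t0])
    qed
  qed
  from has_vector_derivative_add[OF has_vector_derivative_add[OF this lin] has_vector_derivative_const[of "f (c t0)"]]
  show ?thesis by (simp add: R_def)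
qed

lemma has_partial_compose:
  assumes V: "openin (Euclidean_space e) V" and U: "openin (Euclidean_space d) U"
    and f: "tcd e (Suc 0) V f" and g: "\<And>j. j < e \<Longrightarrow> tcd d (Suc 0) U (\<lambda>x. g x j)"
    and gV: "\<And>x. x \<in> U \<Longrightarrow> g x \<in> V" and x: "x \<in> U" and i: "i < d"
  shows "has_partial (\<lambda>x. f (g x)) i x
     (\<Sum>j<e. partial_derivative i (\<lambda>x. g x j) x *\<^sub>R partial_derivative j f (g x))"
proof -
  have "((\<lambda>t. f (g (x(i := t)))) has_vector_derivative
     (\<Sum>j<e. partial_derivative i (\<lambda>x. g x j) x *\<^sub>R partial_derivative j f (g (x(i := x i))))) (at (x i))"
  proof (rule has_vector_derivative_along_curve[OF V f])
    show "g (x(i := x i)) \<in> V" using gV x by (simp only: fun_upd_triv)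
    show "\<forall>\<^sub>F t in nhds (x i). g (x(i := t)) \<in> coord_space e"
      using eventually_line_in_open[OF U x i] by eventually_elim (use gV openin_subset[OF V] in blast)
    show "((\<lambda>t. g (x(i := t)) j) has_vector_derivative partial_derivative i (\<lambda>x. g x j) x) (at (x i))"
      if "j < e" for j
      by (rule tcd_has_partial[OF g[OF that] x i])
  qed
  then show ?thesis by (simp only: fun_upd_triv)
qed

lemma continuous_on_coordinates:
  assumes "\<And>j. j < e \<Longrightarrow> continuous_on U (\<lambda>x. g x j)" "\<And>x. x \<in> U \<Longrightarrow> g x \<in> coord_space e"
  shows "continuous_on U g"
proof (rule continuous_on_coordinatewise_then_product)
  fix j
  show "continuous_on U (\<lambda>x. g x j)"
  proof (cases "j < e")
    case False
    then have "g x j = 0" if "x \<in> U" for x using assms(2)[OF that] by (simp add: coord_space_iff)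
    then show ?thesis using continuous_on_cong[of U U "\<lambda>x. g x j" "\<lambda>x. 0"] by simp
  qed (rule assms)
qed

lemma tcd_compose:
  assumes V: "openin (Euclidean_space e) V" and U: "openin (Euclidean_space d) U"
    and gV: "\<And>x. x \<in> U \<Longrightarrow> g x \<in> V"
  shows "tcd e k V f \<Longrightarrow> (\<And>j. j < e \<Longrightarrow> tcd d k U (\<lambda>x. g x j)) \<Longrightarrow> tcd d k U (\<lambda>x. f (g x))"
proof (induction k arbitrary: f)
  case 0
  have "continuous_on U g"
    by (rule continuous_on_coordinates[of e]) (use 0 gV openin_subset[OF V] in auto)
  then show ?case using 0 gV continuous_on_compose2[of V f U g] by auto
next
  case (Suc k)
  have g0: "tcd d k U (\<lambda>x. g x j)" if "j < e" for j using Suc.prems(2)[OF that] tcd_SucD by blast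
  have g1: "tcd d (Suc 0) U (\<lambda>x. g x j)" if "j < e" for j using Suc.prems(2)[OF that] by (rule tcd_mono) simp
  have f1: "tcd e (Suc 0) V f" using Suc.prems(1) by (rule tcd_mono) simp
  show ?case
  proof (rule tcd_SucI[OF U])
    show "continuous_on U (\<lambda>x. f (g x))"
      using Suc.IH[OF tcd_SucD[OF Suc.prems(1)] g0] tcd_continuous_on by blast
    fix i assume i: "i < d"
    show "\<exists>f'. (\<forall>x\<in>U. has_partial (\<lambda>x. f (g x)) i x (f' x)) \<and> tcd d k U f'"
    proof (intro exI conjI ballI)
      show "has_partial (\<lambda>x. f (g x)) i x
          (\<Sum>j<e. partial_derivative i (\<lambda>x. g x j) x *\<^sub>R partial_derivative j f (g x))" if "x \<in> U" for x
        by (rule has_partial_compose[OF V U f1 g1 gV that i])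
      show "tcd d k U (\<lambda>x. \<Sum>j<e. partial_derivative i (\<lambda>x. g x j) x *\<^sub>R partial_derivative j f (g x))"
      proof (intro tcd_sum[OF U] tcd_scaleR[OF U])
        fix j assume "j \<in> {..<e}"
        then have j: "j < e" by simp
        show "tcd d k U (partial_derivative i (\<lambda>x. g x j))" by (rule tcd_partial[OF Suc.prems(2)[OF j] i])
        show "tcd d k U (\<lambda>x. partial_derivative j f (g x))"
          by (rule Suc.IH[OF tcd_partial[OF Suc.prems(1) j] g0])
      qed
    qed
  qed
qed

subsection \<open>The inverse of a regular homeomorphism\<close>

definition jacobian_mat :: "nat \<Rightarrow> ((nat \<Rightarrow> real) \<Rightarrow> (nat \<Rightarrow> real)) \<Rightarrow> (nat \<Rightarrow> real) \<Rightarrow> real mat" where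
  "jacobian_mat d f x = Matrix.mat d d (\<lambda>(i, j). partial_derivative j (\<lambda>y. f y i) x)"

lemma jacobian_det_eq: "jacobian_det d f x = Determinant.det (jacobian_mat d f x)"
  by (simp add: jacobian_det_def jacobian_mat_def)

lemma matrix_left_inverse:
  fixes A :: "nat \<Rightarrow> nat \<Rightarrow> real" and d :: nat
  defines "M \<equiv> Matrix.mat d d (\<lambda>(i, j). A i j)"
  defines "B \<equiv> (\<lambda>i j. cofactor M j i / Determinant.det M)"
  assumes nz: "Determinant.det M \<noteq> 0" and i: "i < d" and j: "j < d"
  shows "(\<Sum>k<d. B i k * A k j) = (if i = j then 1 else 0)"
proof -
  have M: "M \<in> carrier_mat d d" by (simp add: M_def)
  have "(adj_mat M * M) $$ (i, j) = (Determinant.det M \<cdot>\<^sub>m 1\<^sub>m d) $$ (i, j)"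
    using adj_mat(3)[OF M] by simp
  moreover have "(adj_mat M * M) $$ (i, j) = (\<Sum>k<d. cofactor M k i * A k j)"
    using i j by (simp add: adj_mat_def M_def scalar_prod_def lessThan_atLeast0)
  ultimately have "(\<Sum>k<d. cofactor M k i * A k j) = Determinant.det M * (if i = j then 1 else 0)"
    using i j by simp
  then have "(\<Sum>k<d. cofactor M k i * A k j) / Determinant.det M = (if i = j then 1 else 0)"
    using nz by (simp add: divide_eq_eq)
  then show ?thesis by (simp add: B_def sum_divide_distrib)
qed

text \<open>
  Cramer's rule makes the entries of an inverse matrix rational functions of the entries.
\<close>

lemma tcd_inverse_matrix:
  fixes A :: "_ \<Rightarrow> nat \<Rightarrow> nat \<Rightarrow> real"
  assumes U: "openin (Euclidean_space d) U"
    and A: "\<And>i j. i < n \<Longrightarrow> j < n \<Longrightarrow> tcd d k U (\<lambda>x. A x i j)"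
    and nz: "\<And>x. x \<in> U \<Longrightarrow> Determinant.det (Matrix.mat n n (\<lambda>(i, j). A x i j)) \<noteq> 0"
    and i: "i < n" and j: "j < n"
  shows "tcd d k U (\<lambda>x. cofactor (Matrix.mat n n (\<lambda>(i, j). A x i j)) j i /
     Determinant.det (Matrix.mat n n (\<lambda>(i, j). A x i j)))"
proof -
  have del: "mat_delete (Matrix.mat n n (\<lambda>(i, j). A x i j)) j i =
     Matrix.mat (n - 1) (n - 1) (\<lambda>(i', j'). A x (if i' < j then i' else Suc i') (if j' < i then j' else Suc j'))" for x
    by (rule eq_matI) (auto simp: mat_delete_def)
  show ?thesis
    unfolding cofactor_def del divide_inverse
    by (intro tcd_mult[OF U] tcd_inverse[OF U] tcd_const U tcd_det[OF U] A nz) (use i j in auto)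
qed

text \<open>
  Only the regularity of a given inverse \<open>h\<close> is at stake. Write \<open>\<eta>\<close> for the increment of \<open>h\<close> when
  the argument moves by \<open>s\<close> along the \<open>i\<close>-th axis. Linearising \<open>g\<close> gives \<open>A \<eta> = s e\<^sub>i + o(\<eta>)\<close>,
  hence \<open>\<eta> = s A\<inverse> e\<^sub>i + o(\<eta>)\<close>; so \<open>\<eta> = O(s)\<close> and the derivative is the \<open>i\<close>-th column
  of \<open>A\<inverse>\<close>. Higher derivatives follow because that matrix is a smooth function composed with \<open>h\<close>.
\<close>

lemma has_partial_inverse:
  fixes g h :: "(nat \<Rightarrow> real) \<Rightarrow> nat \<Rightarrow> real"
  assumes V: "openin (Euclidean_space d) V" and W: "openin (Euclidean_space d) W"
    and g: "\<And>j. tcd d (Suc 0) V (\<lambda>x. g x j)"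
    and hV: "\<And>y. y \<in> W \<Longrightarrow> h y \<in> V" and gh: "\<And>y. y \<in> W \<Longrightarrow> g (h y) = y"
    and h: "continuous_on W h" and nz: "jacobian_det d g (h y) \<noteq> 0"
    and y: "y \<in> W" and i: "i < d" and j: "j < d"
  shows "has_partial (\<lambda>y. h y j) i y
    (cofactor (jacobian_mat d g (h y)) i j / Determinant.det (jacobian_mat d g (h y)))"
proof -
  define A where "A = (\<lambda>m l. partial_derivative l (\<lambda>x. g x m) (h y))"
  define M where "M = jacobian_mat d g (h y)"
  have M: "M = Matrix.mat d d (\<lambda>(m, l). A m l)" by (simp add: M_def jacobian_mat_def A_def)
  define B where "B = (\<lambda>i j. cofactor M j i / Determinant.det M)"
  have nz': "Determinant.det M \<noteq> 0" using nz by (simp add: jacobian_det_eq M_def)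
  have BA: "(\<Sum>k<d. B i k * A k j) = (if i = j then 1 else 0)" if "i < d" "j < d" for i j
    unfolding B_def M by (rule matrix_left_inverse) (use nz' M that in auto)
  define K where "K = 1 + (\<Sum>j<d. \<Sum>m<d. \<bar>B j m\<bar>)"
  have K: "K \<ge> 1" by (auto simp: K_def intro!: sum_nonneg)
  have rowK: "(\<Sum>m<d. \<bar>B j m\<bar>) \<le> K" if "j < d" for j
    using that member_le_sum[of j "{..<d}" "\<lambda>j. \<Sum>m<d. \<bar>B j m\<bar>"] by (auto simp: K_def intro: sum_nonneg)
  have colK: "(\<Sum>j<d. \<bar>B j i\<bar>) \<le> K"
  proof -
    have "(\<Sum>j<d. \<bar>B j i\<bar>) \<le> (\<Sum>j<d. \<Sum>m<d. \<bar>B j m\<bar>)"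
      using i by (intro sum_mono member_le_sum) auto
    then show ?thesis by (simp add: K_def)
  qed
  define \<eta> where "\<eta> t = (\<lambda>l. h (y(i := t)) l - h y l)" for t
  have "\<forall>\<^sub>F t in nhds (y i). \<bar>\<eta> t j - (t - y i) * B j i\<bar> \<le> e * \<bar>t - y i\<bar>" if e: "e > 0" for e
  proof -
    define e' where "e' = min (1 / (2 * K * (real d + 1))) (e / (2 * K ^ 2))"
    have e': "e' > 0" using e K by (auto simp: e'_def)
    have "\<exists>r>0. \<forall>z\<in>coord_space d. (\<forall>l<d. \<bar>z l - h y l\<bar> < r) \<longrightarrow>
        norm (g z m - g (h y) m - (\<Sum>l<d. (z l - h y l) *\<^sub>R A m l)) \<le> e' * (\<Sum>l<d. \<bar>z l - h y l\<bar>)"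
      for m unfolding A_def by (rule total_differential[OF V g hV[OF y] e'])
    then have "\<exists>r>0. \<forall>m<d. \<forall>z\<in>coord_space d. (\<forall>l<d. \<bar>z l - h y l\<bar> < r) \<longrightarrow>
        norm (g z m - g (h y) m - (\<Sum>l<d. (z l - h y l) *\<^sub>R A m l)) \<le> e' * (\<Sum>l<d. \<bar>z l - h y l\<bar>)"
      by (intro uniform_radius[of d "\<lambda>m r. \<forall>z\<in>coord_space d. (\<forall>l<d. \<bar>z l - h y l\<bar> < r) \<longrightarrow>
        norm (g z m - g (h y) m - (\<Sum>l<d. (z l - h y l) *\<^sub>R A m l)) \<le> e' * (\<Sum>l<d. \<bar>z l - h y l\<bar>)"])
        (simp, meson less_le_trans)
    then obtain r where r: "r > 0" "\<And>m z. m < d \<Longrightarrow> z \<in> coord_space d \<Longrightarrow> (\<forall>l<d. \<bar>z l - h y l\<bar> < r) \<Longrightarrow>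
        \<bar>g z m - g (h y) m - (\<Sum>l<d. (z l - h y l) * A m l)\<bar> \<le> e' * (\<Sum>l<d. \<bar>z l - h y l\<bar>)"
      by auto
    have "\<forall>\<^sub>F t in nhds (y i). \<forall>l\<in>{..<d}. \<bar>\<eta> t l\<bar> < r"
    proof (intro eventually_ball_finite ballI)
      fix l
      have "continuous_on W (\<lambda>z. h z l)" by (rule continuous_on_product_then_coordinatewise[OF h])
      then obtain r' where r': "r' > 0" "\<And>z. z \<in> coord_space d \<Longrightarrow> (\<forall>i<d. \<bar>z i - y i\<bar> < r') \<Longrightarrow>
          dist (h z l) (h y l) < r"
        using continuous_on_box[OF W _ y r(1), of "\<lambda>z. h z l"] by blast
      have "\<forall>\<^sub>F t in nhds (y i). \<bar>t - y i\<bar> < r'"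
        using r'(1) unfolding eventually_nhds_metric dist_real_def by blast
      then show "\<forall>\<^sub>F t in nhds (y i). \<bar>\<eta> t l\<bar> < r"
        using eventually_line_in_open[OF W y i]
      proof eventually_elim
        case (elim t)
        then have "\<forall>l<d. \<bar>(y(i := t)) l - y l\<bar> < r'" using r'(1) by auto
        then show ?case using r'(2)[of "y(i := t)"] elim openin_subset[OF W]
          by (auto simp: \<eta>_def dist_real_def)
      qed
    qed simp
    then show ?thesis using eventually_line_in_open[OF W y i]
    proof eventually_elim
      case (elim t)
      define s where "s = t - y i"
      define N where "N = (\<Sum>l<d. \<bar>\<eta> t l\<bar>)"
      have N: "N \<ge> 0" by (auto simp: N_def intro: sum_nonneg)
      define \<rho> where "\<rho> m = (if m = i then s else 0) - (\<Sum>l<d. \<eta> t l * A m l)" for m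
      have \<rho>: "\<bar>\<rho> m\<bar> \<le> e' * N" if m: "m < d" for m
      proof -
        have "g (h (y(i := t))) m - g (h y) m = (if m = i then s else 0)"
          using gh[OF elim(2)] gh[OF y] by (auto simp: s_def)
        then show ?thesis
          using r(2)[OF m, of "h (y(i := t))"] elim hV[OF elim(2)] openin_subset[OF V]
          by (auto simp: \<rho>_def N_def \<eta>_def)
      qed
      have eq: "\<eta> t l - s * B l i = - (\<Sum>m<d. B l m * \<rho> m)" if l: "l < d" for l
      proof -
        have "(\<Sum>m<d. B l m * \<rho> m) = (\<Sum>m<d. B l m * (if m = i then s else 0))
            - (\<Sum>m<d. \<Sum>l'<d. \<eta> t l' * (B l m * A m l'))"
          by (simp add: \<rho>_def right_diff_distrib sum_subtractf sum_distrib_left mult_ac)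
        also have "(\<Sum>m<d. B l m * (if m = i then s else 0)) = B l i * s"
          using i by (simp add: if_distrib cong: if_cong)
        also have "(\<Sum>m<d. \<Sum>l'<d. \<eta> t l' * (B l m * A m l')) = (\<Sum>l'<d. \<eta> t l' * (\<Sum>m<d. B l m * A m l'))"
          by (subst sum.swap) (simp add: sum_distrib_left)
        also have "\<dots> = (\<Sum>l'<d. \<eta> t l' * (if l = l' then 1 else 0))"
          using BA[OF l] by (intro sum.cong) auto
        also have "\<dots> = \<eta> t l" using l by (simp add: if_distrib cong: if_cong)
        finally show ?thesis by simp
      qed
      have bound: "\<bar>\<eta> t l - s * B l i\<bar> \<le> K * (e' * N)" if l: "l < d" for l
      proof -
        have "\<bar>\<Sum>m<d. B l m * \<rho> m\<bar> \<le> (\<Sum>m<d. \<bar>B l m\<bar> * (e' * N))"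
          by (rule order_trans[OF sum_abs]) (auto simp: abs_mult intro!: sum_mono mult_left_mono \<rho>)
        also have "\<dots> = (\<Sum>m<d. \<bar>B l m\<bar>) * (e' * N)" by (simp add: sum_distrib_right)
        also have "\<dots> \<le> K * (e' * N)" using rowK[OF l] e' N by (intro mult_right_mono) auto
        finally show ?thesis using eq[OF l] by simp
      qed
      have "N \<le> (\<Sum>l<d. \<bar>s\<bar> * \<bar>B l i\<bar> + K * (e' * N))"
        unfolding N_def
      proof (rule sum_mono)
        fix l assume "l \<in> {..<d}"
        then have "\<bar>\<eta> t l - s * B l i\<bar> \<le> K * (e' * N)" by (intro bound) simp
        then show "\<bar>\<eta> t l\<bar> \<le> \<bar>s\<bar> * \<bar>B l i\<bar> + K * (e' * (\<Sum>l<d. \<bar>\<eta> t l\<bar>))"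
          unfolding N_def abs_mult[symmetric] by linarith
      qed
      also have "\<dots> = \<bar>s\<bar> * (\<Sum>l<d. \<bar>B l i\<bar>) + real d * K * e' * N"
        by (simp add: sum.distrib sum_distrib_left)
      also have "\<dots> \<le> \<bar>s\<bar> * K + 1/2 * N"
      proof (intro add_mono mult_left_mono mult_right_mono colK N)
        have "real d * K * e' \<le> real d * K * (1 / (2 * K * (real d + 1)))"
          using K by (intro mult_left_mono) (auto simp: e'_def)
        also have "\<dots> \<le> 1/2"
        proof -
          have "2 * K * (real d + 1) > 0" using K by simp
          moreover have "real d * K \<le> 1/2 * (2 * K * (real d + 1))" using K by (simp add: algebra_simps)
          ultimately show ?thesis by (simp only: times_divide_eq_right mult_1_right pos_divide_le_eq)
        qed
        finally show "real d * K * e' \<le> 1/2" .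
      qed auto
      finally have N2: "N \<le> 2 * K * \<bar>s\<bar>" by (simp add: mult_ac)
      have "\<bar>\<eta> t j - s * B j i\<bar> \<le> K * (e' * (2 * K * \<bar>s\<bar>))"
        using bound[OF j] N2 K e' by (meson mult_left_mono order_trans less_imp_le zero_le_one)
      also have "\<dots> = (e' * (2 * K ^ 2)) * \<bar>s\<bar>" by (simp add: power2_eq_square)
      also have "\<dots> \<le> e * \<bar>s\<bar>"
      proof (rule mult_right_mono)
        have "e' * (2 * K ^ 2) \<le> e / (2 * K ^ 2) * (2 * K ^ 2)" by (intro mult_right_mono) (auto simp: e'_def)
        then show "e' * (2 * K ^ 2) \<le> e" using K by simp
      qed simp
      finally show ?case by (simp add: s_def)
    qed
  qed
  then have "has_partial (\<lambda>y. h y j) i y (B j i)"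
    unfolding has_vector_derivative_little_o by (simp only: fun_upd_triv) (simp add: \<eta>_def)
  then show ?thesis by (simp add: B_def M_def)
qed

lemma smooth_map_inverse:
  fixes g h :: "(nat \<Rightarrow> real) \<Rightarrow> nat \<Rightarrow> real"
  assumes V: "openin (Euclidean_space d) V" and W: "openin (Euclidean_space d) W"
    and g: "smooth_map d V g"
    and hV: "\<And>y. y \<in> W \<Longrightarrow> h y \<in> V" and gh: "\<And>y. y \<in> W \<Longrightarrow> g (h y) = y"
    and h: "continuous_on W h" and nz: "\<And>x. x \<in> V \<Longrightarrow> jacobian_det d g x \<noteq> 0"
  shows "smooth_map d W h"
proof -
  have gk: "tcd d k V (\<lambda>x. g x j)" for k j using g unfolding smooth_map_def smooth_def by blast
  have "\<forall>j<d. tcd d k W (\<lambda>y. h y j)" for k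
  proof (induction k)
    case 0
    then show ?case using continuous_on_product_then_coordinatewise[OF h] by simp
  next
    case (Suc k)
    show ?case
    proof (intro allI impI, rule tcd_SucI[OF W])
      fix j assume j: "j < d"
      show "continuous_on W (\<lambda>y. h y j)" by (rule continuous_on_product_then_coordinatewise[OF h])
      fix i assume i: "i < d"
      let ?B = "\<lambda>x. cofactor (jacobian_mat d g x) i j / Determinant.det (jacobian_mat d g x)"
      have "tcd d k V ?B" unfolding jacobian_mat_def
        by (rule tcd_inverse_matrix[OF V])
          (use i j nz in \<open>auto simp: jacobian_det_def intro!: tcd_partial[OF gk]\<close>)
      then have "tcd d k W (\<lambda>y. ?B (h y))"
        using Suc by (intro tcd_compose[where f = ?B and g = h, OF V W hV]) auto
      moreover have "\<forall>y\<in>W. has_partial (\<lambda>y. h y j) i y (?B (h y))"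
        using has_partial_inverse[OF V W gk hV gh h _ _ i j] nz hV by blast
      ultimately show "\<exists>f'. (\<forall>y\<in>W. has_partial (\<lambda>y. h y j) i y (f' y)) \<and> tcd d k W f'"
        by (intro exI[of _ "\<lambda>y. ?B (h y)"] conjI)
    qed
  qed
  moreover have "tcd d k W (\<lambda>y. h y j)" if "\<not> j < d" for j k
    by (rule tcd_cong[OF W _ tcd_const[OF W, where c = 0]])
      (use that hV openin_subset[OF V] in \<open>auto simp: coord_space_iff subset_iff\<close>)
  ultimately show ?thesis unfolding smooth_map_def smooth_def by blast
qed

subsection \<open>Smooth functions\<close>

lemma smoothI: "(\<And>k. tcd d k U f) \<Longrightarrow> smooth d U f"
  by (simp add: smooth_def)

lemma smoothD: "smooth d U f \<Longrightarrow> tcd d k U f"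
  by (simp add: smooth_def)

lemma smooth_continuous_on: "smooth d U f \<Longrightarrow> continuous_on U f"
  using smoothD tcd_continuous_on by blast

lemma smooth_subset: "smooth d U f \<Longrightarrow> V \<subseteq> U \<Longrightarrow> smooth d V f"
  unfolding smooth_def using tcd_subset[of d _ U f V] by simp

lemma smooth_cong:
  "openin (Euclidean_space d) U \<Longrightarrow> (\<And>x. x \<in> U \<Longrightarrow> f x = g x) \<Longrightarrow> smooth d U f \<Longrightarrow> smooth d U g"
  unfolding smooth_def using tcd_cong[of d U f g] by simp

lemma smooth_local:
  assumes "openin (Euclidean_space d) U"
    and *: "\<And>x. x \<in> U \<Longrightarrow> \<exists>V. openin (Euclidean_space d) V \<and> x \<in> V \<and> smooth d V f"
  shows "smooth d U f"
proof (rule smoothI)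
  fix k
  show "tcd d k U f"
  proof (rule tcd_local[OF assms(1)])
    fix x assume "x \<in> U"
    then obtain V where "openin (Euclidean_space d) V" "x \<in> V" "smooth d V f" using * by blast
    then show "\<exists>V. openin (Euclidean_space d) V \<and> x \<in> V \<and> tcd d k V f"
      by (intro exI[of _ V] conjI smoothD)
  qed
qed

lemma smooth_const: "openin (Euclidean_space d) U \<Longrightarrow> smooth d U (\<lambda>x. c)"
  by (simp add: smooth_def)

lemma smooth_coord: "openin (Euclidean_space d) U \<Longrightarrow> smooth d U (\<lambda>x. x j)"
  by (simp add: smooth_def tcd_coord)

lemma smooth_add: "openin (Euclidean_space d) U \<Longrightarrow> smooth d U f \<Longrightarrow> smooth d U g \<Longrightarrow> smooth d U (\<lambda>x. f x + g x)"
  by (simp add: smooth_def tcd_add)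

lemma smooth_minus: "openin (Euclidean_space d) U \<Longrightarrow> smooth d U f \<Longrightarrow> smooth d U (\<lambda>x. - f x)"
  by (simp add: smooth_def tcd_minus)

lemma smooth_diff: "openin (Euclidean_space d) U \<Longrightarrow> smooth d U f \<Longrightarrow> smooth d U g \<Longrightarrow> smooth d U (\<lambda>x. f x - g x)"
  by (simp add: smooth_def tcd_diff)

lemma smooth_mult:
  fixes f g :: "_ \<Rightarrow> 'b::real_normed_algebra"
  shows "openin (Euclidean_space d) U \<Longrightarrow> smooth d U f \<Longrightarrow> smooth d U g \<Longrightarrow> smooth d U (\<lambda>x. f x * g x)"
  by (simp add: smooth_def tcd_mult)

lemma smooth_linear:
  "bounded_linear L \<Longrightarrow> openin (Euclidean_space d) U \<Longrightarrow> smooth d U f \<Longrightarrow> smooth d U (\<lambda>x. L (f x))"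
  by (simp add: smooth_def tcd_linear)

lemma smooth_sum:
  "openin (Euclidean_space d) U \<Longrightarrow> (\<And>a. a \<in> A \<Longrightarrow> smooth d U (f a)) \<Longrightarrow> smooth d U (\<lambda>x. \<Sum>a\<in>A. f a x)"
  by (simp add: smooth_def tcd_sum)

lemma smooth_inverse:
  fixes f :: "_ \<Rightarrow> real"
  shows "openin (Euclidean_space d) U \<Longrightarrow> (\<And>x. x \<in> U \<Longrightarrow> f x \<noteq> 0) \<Longrightarrow> smooth d U f \<Longrightarrow> smooth d U (\<lambda>x. inverse (f x))"
  by (simp add: smooth_def tcd_inverse)

lemma smooth_sqrt:
  fixes f :: "_ \<Rightarrow> real"
  shows "openin (Euclidean_space d) U \<Longrightarrow> (\<And>x. x \<in> U \<Longrightarrow> f x > 0) \<Longrightarrow> smooth d U f \<Longrightarrow> smooth d U (\<lambda>x. sqrt (f x))"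
  by (simp add: smooth_def tcd_sqrt)

lemma smooth_partial: "smooth d U f \<Longrightarrow> i < d \<Longrightarrow> smooth d U (partial_derivative i f)"
  unfolding smooth_def using tcd_partial by blast

lemma smooth_has_partial:
  "smooth d U f \<Longrightarrow> x \<in> U \<Longrightarrow> i < d \<Longrightarrow> has_partial f i x (partial_derivative i f x)"
  by (rule tcd_has_partial[OF smoothD])

lemma smooth_compose:
  assumes "openin (Euclidean_space e) V" "openin (Euclidean_space d) U" "\<And>x. x \<in> U \<Longrightarrow> g x \<in> V"
    and "smooth e V f" "smooth_map d U g"
  shows "smooth d U (\<lambda>x. f (g x))"
proof (rule smoothI)
  fix k
  show "tcd d k U (\<lambda>x. f (g x))"
    by (rule tcd_compose[OF assms(1-3) smoothD[OF assms(4)]])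
      (use assms(5) in \<open>simp_all add: smooth_map_def smooth_def\<close>)
qed

lemma smooth_partial_compose:
  assumes "openin (Euclidean_space e) V" "openin (Euclidean_space d) U" "\<And>x. x \<in> U \<Longrightarrow> g x \<in> V"
    and "smooth e V f" "smooth_map d U g" "x \<in> U" "i < d"
  shows "partial_derivative i (\<lambda>x. f (g x)) x =
    (\<Sum>j<e. partial_derivative i (\<lambda>x. g x j) x *\<^sub>R partial_derivative j f (g x))"
proof (rule partial_derivative_eqI, rule has_partial_compose[OF assms(1,2) smoothD[OF assms(4)] _ assms(3,6,7)])
  show "tcd d (Suc 0) U (\<lambda>x. g x j)" for j
    using assms(5) unfolding smooth_map_def by (blast intro: smoothD)
qed

lemma smooth_mapD: "smooth_map d U f \<Longrightarrow> smooth d U (\<lambda>x. f x j)"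
  by (simp add: smooth_map_def)

lemma smooth_map_cong:
  assumes "openin (Euclidean_space d) U" "\<And>x. x \<in> U \<Longrightarrow> f x = g x" "smooth_map d U f"
  shows "smooth_map d U g"
  unfolding smooth_map_def
proof
  fix j show "smooth d U (\<lambda>x. g x j)"
    by (rule smooth_cong[OF assms(1) _ smooth_mapD[OF assms(3)]]) (simp add: assms(2))
qed

lemma smooth_map_subset: "smooth_map d U f \<Longrightarrow> V \<subseteq> U \<Longrightarrow> smooth_map d V f"
  by (simp add: smooth_map_def smooth_subset[of d U _ V])

lemma smooth_map_local:
  assumes U: "openin (Euclidean_space d) U"
    and *: "\<And>x. x \<in> U \<Longrightarrow> \<exists>V. openin (Euclidean_space d) V \<and> x \<in> V \<and> smooth_map d V f"
  shows "smooth_map d U f"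
  unfolding smooth_map_def
proof
  fix j show "smooth d U (\<lambda>x. f x j)"
  proof (rule smooth_local[OF U])
    fix x assume "x \<in> U"
    then obtain V where "openin (Euclidean_space d) V" "x \<in> V" "smooth_map d V f" using * by blast
    then show "\<exists>V. openin (Euclidean_space d) V \<and> x \<in> V \<and> smooth d V (\<lambda>x. f x j)"
      by (intro exI[of _ V] conjI smooth_mapD)
  qed
qed

lemma smooth_map_compose:
  assumes "openin (Euclidean_space e) V" "openin (Euclidean_space d) U" "\<And>x. x \<in> U \<Longrightarrow> g x \<in> V"
    and "smooth_map e V f" "smooth_map d U g"
  shows "smooth_map d U (\<lambda>x. f (g x))"
  unfolding smooth_map_def
proof
  fix j show "smooth d U (\<lambda>x. f (g x) j)"
    by (rule smooth_compose[OF assms(1-3) smooth_mapD[OF assms(4)] assms(5)])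
qed

lemma smooth_map_continuous_on:
  fixes f :: "_ \<Rightarrow> nat \<Rightarrow> 'b::real_normed_vector"
  shows "smooth_map d U f \<Longrightarrow> continuous_on U f"
  by (intro continuous_on_coordinatewise_then_product smooth_continuous_on smooth_mapD)

lemma openin_Euclidean_preimage:
  assumes "openin (Euclidean_space d) U" "continuous_on U f" "openin (top_of_set S) W" "f ` U \<subseteq> S"
  shows "openin (Euclidean_space d) {x \<in> U. f x \<in> W}"
proof -
  have "openin (top_of_set U) (U \<inter> f -` W)"
    using continuous_openin_preimage[OF assms(2) _ assms(3)] assms(4) by blast
  moreover have "U \<inter> f -` W = {x \<in> U. f x \<in> W}" by blast
  ultimately show ?thesis using assms(1) openin_Euclidean_space_trans by metis
qed

section \<open>Charts\<close>

lemma is_chart_open: "is_chart d X (U, \<phi>) \<Longrightarrow> openin X U"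
  by (simp add: is_chart_def)

lemma is_chart_subset: "is_chart d X (U, \<phi>) \<Longrightarrow> U \<subseteq> topspace X"
  using is_chart_open openin_subset by blast

lemma is_chart_image_open: "is_chart d X (U, \<phi>) \<Longrightarrow> openin (Euclidean_space d) (\<phi> ` U)"
  by (simp add: is_chart_def)

lemma is_chart_inj: "is_chart d X (U, \<phi>) \<Longrightarrow> inj_on \<phi> U"
  using homeomorphic_imp_injective_map[of "subtopology X U"] is_chart_subset[of d X U \<phi>]
  by (auto simp: is_chart_def topspace_subtopology Int_absorb1)

lemma is_chart_open_image:
  assumes c: "is_chart d X (U, \<phi>)" and A: "openin X A" "A \<subseteq> U"
  shows "openin (Euclidean_space d) (\<phi> ` A)"
proof -
  have "openin (subtopology X U) A"
    using A is_chart_open[OF c] by (simp add: openin_open_subtopology)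
  then have "openin (subtopology (Euclidean_space d) (\<phi> ` U)) (\<phi> ` A)"
    using c homeomorphic_imp_open_map by (fastforce simp: is_chart_def open_map_def)
  then show ?thesis using is_chart_image_open[OF c] openin_trans_full by blast
qed

lemma is_chart_open_preimage:
  assumes c: "is_chart d X (U, \<phi>)" and B: "openin (Euclidean_space d) B"
  shows "openin X {x \<in> U. \<phi> x \<in> B}"
proof -
  have "continuous_map (subtopology X U) (subtopology (Euclidean_space d) (\<phi> ` U)) \<phi>"
    using c homeomorphic_imp_continuous_map by (fastforce simp: is_chart_def)
  then have "continuous_map (subtopology X U) (Euclidean_space d) \<phi>"
    by (rule continuous_map_into_fulltopology)
  then have "openin (subtopology X U) {x \<in> topspace (subtopology X U). \<phi> x \<in> B}"
    using B openin_continuous_map_preimage by blast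
  moreover have "topspace (subtopology X U) = U"
    using is_chart_subset[OF c] by (simp add: topspace_subtopology Int_absorb1)
  ultimately show ?thesis using is_chart_open[OF c] openin_trans_full by metis
qed

lemma is_chartI:
  assumes U: "openin X U" and P: "openin (Euclidean_space d) P"
    and \<phi>: "\<And>x. x \<in> U \<Longrightarrow> \<phi> x \<in> P" and \<psi>: "\<And>t. t \<in> P \<Longrightarrow> \<psi> t \<in> U"
    and "\<And>x. x \<in> U \<Longrightarrow> \<psi> (\<phi> x) = x" "\<And>t. t \<in> P \<Longrightarrow> \<phi> (\<psi> t) = t"
    and pre: "\<And>B. openin (Euclidean_space d) B \<Longrightarrow> B \<subseteq> P \<Longrightarrow> openin X {x \<in> U. \<phi> x \<in> B}"
    and img: "\<And>A. openin X A \<Longrightarrow> A \<subseteq> U \<Longrightarrow> openin (Euclidean_space d) {t \<in> P. \<psi> t \<in> A}"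
  shows "is_chart d X (U, \<phi>)"
proof -
  have im: "\<phi> ` U = P" using assms(3-6) by force
  have UX: "topspace (subtopology X U) = U" using openin_subset[OF U] by (simp add: topspace_subtopology Int_absorb1)
  have PE: "topspace (subtopology (Euclidean_space d) P) = P"
    using openin_subset[OF P] by (simp add: topspace_subtopology Int_absorb1)
  have "homeomorphic_maps (subtopology X U) (subtopology (Euclidean_space d) P) \<phi> \<psi>"
    unfolding homeomorphic_maps_def
  proof (intro conjI)
    show "continuous_map (subtopology X U) (subtopology (Euclidean_space d) P) \<phi>"
      unfolding continuous_map_def UX PE using \<phi> pre U P by (auto simp: openin_open_subtopology)
    show "continuous_map (subtopology (Euclidean_space d) P) (subtopology X U) \<psi>"
      unfolding continuous_map_def UX PE using \<psi> img U P by (auto simp: openin_open_subtopology)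
  qed (use assms(5,6) UX PE in auto)
  then show ?thesis
    unfolding is_chart_def using im U P by (auto simp: homeomorphic_map_maps)
qed

lemma is_chart_restrict:
  assumes c: "is_chart d X (U, \<phi>)" and V: "openin X V" "V \<subseteq> U"
  shows "is_chart d X (V, \<phi>)"
proof (rule is_chartI[where \<psi> = "inv_into U \<phi>"])
  have inj: "inj_on \<phi> U" by (rule is_chart_inj[OF c])
  show "openin X V" by fact
  show "openin (Euclidean_space d) (\<phi> ` V)" by (rule is_chart_open_image[OF c V])
  show "inv_into U \<phi> t \<in> V" if "t \<in> \<phi> ` V" for t using that V inj by auto
  show "inv_into U \<phi> (\<phi> x) = x" if "x \<in> V" for x using that V inj by auto
  show "\<phi> (inv_into U \<phi> t) = t" if "t \<in> \<phi> ` V" for t using that V inj by auto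
  fix B assume B: "openin (Euclidean_space d) B"
  have "{x \<in> V. \<phi> x \<in> B} = V \<inter> {x \<in> U. \<phi> x \<in> B}" using V by blast
  then show "openin X {x \<in> V. \<phi> x \<in> B}" using is_chart_open_preimage[OF c B] V by auto
next
  fix A assume A: "openin X A" "A \<subseteq> V"
  have "{t \<in> \<phi> ` V. inv_into U \<phi> t \<in> A} = \<phi> ` A"
    using A V is_chart_inj[OF c] by (auto simp: subset_iff)
  then show "openin (Euclidean_space d) {t \<in> \<phi> ` V. inv_into U \<phi> t \<in> A}"
    using is_chart_open_image[OF c A(1)] A V by auto
qed auto

section \<open>Embedded submanifolds\<close>

lemma immersionD:
  assumes "immersion d U f" "x \<in> U"
    and "\<And>j. (\<Sum>i<d. v i *\<^sub>R partial_derivative i (\<lambda>y. f y j) x) = 0" and "i < d"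
  shows "v i = 0"
  using assms unfolding immersion_def by simp

lemma submanifold_simps [simp]:
  "dimension (submanifold d S) = d" "topology_of (submanifold d S) = top_of_set S"
  by (simp_all add: submanifold_def)

lemma submanifold_charts_iff:
  "(U, \<phi>) \<in> charts (submanifold d S) \<longleftrightarrow>
     is_chart d (top_of_set S) (U, \<phi>) \<and> immersion d (\<phi> ` U) (inv_into U \<phi>)"
  by (simp add: submanifold_def)

lemma chart_image_subset: "is_chart d (top_of_set S) (U, \<phi>) \<Longrightarrow> U \<subseteq> S"
  using is_chart_subset[of d "top_of_set S" U \<phi>] by simp

text \<open>
  The parametrizations of the manifolds in question are inverted by coordinate functions that are
  restrictions of real linear ones. This makes composites with these charts smooth for trivial
  reasons, and the differential of such a parametrization is injective without computation.
\<close>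

definition lin_coord :: "nat \<Rightarrow> (nat \<Rightarrow> complex) \<Rightarrow> (nat \<Rightarrow> nat) \<Rightarrow> (nat \<Rightarrow> complex) \<Rightarrow> nat \<Rightarrow> real" where
  "lin_coord d a \<kappa> z = (\<lambda>i. if i < d then Re (a i * z (\<kappa> i)) else 0)"

definition locally_linear_graph :: "nat \<Rightarrow> (nat \<Rightarrow> complex) set \<Rightarrow> bool" where
  "locally_linear_graph d S \<longleftrightarrow>
     (\<forall>z\<in>S. \<exists>W a \<kappa>. z \<in> W \<and> (W, lin_coord d a \<kappa>) \<in> charts (submanifold d S))"

lemma lin_coord_in_space: "lin_coord d a \<kappa> z \<in> coord_space d"
  by (simp add: lin_coord_def coord_space_iff)

lemma bounded_linear_Re_mult: "bounded_linear (\<lambda>z. Re (c * z))"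
  by (rule bounded_linear_compose[OF bounded_linear_Re bounded_linear_mult_right])

lemma smooth_map_lin_coord:
  assumes U: "openin (Euclidean_space e) U" and h: "smooth_map e U h"
  shows "smooth_map e U (\<lambda>x. lin_coord d a \<kappa> (h x))"
  unfolding smooth_map_def
proof
  fix j
  show "smooth e U (\<lambda>x. lin_coord d a \<kappa> (h x) j)"
  proof (cases "j < d")
    case True
    then show ?thesis
      unfolding lin_coord_def by (simp del: times_complex.sel add: smooth_linear[OF bounded_linear_Re_mult U smooth_mapD[OF h]])
  qed (simp add: lin_coord_def smooth_const U)
qed

lemma continuous_on_lin_coord: "continuous_on A (lin_coord d a \<kappa>)"
proof (rule continuous_on_coordinatewise_then_product)
  fix j
  show "continuous_on A (\<lambda>z. lin_coord d a \<kappa> z j)"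
    unfolding lin_coord_def
    by (cases "j < d")
      (auto intro!: continuous_intros continuous_on_subset[OF continuous_on_product_coordinates])
qed

lemma lin_coord_chartI:
  assumes P: "openin (Euclidean_space d) P" and \<Psi>: "smooth_map d P \<Psi>"
    and W: "openin (top_of_set S) W" and \<Psi>W: "\<And>t. t \<in> P \<Longrightarrow> \<Psi> t \<in> W"
    and \<Phi>P: "\<And>z. z \<in> W \<Longrightarrow> lin_coord d a \<kappa> z \<in> P"
    and \<Phi>\<Psi>: "\<And>t. t \<in> P \<Longrightarrow> lin_coord d a \<kappa> (\<Psi> t) = t"
    and \<Psi>\<Phi>: "\<And>z. z \<in> W \<Longrightarrow> \<Psi> (lin_coord d a \<kappa> z) = z"
  shows "(W, lin_coord d a \<kappa>) \<in> charts (submanifold d S)"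
proof -
  let ?\<Phi> = "lin_coord d a \<kappa>"
  have WS: "W \<subseteq> S" using openin_subset[OF W] by simp
  have inj: "inj_on ?\<Phi> W" by (rule inj_on_inverseI[of _ \<Psi>]) (rule \<Psi>\<Phi>)
  have im: "?\<Phi> ` W = P" using \<Psi>W \<Phi>P \<Phi>\<Psi> by force
  have inv: "inv_into W ?\<Phi> t = \<Psi> t" if "t \<in> P" for t
    by (rule inv_into_f_eq[OF inj \<Psi>W]) (use that \<Phi>\<Psi> in auto)
  have "is_chart d (top_of_set S) (W, ?\<Phi>)"
  proof (rule is_chartI[where \<phi> = ?\<Phi> and \<psi> = \<Psi>, OF W P \<Phi>P \<Psi>W \<Psi>\<Phi> \<Phi>\<Psi>])
    show "openin (top_of_set S) {x \<in> W. ?\<Phi> x \<in> B}" if B: "openin (Euclidean_space d) B" for B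
    proof -
      obtain T where T: "open T" "B = coord_space d \<inter> T" using B openin_Euclidean_space_open by blast
      have "{x \<in> W. ?\<Phi> x \<in> B} = W \<inter> ?\<Phi> -` T"
        using T lin_coord_in_space by blast
      moreover have "openin (top_of_set W) (W \<inter> ?\<Phi> -` T)"
        by (rule continuous_openin_preimage_gen[OF continuous_on_lin_coord T(1)])
      ultimately show ?thesis using W openin_trans by metis
    qed
    show "openin (Euclidean_space d) {t \<in> P. \<Psi> t \<in> A}" if A: "openin (top_of_set S) A" for A
      using openin_Euclidean_preimage[OF P smooth_map_continuous_on[OF \<Psi>] A] \<Psi>W WS by blast
  qed
  moreover have "immersion d P (inv_into W ?\<Phi>)"
    unfolding immersion_def
  proof (intro conjI ballI allI impI)
    show sm: "smooth_map d P (inv_into W ?\<Phi>)"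
      by (rule smooth_map_cong[OF P _ \<Psi>]) (simp add: inv)
    fix x and v :: "nat \<Rightarrow> real" and l
    assume x: "x \<in> P" and l: "l < d"
      and 0: "\<forall>j. (\<Sum>i<d. v i *\<^sub>R partial_derivative i (\<lambda>y. inv_into W ?\<Phi> y j) x) = 0"
    let ?f = "\<lambda>y. inv_into W ?\<Phi> y (\<kappa> l)"
    have "Re (a l * partial_derivative i ?f x) = (if i = l then 1 else 0)" if i: "i < d" for i
    proof -
      have "has_partial (\<lambda>y. Re (a l * ?f y)) i x (Re (a l * partial_derivative i ?f x))"
        by (rule bounded_linear.has_vector_derivative[OF bounded_linear_Re_mult
              smooth_has_partial[OF smooth_mapD[OF sm] x i]])
      moreover have "has_partial (\<lambda>y. Re (a l * ?f y)) i x D \<longleftrightarrow> has_partial (\<lambda>y. y l) i x D" for D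
      proof (rule has_partial_cong[OF P _ x i])
        fix y assume y: "y \<in> P"
        have "y l = lin_coord d a \<kappa> (\<Psi> y) l" by (simp add: \<Phi>\<Psi>[OF y])
        then show "Re (a l * ?f y) = y l" using l by (simp add: inv[OF y] lin_coord_def)
      qed
      moreover have "has_partial (\<lambda>y. y l) i x (if i = l then 1 else 0)"
        by (cases "i = l") (auto intro: has_vector_derivative_const simp: has_vector_derivative_id)
      ultimately show ?thesis using vector_derivative_unique_at by blast
    qed
    then have "(\<Sum>i<d. v i * Re (a l * partial_derivative i ?f x)) = (\<Sum>i<d. v i * (if i = l then 1 else 0))"
      by (intro sum.cong) auto
    also have "\<dots> = v l" using l by (simp add: if_distrib cong: if_cong)
    also have "(\<Sum>i<d. v i * Re (a l * partial_derivative i ?f x))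
        = Re (a l * (\<Sum>i<d. v i *\<^sub>R partial_derivative i ?f x))"
      by (simp add: sum_distrib_left Re_sum algebra_simps)
    finally show "v l = 0" using 0 by simp
  qed
  ultimately show ?thesis by (simp add: submanifold_charts_iff im)
qed

lemma det_zero_null_vector:
  fixes A :: "nat \<Rightarrow> nat \<Rightarrow> real"
  assumes "Determinant.det (Matrix.mat d d (\<lambda>(i, j). A i j)) = 0"
  shows "\<exists>v. (\<exists>i<d. v i \<noteq> 0) \<and> (\<forall>k<d. (\<Sum>i<d. v i * A k i) = 0)"
proof -
  let ?M = "Matrix.mat d d (\<lambda>(i, j). A i j)"
  obtain v where v: "v \<in> carrier_vec d" "v \<noteq> 0\<^sub>v d" "?M *\<^sub>v v = 0\<^sub>v d"
    using assms det_0_iff_vec_prod_zero[of ?M d] by auto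
  have "\<exists>i<d. vec_index v i \<noteq> 0" using v(1,2) by (auto simp: vec_eq_iff)
  moreover have "(\<Sum>i<d. vec_index v i * A k i) = 0" if "k < d" for k
  proof -
    have "vec_index (?M *\<^sub>v v) k = 0" using v(3) that by simp
    then show ?thesis using that v(1) by (simp add: scalar_prod_def lessThan_atLeast0 mult.commute)
  qed
  ultimately show ?thesis by (intro exI[of _ "\<lambda>i. vec_index v i"]) blast
qed

text \<open>
  The universal property of an embedded submanifold: a smooth map into the ambient space with
  values in \<open>S\<close> is smooth in every chart. In a linear chart this is clear, and the change from a
  linear chart to the given one is the inverse of a regular homeomorphism.
\<close>

lemma smooth_map_chart_comp:
  assumes S: "locally_linear_graph d S" and c: "(V, \<psi>) \<in> charts (submanifold d S)"
    and P: "openin (Euclidean_space e) P" and h: "smooth_map e P h" and hV: "\<And>x. x \<in> P \<Longrightarrow> h x \<in> V"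
  shows "smooth_map e P (\<lambda>x. \<psi> (h x))"
proof (rule smooth_map_local[OF P])
  fix x assume x: "x \<in> P"
  have \<psi>: "is_chart d (top_of_set S) (V, \<psi>)" and \<chi>: "immersion d (\<psi> ` V) (inv_into V \<psi>)"
    using c by (simp_all add: submanifold_charts_iff)
  have VS: "V \<subseteq> S" by (rule chart_image_subset[OF \<psi>])
  obtain W a \<kappa> where "h x \<in> W" and W: "(W, lin_coord d a \<kappa>) \<in> charts (submanifold d S)"
    using S hV[OF x] VS unfolding locally_linear_graph_def by blast
  let ?\<Phi> = "lin_coord d a \<kappa>" and ?V' = "V \<inter> W"
  let ?\<chi> = "inv_into V \<psi>" and ?\<Psi> = "inv_into W ?\<Phi>"
  have \<Phi>: "is_chart d (top_of_set S) (W, ?\<Phi>)" and \<Psi>: "immersion d (?\<Phi> ` W) ?\<Psi>"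
    using W by (simp_all add: submanifold_charts_iff)
  note inj = is_chart_inj[OF \<psi>] is_chart_inj[OF \<Phi>]
  have V': "openin (top_of_set S) ?V'"
    using is_chart_open[OF \<psi>] is_chart_open[OF \<Phi>] by auto
  define Q where "Q = \<psi> ` ?V'"
  define R where "R = ?\<Phi> ` ?V'"
  have Q: "openin (Euclidean_space d) Q" unfolding Q_def by (rule is_chart_open_image[OF \<psi> V']) simp
  have R: "openin (Euclidean_space d) R" unfolding R_def by (rule is_chart_open_image[OF \<Phi> V']) simp
  have smQ: "smooth_map d Q ?\<chi>"
    using \<chi> unfolding immersion_def by (auto simp: Q_def intro: smooth_map_subset)
  have smR: "smooth_map d R ?\<Psi>"
    using \<Psi> unfolding immersion_def by (auto simp: R_def intro: smooth_map_subset)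
  define G where "G t = ?\<Phi> (?\<chi> t)" for t
  define H where "H s = \<psi> (?\<Psi> s)" for s
  have G: "smooth_map d Q G" unfolding G_def by (rule smooth_map_lin_coord[OF Q smQ])
  have GR: "G t \<in> R" if "t \<in> Q" for t using that inj by (auto simp: Q_def R_def G_def)
  have HQ: "H s \<in> Q" if "s \<in> R" for s using that inj by (auto simp: Q_def R_def H_def)
  have GH: "G (H s) = s" if "s \<in> R" for s using that inj by (auto simp: R_def H_def G_def)
  have contH: "continuous_on R H"
  proof -
    have "continuous_on V \<psi>"
    proof -
      have "continuous_map (subtopology (top_of_set S) V) (Euclidean_space d) \<psi>"
        using \<psi> homeomorphic_imp_continuous_map continuous_map_into_fulltopology
        by (fastforce simp: is_chart_def)
      then have "continuous_map (top_of_set V) (top_of_set (coord_space d)) \<psi>"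
        using VS by (simp add: subtopology_subtopology Int_absorb1 Euclidean_space_eq[symmetric])
      then show ?thesis by (simp add: continuous_map_subtopology_eu)
    qed
    moreover have "?\<Psi> ` R \<subseteq> V" using inj by (auto simp: R_def)
    ultimately show ?thesis unfolding H_def
      using continuous_on_compose2 smooth_map_continuous_on[OF smR] by blast
  qed
  have jac: "jacobian_det d G t \<noteq> 0" if t: "t \<in> Q" for t
  proof
    assume "jacobian_det d G t = 0"
    then obtain v where v: "\<exists>i<d. v i \<noteq> 0"
      "\<And>k. k < d \<Longrightarrow> (\<Sum>i<d. v i * partial_derivative i (\<lambda>y. G y k) t) = 0"
      using det_zero_null_vector unfolding jacobian_det_def by blast
    have "(\<Sum>i<d. v i *\<^sub>R partial_derivative i (\<lambda>y. ?\<chi> y j) t) = 0" for j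
    proof -
      let ?D = "\<lambda>k. partial_derivative k (\<lambda>s. ?\<Psi> s j) (G t)"
      have eq: "?\<chi> y j = ?\<Psi> (G y) j" if "y \<in> Q" for y
        using that inj by (auto simp: Q_def G_def)
      have "partial_derivative i (\<lambda>y. ?\<chi> y j) t = (\<Sum>k<d. partial_derivative i (\<lambda>y. G y k) t *\<^sub>R ?D k)"
        if i: "i < d" for i
        using partial_derivative_cong[OF Q eq t i]
          smooth_partial_compose[OF R Q GR smooth_mapD[OF smR] G t i, of j] by simp
      then have "(\<Sum>i<d. v i *\<^sub>R partial_derivative i (\<lambda>y. ?\<chi> y j) t) =
          (\<Sum>i<d. \<Sum>k<d. (v i * partial_derivative i (\<lambda>y. G y k) t) *\<^sub>R ?D k)"
        by (simp add: scaleR_sum_right)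
      also have "\<dots> = (\<Sum>k<d. (\<Sum>i<d. v i * partial_derivative i (\<lambda>y. G y k) t) *\<^sub>R ?D k)"
        by (subst sum.swap) (simp add: scaleR_sum_left)
      also have "\<dots> = 0" using v(2) by (intro sum.neutral) simp
      finally show ?thesis .
    qed
    moreover have "t \<in> \<psi> ` V" using t by (auto simp: Q_def)
    ultimately have "\<forall>i<d. v i = 0" using \<chi> unfolding immersion_def by blast
    then show False using v(1) by blast
  qed
  have smH: "smooth_map d R H" by (rule smooth_map_inverse[OF Q R G HQ GH contH jac])
  let ?P' = "{y \<in> P. h y \<in> ?V'}"
  have P': "openin (Euclidean_space e) ?P'"
    using openin_Euclidean_preimage[OF P smooth_map_continuous_on[OF h] V'] hV VS by blast
  have smh: "smooth_map e ?P' (\<lambda>y. ?\<Phi> (h y))"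
    by (rule smooth_map_lin_coord[OF P' smooth_map_subset[OF h]]) auto
  have "smooth_map e ?P' (\<lambda>y. H (?\<Phi> (h y)))"
    by (rule smooth_map_compose[OF R P' _ smH smh]) (auto simp: R_def)
  then have "smooth_map e ?P' (\<lambda>y. \<psi> (h y))"
    by (rule smooth_map_cong[OF P', rotated]) (use inj in \<open>auto simp: H_def\<close>)
  moreover have "x \<in> ?P'" using x hV \<open>h x \<in> W\<close> by auto
  ultimately show "\<exists>V. openin (Euclidean_space e) V \<and> x \<in> V \<and> smooth_map e V (\<lambda>x. \<psi> (h x))"
    using P' by blast
qed

lemma submanifold_inverse_smooth:
  "(U, \<phi>) \<in> charts (submanifold d S) \<Longrightarrow> smooth_map d (\<phi> ` U) (inv_into U \<phi>)"
  by (simp add: submanifold_charts_iff immersion_def)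

lemma submanifold_compatible:
  assumes S: "locally_linear_graph d S"
    and c: "c \<in> charts (submanifold d S)" and c': "c' \<in> charts (submanifold d S)"
  shows "compatible d c c'"
proof -
  have "smooth_map d (overlap c c') (transition c c')"
    if c: "c \<in> charts (submanifold d S)" and c': "c' \<in> charts (submanifold d S)" for c c'
  proof -
    obtain U \<phi> V \<psi> where eq: "c = (U, \<phi>)" "c' = (V, \<psi>)" by (cases c, cases c')
    have \<phi>: "is_chart d (top_of_set S) (U, \<phi>)" and \<psi>: "is_chart d (top_of_set S) (V, \<psi>)"
      using c c' by (simp_all add: eq submanifold_charts_iff)
    have UV: "openin (top_of_set S) (U \<inter> V)" using is_chart_open[OF \<phi>] is_chart_open[OF \<psi>] by auto
    have "smooth_map d (\<phi> ` (U \<inter> V)) (\<lambda>x. \<psi> (inv_into U \<phi> x))"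
    proof (rule smooth_map_chart_comp[OF S c'[unfolded eq]])
      show "openin (Euclidean_space d) (\<phi> ` (U \<inter> V))" by (rule is_chart_open_image[OF \<phi> UV]) simp
      show "smooth_map d (\<phi> ` (U \<inter> V)) (inv_into U \<phi>)"
        using submanifold_inverse_smooth[OF c[unfolded eq]] by (rule smooth_map_subset) auto
    qed (use is_chart_inj[OF \<phi>] in auto)
    then show ?thesis by (simp add: eq overlap_def transition_def comp_def)
  qed
  then show ?thesis using c c' by (simp add: compatible_def)
qed

lemma submanifold_smooth_atlas:
  assumes S: "locally_linear_graph d S"
  shows "smooth_atlas d (top_of_set S) (charts (submanifold d S))"
  unfolding smooth_atlas_def
proof (intro conjI ballI)
  show ch: "is_chart d (top_of_set S) c" if "c \<in> charts (submanifold d S)" for c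
    using that by (cases c) (simp add: submanifold_charts_iff)
  have "\<Union> (fst ` charts (submanifold d S)) \<subseteq> S"
    using ch chart_image_subset by fastforce
  moreover have "S \<subseteq> \<Union> (fst ` charts (submanifold d S))"
    using S unfolding locally_linear_graph_def by force
  ultimately show "\<Union> (fst ` charts (submanifold d S)) = topspace (top_of_set S)" by auto
qed (rule submanifold_compatible[OF S])

lemma submanifold_chart_restrict:
  assumes c: "(U, \<phi>) \<in> charts (submanifold d S)" and V: "openin (top_of_set S) V" "V \<subseteq> U"
  shows "(V, \<phi>) \<in> charts (submanifold d S)"
proof -
  have \<phi>: "is_chart d (top_of_set S) (U, \<phi>)" and im: "immersion d (\<phi> ` U) (inv_into U \<phi>)"
    using c by (simp_all add: submanifold_charts_iff)
  have V': "is_chart d (top_of_set S) (V, \<phi>)" by (rule is_chart_restrict[OF \<phi> V])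
  note op = is_chart_image_open[OF V']
  have inv: "inv_into V \<phi> y = inv_into U \<phi> y" if "y \<in> \<phi> ` V" for y
    using that V is_chart_inj[OF \<phi>] is_chart_inj[OF V'] by auto
  have "immersion d (\<phi> ` V) (inv_into V \<phi>)"
    unfolding immersion_def
  proof (intro conjI ballI allI impI)
    show "smooth_map d (\<phi> ` V) (inv_into V \<phi>)"
      by (rule smooth_map_cong[OF op _ smooth_map_subset[OF submanifold_inverse_smooth[OF c]]])
        (use V inv in auto)
    fix x and v :: "nat \<Rightarrow> real" and l
    assume x: "x \<in> \<phi> ` V" and l: "l < d"
      and 0: "\<forall>j. (\<Sum>i<d. v i *\<^sub>R partial_derivative i (\<lambda>y. inv_into V \<phi> y j) x) = 0"
    have "partial_derivative i (\<lambda>y. inv_into V \<phi> y j) x = partial_derivative i (\<lambda>y. inv_into U \<phi> y j) x"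
      if "i < d" for i j
      by (rule partial_derivative_cong[OF op _ x that]) (simp add: inv)
    then have "\<forall>j. (\<Sum>i<d. v i *\<^sub>R partial_derivative i (\<lambda>y. inv_into U \<phi> y j) x) = 0"
      using 0 by simp
    moreover have "x \<in> \<phi> ` U" using x V by blast
    ultimately show "v l = 0" using im l unfolding immersion_def by blast
  qed
  then show ?thesis using V' by (simp add: submanifold_charts_iff)
qed

section \<open>Orienting framed submanifolds of a torus\<close>

lemma det_scale_rows:
  fixes A :: "nat \<Rightarrow> nat \<Rightarrow> real"
  shows "Determinant.det (Matrix.mat n n (\<lambda>(i, j). s i * A i j)) =
    (\<Prod>i<n. s i) * Determinant.det (Matrix.mat n n (\<lambda>(i, j). A i j))"
proof -
  have "Determinant.det (Matrix.mat n n (\<lambda>(i, j). B i j)) =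
    (\<Sum>p\<in>{p. p permutes {0..<n}}. signof p * (\<Prod>i=0..<n. B i (p i)))" for B :: "nat \<Rightarrow> nat \<Rightarrow> real"
    unfolding det_def'[OF mat_carrier]
    by (intro sum.cong prod.cong arg_cong2[where f = "(*)"] refl)
      (auto simp: permutes_in_image dest: permutes_in_image)
  then show ?thesis
    by (simp add: prod.distrib sum_distrib_left mult_ac lessThan_atLeast0)
qed

lemma det_zero_left_null_vector:
  fixes A :: "nat \<Rightarrow> nat \<Rightarrow> real"
  assumes "Determinant.det (Matrix.mat d d (\<lambda>(i, j). A i j)) = 0"
  shows "\<exists>v. (\<exists>i<d. v i \<noteq> 0) \<and> (\<forall>k<d. (\<Sum>i<d. v i * A i k) = 0)"
proof -
  have "transpose_mat (Matrix.mat d d (\<lambda>(i, j). A i j)) = Matrix.mat d d (\<lambda>(i, j). A j i)"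
    by (rule eq_matI) auto
  then have "Determinant.det (Matrix.mat d d (\<lambda>(i, j). A j i)) = 0"
    using assms det_transpose[of "Matrix.mat d d (\<lambda>(i, j). A i j)" d] by simp
  then show ?thesis using det_zero_null_vector[of d "\<lambda>i j. A j i"] by simp
qed

lemma det_block_extend:
  fixes A :: "nat \<Rightarrow> nat \<Rightarrow> real"
  assumes "d \<le> m"
  shows "Determinant.det (Matrix.mat m m (\<lambda>(i, j). if i < d \<and> j < d then A i j else if i = j then 1 else 0)) =
    Determinant.det (Matrix.mat d d (\<lambda>(i, j). A i j))"
proof -
  let ?A = "Matrix.mat d d (\<lambda>(i, j). A i j)"
  have "Matrix.mat m m (\<lambda>(i, j). if i < d \<and> j < d then A i j else if i = j then 1 else 0) =
    four_block_mat ?A (0\<^sub>m d (m - d)) (0\<^sub>m (m - d) d) (1\<^sub>m (m - d))"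
    using assms by (intro eq_matI) (auto simp: four_block_mat_def)
  also have "Determinant.det \<dots> = Determinant.det ?A * Determinant.det (1\<^sub>m (m - d) :: real mat)"
    by (rule det_four_block_mat_upper_right_zero[where n = d and m = "m - d"]) auto
  finally show ?thesis by simp
qed

text \<open>
  A curve on a torus has at each time a velocity in each of the circles; this is the angular velocity
  of the parametrized point in the \<open>j\<close>-th circle as the \<open>i\<close>-th parameter varies. Completing these
  velocity vectors by a frame \<open>N\<close> of the normal bundle gives a square matrix, whose determinant is the
  volume form induced on the submanifold, written in the given parametrization.
\<close>

definition angular_velocity ::
    "((nat \<Rightarrow> real) \<Rightarrow> nat \<Rightarrow> complex) \<Rightarrow> nat \<Rightarrow> nat \<Rightarrow> (nat \<Rightarrow> real) \<Rightarrow> real" where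
  "angular_velocity \<xi> i j x = Im (cnj (\<xi> x j) * partial_derivative i (\<lambda>y. \<xi> y j) x)"

definition orientation_form ::
    "nat \<Rightarrow> nat \<Rightarrow> (nat \<Rightarrow> (nat \<Rightarrow> complex) \<Rightarrow> nat \<Rightarrow> real) \<Rightarrow>
      ((nat \<Rightarrow> real) \<Rightarrow> nat \<Rightarrow> complex) \<Rightarrow> (nat \<Rightarrow> real) \<Rightarrow> real" where
  "orientation_form d m N \<xi> x = Determinant.det (Matrix.mat m m
     (\<lambda>(i, j). if i < d then angular_velocity \<xi> i (Suc j) x else N (i - d) (\<xi> x) (Suc j)))"

locale framed_submanifold =
  fixes d m :: nat and S :: "(nat \<Rightarrow> complex) set" and N :: "nat \<Rightarrow> (nat \<Rightarrow> complex) \<Rightarrow> nat \<Rightarrow> real"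
  assumes dim_le: "d \<le> m" and in_torus: "S \<subseteq> torus_set m"
    and graph: "locally_linear_graph d S"
    and continuous_frame: "\<And>r j. continuous_on S (\<lambda>z. N r z j)"
    and orientation_form_nonzero: "\<And>U \<phi> x. (U, \<phi>) \<in> charts (submanifold d S) \<Longrightarrow> x \<in> \<phi> ` U \<Longrightarrow>
      orientation_form d m N (inv_into U \<phi>) x \<noteq> 0"

lemma torus_setD:
  assumes "z \<in> torus_set m"
  shows "j \<in> {1..m} \<Longrightarrow> norm (z j) = 1" "j \<notin> {1..m} \<Longrightarrow> z j = undefined"
  using assms by (auto simp: torus_set_def PiE_iff extensional_def)

lemma partial_derivative_const_coordinate:
  assumes "openin (Euclidean_space d) P" "\<And>y. y \<in> P \<Longrightarrow> \<xi> y = c" "x \<in> P" "i < d"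
  shows "partial_derivative i \<xi> x = 0"
  using partial_derivative_cong[of d P \<xi> "\<lambda>y. c", OF assms(1,2,3,4)]
  by (simp add: partial_derivative_def)

text \<open>
  The velocity of a point moving on the unit circle is perpendicular to its position, so it is known
  from its angular part.
\<close>

lemma partial_derivative_torus:
  assumes P: "openin (Euclidean_space d) P" and \<xi>: "smooth_map d P \<xi>"
    and T: "\<And>y. y \<in> P \<Longrightarrow> \<xi> y \<in> torus_set m" and x: "x \<in> P" and i: "i < d"
  shows "j \<in> {1..m} \<Longrightarrow>
      partial_derivative i (\<lambda>y. \<xi> y j) x = \<i> * \<xi> x j * of_real (angular_velocity \<xi> i j x)"
    and "j \<notin> {1..m} \<Longrightarrow> partial_derivative i (\<lambda>y. \<xi> y j) x = 0"
proof -
  assume j: "j \<in> {1..m}"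
  let ?D = "partial_derivative i (\<lambda>y. \<xi> y j) x"
  have hp: "has_partial (\<lambda>y. \<xi> y j) i x ?D"
    by (rule smooth_has_partial[OF smooth_mapD[OF \<xi>] x i])
  have one: "\<xi> y j * cnj (\<xi> y j) = 1" if "y \<in> P" for y
    using torus_setD(1)[OF T[OF that] j] complex_norm_square[of "\<xi> y j"] by simp
  have "has_partial (\<lambda>y. \<xi> y j * cnj (\<xi> y j)) i x (\<xi> x j * cnj ?D + ?D * cnj (\<xi> x j))"
    using has_vector_derivative_mult[OF hp bounded_linear.has_vector_derivative[OF bounded_linear_cnj hp]]
    by (simp only: fun_upd_triv)
  then have "partial_derivative i (\<lambda>y. \<xi> y j * cnj (\<xi> y j)) x = \<xi> x j * cnj ?D + ?D * cnj (\<xi> x j)"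
    by (rule partial_derivative_eqI)
  moreover have "partial_derivative i (\<lambda>y. \<xi> y j * cnj (\<xi> y j)) x = 0"
    by (rule partial_derivative_const_coordinate[OF P one x i])
  ultimately have "Re (\<xi> x j * cnj ?D + ?D * cnj (\<xi> x j)) = 0" by simp
  then have "Re (cnj (\<xi> x j) * ?D) = 0" by (simp add: algebra_simps)
  then have "cnj (\<xi> x j) * ?D = \<i> * of_real (angular_velocity \<xi> i j x)"
    by (simp add: complex_eq_iff angular_velocity_def)
  then have "\<xi> x j * (cnj (\<xi> x j) * ?D) = \<xi> x j * (\<i> * of_real (angular_velocity \<xi> i j x))" by simp
  then show "?D = \<i> * \<xi> x j * of_real (angular_velocity \<xi> i j x)"
    using one[OF x] by (simp add: mult.assoc[symmetric] mult.commute[of \<i>])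
next
  assume "j \<notin> {1..m}"
  then have "\<xi> y j = undefined" if "y \<in> P" for y using torus_setD(2)[OF T[OF that]] by blast
  then show "partial_derivative i (\<lambda>y. \<xi> y j) x = 0"
    by (rule partial_derivative_const_coordinate[OF P _ x i])
qed

context framed_submanifold
begin

abbreviation "form \<equiv> orientation_form d m N"

lemma chart_facts:
  assumes "(U, \<phi>) \<in> charts (submanifold d S)"
  shows "is_chart d (top_of_set S) (U, \<phi>)" "openin (Euclidean_space d) (\<phi> ` U)" "inj_on \<phi> U"
    "U \<subseteq> S" "smooth_map d (\<phi> ` U) (inv_into U \<phi>)" "immersion d (\<phi> ` U) (inv_into U \<phi>)"
    "openin (top_of_set S) U"
proof -
  show *: "is_chart d (top_of_set S) (U, \<phi>)" and "immersion d (\<phi> ` U) (inv_into U \<phi>)"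
    using assms by (simp_all add: submanifold_charts_iff)
  show "openin (Euclidean_space d) (\<phi> ` U)" "inj_on \<phi> U" "U \<subseteq> S" "openin (top_of_set S) U"
    using is_chart_image_open[OF *] is_chart_inj[OF *] chart_image_subset[OF *] is_chart_open[OF *] by blast+
  show "smooth_map d (\<phi> ` U) (inv_into U \<phi>)" by (rule submanifold_inverse_smooth[OF assms])
qed

text \<open>
  By the chain rule the tangential rows are transformed by the transposed Jacobian matrix, while
  the normal rows do not depend on the parametrization.
\<close>

lemma form_transition:
  assumes c: "(U, \<phi>) \<in> charts (submanifold d S)" and c': "(V, \<psi>) \<in> charts (submanifold d S)"
    and x: "x \<in> \<phi> ` (U \<inter> V)"
  shows "form (inv_into U \<phi>) x =
    jacobian_det d (transition (U, \<phi>) (V, \<psi>)) x * form (inv_into V \<psi>) (transition (U, \<phi>) (V, \<psi>) x)"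
proof -
  let ?\<xi> = "inv_into U \<phi>" and ?\<xi>' = "inv_into V \<psi>" and ?\<tau> = "transition (U, \<phi>) (V, \<psi>)"
  note f = chart_facts[OF c] and f' = chart_facts[OF c']
  let ?P = "\<phi> ` (U \<inter> V)"
  have UV: "openin (top_of_set S) (U \<inter> V)" using f(7) f'(7) by auto
  have P: "openin (Euclidean_space d) ?P" by (rule is_chart_open_image[OF f(1) UV]) simp
  have \<tau>V: "?\<tau> y \<in> \<psi> ` V" if "y \<in> ?P" for y using that f(3) by (auto simp: transition_def)
  have eq: "?\<xi> y = ?\<xi>' (?\<tau> y)" if "y \<in> ?P" for y using that f(3) f'(3) by (auto simp: transition_def)
  have \<tau>: "smooth_map d ?P ?\<tau>"
    using submanifold_compatible[OF graph c c'] by (simp add: compatible_def overlap_def)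
  have av: "angular_velocity ?\<xi> i j x =
      (\<Sum>k<d. partial_derivative i (\<lambda>y. ?\<tau> y k) x * angular_velocity ?\<xi>' k j (?\<tau> x))" if i: "i < d" for i j
  proof -
    have "partial_derivative i (\<lambda>y. ?\<xi> y j) x = partial_derivative i (\<lambda>y. ?\<xi>' (?\<tau> y) j) x"
      by (rule partial_derivative_cong[OF P _ x i]) (simp add: eq)
    also have "\<dots> = (\<Sum>k<d. partial_derivative i (\<lambda>y. ?\<tau> y k) x *\<^sub>R
        partial_derivative k (\<lambda>y. ?\<xi>' y j) (?\<tau> x))"
      by (rule smooth_partial_compose[OF f'(2) P \<tau>V smooth_mapD[OF f'(5)] \<tau> x i])
    finally show ?thesis
      unfolding angular_velocity_def eq[OF x] by (simp add: sum_distrib_left Im_sum algebra_simps)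
  qed
  let ?T = "Matrix.mat m m (\<lambda>(i, j). if i < d \<and> j < d then partial_derivative i (\<lambda>y. ?\<tau> y j) x
      else if i = j then 1 else 0)"
  let ?M = "\<lambda>\<xi> x. Matrix.mat m m
     (\<lambda>(i, j). if i < d then angular_velocity \<xi> i (Suc j) x else N (i - d) (\<xi> x) (Suc j))"
  have "?M ?\<xi> x = ?T * ?M ?\<xi>' (?\<tau> x)"
  proof (rule eq_matI)
    fix i j assume "i < dim_row (?T * ?M ?\<xi>' (?\<tau> x))" "j < dim_col (?T * ?M ?\<xi>' (?\<tau> x))"
    then have ij: "i < m" "j < m" by auto
    have "(?T * ?M ?\<xi>' (?\<tau> x)) $$ (i, j) =
      (\<Sum>k<m. (if i < d \<and> k < d then partial_derivative i (\<lambda>y. ?\<tau> y k) x else if i = k then 1 else 0) *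
        (if k < d then angular_velocity ?\<xi>' k (Suc j) (?\<tau> x) else N (k - d) (?\<xi>' (?\<tau> x)) (Suc j)))"
      using ij by (simp add: scalar_prod_def lessThan_atLeast0)
    also have "\<dots> = ?M ?\<xi> x $$ (i, j)"
    proof (cases "i < d")
      case True
      have "(\<Sum>k<m. (if i < d \<and> k < d then partial_derivative i (\<lambda>y. ?\<tau> y k) x else if i = k then 1 else 0) *
        (if k < d then angular_velocity ?\<xi>' k (Suc j) (?\<tau> x) else N (k - d) (?\<xi>' (?\<tau> x)) (Suc j))) =
        (\<Sum>k<d. partial_derivative i (\<lambda>y. ?\<tau> y k) x * angular_velocity ?\<xi>' k (Suc j) (?\<tau> x))"
        using dim_le True by (intro sum.mono_neutral_cong_right) auto
      then show ?thesis using True ij av[OF True] by simp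
    next
      case False
      then have "(\<Sum>k<m. (if i < d \<and> k < d then partial_derivative i (\<lambda>y. ?\<tau> y k) x else if i = k then 1 else 0) *
        (if k < d then angular_velocity ?\<xi>' k (Suc j) (?\<tau> x) else N (k - d) (?\<xi>' (?\<tau> x)) (Suc j))) =
        (\<Sum>k<m. if i = k then N (k - d) (?\<xi>' (?\<tau> x)) (Suc j) else 0)"
        by (intro sum.cong) auto
      then show ?thesis using False ij eq[OF x] by simp
    qed
    finally show "?M ?\<xi> x $$ (i, j) = (?T * ?M ?\<xi>' (?\<tau> x)) $$ (i, j)" by simp
  qed auto
  then have "form ?\<xi> x = Determinant.det ?T * form ?\<xi>' (?\<tau> x)"
    unfolding orientation_form_def using det_mult[of ?T m "?M ?\<xi>' (?\<tau> x)"] by simp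
  moreover have "Determinant.det ?T = jacobian_det d ?\<tau> x"
  proof -
    have "Determinant.det ?T = Determinant.det (Matrix.mat d d (\<lambda>(i, j). partial_derivative i (\<lambda>y. ?\<tau> y j) x))"
      by (rule det_block_extend[OF dim_le])
    also have "Matrix.mat d d (\<lambda>(i, j). partial_derivative i (\<lambda>y. ?\<tau> y j) x) =
        transpose_mat (Matrix.mat d d (\<lambda>(i, j). partial_derivative j (\<lambda>y. ?\<tau> y i) x))"
      by (rule eq_matI) auto
    also have "Determinant.det \<dots> = jacobian_det d ?\<tau> x"
      unfolding jacobian_det_def by (rule det_transpose[where n = d]) simp
    finally show ?thesis .
  qed
  ultimately show ?thesis by simp
qed

lemma continuous_on_form:
  assumes c: "(U, \<phi>) \<in> charts (submanifold d S)"
  shows "continuous_on (\<phi> ` U) (form (inv_into U \<phi>))"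
proof -
  let ?\<xi> = "inv_into U \<phi>"
  note f = chart_facts[OF c]
  have cont: "continuous_on (\<phi> ` U) (\<lambda>x. ?\<xi> x j)" for j
    by (rule smooth_continuous_on[OF smooth_mapD[OF f(5)]])
  have im: "?\<xi> ` \<phi> ` U \<subseteq> S" using f(3,4) by auto
  have "tcd d 0 (\<phi> ` U) (\<lambda>x. Determinant.det (Matrix.mat m m
     (\<lambda>(i, j). if i < d then angular_velocity ?\<xi> i (Suc j) x else N (i - d) (?\<xi> x) (Suc j))))"
  proof (rule tcd_det[OF f(2)])
    fix i j
    show "tcd d 0 (\<phi> ` U) (\<lambda>x. if i < d then angular_velocity ?\<xi> i (Suc j) x else N (i - d) (?\<xi> x) (Suc j))"
    proof (cases "i < d")
      case True
      have "continuous_on (\<phi> ` U) (partial_derivative i (\<lambda>y. ?\<xi> y (Suc j)))"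
        by (rule smooth_continuous_on[OF smooth_partial[OF smooth_mapD[OF f(5)] True]])
      then show ?thesis using True cont by (auto simp: angular_velocity_def intro!: continuous_intros)
    next
      case False
      then show ?thesis
        using continuous_on_compose2[OF continuous_frame smooth_map_continuous_on[OF f(5)] im] by simp
    qed
  qed
  then show ?thesis by (simp add: orientation_form_def[abs_def])
qed

end

subsection \<open>Reflected charts\<close>

definition reflection :: "(nat \<Rightarrow> real) \<Rightarrow> nat \<Rightarrow> real" where
  "reflection x = (\<lambda>i. if i = 0 then - x 0 else x i)"

lemma reflection_invol [simp]: "reflection (reflection x) = x"
  by (auto simp: reflection_def fun_eq_iff)

lemma reflection_in_space: "d > 0 \<Longrightarrow> x \<in> coord_space d \<Longrightarrow> reflection x \<in> coord_space d"
  by (auto simp: reflection_def coord_space_iff)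

lemma smooth_map_reflection:
  assumes P: "openin (Euclidean_space d) P"
  shows "smooth_map d P reflection"
  unfolding smooth_map_def
proof
  fix j
  show "smooth d P (\<lambda>x. reflection x j)"
    by (cases "j = 0") (simp_all add: reflection_def smooth_coord P smooth_minus)
qed

lemma partial_derivative_reflection:
  "partial_derivative i (\<lambda>x. reflection x j) x = (if i = j then if i = 0 then -1 else 1 else 0)"
proof (rule partial_derivative_eqI)
  have "((\<lambda>t. - t :: real) has_vector_derivative - 1) (at (x 0))"
    by (rule has_vector_derivative_minus) (rule has_vector_derivative_id)
  then show "has_partial (\<lambda>x. reflection x j) i x (if i = j then if i = 0 then -1 else 1 else 0)"
    by (cases "i = j"; cases "j = 0")
      (auto intro: has_vector_derivative_const simp: reflection_def has_vector_derivative_id)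
qed

context framed_submanifold
begin

lemma reflected_chart:
  assumes d: "d > 0" and c: "(U, \<phi>) \<in> charts (submanifold d S)"
  shows "(U, \<lambda>z. reflection (\<phi> z)) \<in> charts (submanifold d S)" (is "?c \<in> _")
    and "x \<in> \<phi> ` U \<Longrightarrow> form (inv_into U (\<lambda>z. reflection (\<phi> z))) (reflection x) = - form (inv_into U \<phi>) x"
proof -
  note f = chart_facts[OF c]
  let ?P = "\<phi> ` U" and ?\<phi>' = "\<lambda>z. reflection (\<phi> z)"
  let ?\<xi> = "inv_into U \<phi>" and ?\<xi>' = "inv_into U ?\<phi>'"
  define Q where "Q = ?\<phi>' ` U"
  have E: "openin (Euclidean_space d) (coord_space d)" by simp
  have PE: "?P \<subseteq> coord_space d" using openin_subset[OF f(2)] .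
  have reflQ: "reflection y \<in> ?P" if "y \<in> Q" for y using that by (auto simp: Q_def)
  have op: "openin (Euclidean_space d) {y \<in> A. reflection y \<in> B}"
    if "openin (Euclidean_space d) A" "openin (Euclidean_space d) B" for A B
  proof -
    have "reflection ` A \<subseteq> coord_space d"
      using openin_subset[OF that(1)] reflection_in_space[OF d] by blast
    then show ?thesis
      using openin_Euclidean_preimage[OF that(1) smooth_map_continuous_on[OF smooth_map_reflection[OF that(1)]],
          of "coord_space d" B] that(2) by (simp add: Euclidean_space_eq[symmetric])
  qed
  have Qeq: "Q = {y \<in> coord_space d. reflection y \<in> ?P}"
  proof (intro equalityI subsetI)
    fix y assume "y \<in> Q"
    then obtain z where "z \<in> U" "y = reflection (\<phi> z)" by (auto simp: Q_def)
    then show "y \<in> {y \<in> coord_space d. reflection y \<in> ?P}"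
      using PE reflection_in_space[OF d, of "\<phi> z"] by auto
  next
    fix y assume "y \<in> {y \<in> coord_space d. reflection y \<in> ?P}"
    then obtain z where "z \<in> U" "reflection y = \<phi> z" by auto
    then have "y = reflection (\<phi> z)" by (metis reflection_invol)
    then show "y \<in> Q" using \<open>z \<in> U\<close> by (simp add: Q_def)
  qed
  have Q: "openin (Euclidean_space d) Q" unfolding Qeq by (rule op[OF E f(2)])
  have inj': "inj_on ?\<phi>' U"
  proof (rule inj_onI)
    fix a b assume "a \<in> U" "b \<in> U" "reflection (\<phi> a) = reflection (\<phi> b)"
    then show "a = b" using f(3) by (metis inj_onD reflection_invol)
  qed
  have \<xi>': "?\<xi>' y = ?\<xi> (reflection y)" if "y \<in> Q" for y
  proof -
    obtain z where "z \<in> U" "y = reflection (\<phi> z)" using \<open>y \<in> Q\<close> by (auto simp: Q_def)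
    then show ?thesis using inv_into_f_f[OF inj' \<open>z \<in> U\<close>] f(3) by simp
  qed
  have chart': "is_chart d (top_of_set S) (U, ?\<phi>')"
  proof (rule is_chartI[where \<phi> = ?\<phi>' and \<psi> = "\<lambda>y. ?\<xi> (reflection y)", OF f(7) Q])
    fix B assume B: "openin (Euclidean_space d) B" "B \<subseteq> Q"
    have "{x \<in> U. ?\<phi>' x \<in> B} = {x \<in> U. \<phi> x \<in> {y \<in> ?P. reflection y \<in> B}}" by auto
    then show "openin (top_of_set S) {x \<in> U. ?\<phi>' x \<in> B}"
      using is_chart_open_preimage[OF f(1) op[OF f(2) B(1)]] by simp
  next
    fix A assume A: "openin (top_of_set S) A" "A \<subseteq> U"
    have "{t \<in> Q. ?\<xi> (reflection t) \<in> A} = {t \<in> Q. reflection t \<in> \<phi> ` A}"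
    proof (intro Collect_cong conj_cong refl)
      fix t assume "t \<in> Q"
      then obtain z where z: "z \<in> U" "reflection t = \<phi> z" by (auto simp: Q_def)
      then have "?\<xi> (reflection t) = z" using f(3) by simp
      then show "?\<xi> (reflection t) \<in> A \<longleftrightarrow> reflection t \<in> \<phi> ` A"
        using z inj_on_image_mem_iff[OF f(3) z(1) A(2)] by simp
    qed
    then show "openin (Euclidean_space d) {t \<in> Q. ?\<xi> (reflection t) \<in> A}"
      using op[OF Q is_chart_open_image[OF f(1) A]] by simp
  qed (use f(3) in \<open>auto simp: Q_def\<close>)
  have sm0: "smooth_map d Q (\<lambda>y. ?\<xi> (reflection y))"
    by (rule smooth_map_compose[OF f(2) Q reflQ f(5) smooth_map_reflection[OF Q]])
  have sm: "smooth_map d Q ?\<xi>'" by (rule smooth_map_cong[OF Q _ sm0]) (simp add: \<xi>')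
  have part: "partial_derivative i (\<lambda>y. ?\<xi>' y j) y =
      (if i = 0 then -1 else 1) *\<^sub>R partial_derivative i (\<lambda>y. ?\<xi> y j) (reflection y)"
    if y: "y \<in> Q" and i: "i < d" for y i j
  proof -
    have "partial_derivative i (\<lambda>y. ?\<xi>' y j) y = partial_derivative i (\<lambda>y. ?\<xi> (reflection y) j) y"
      by (rule partial_derivative_cong[OF Q _ y i]) (simp add: \<xi>')
    also have "\<dots> = (\<Sum>k<d. partial_derivative i (\<lambda>y. reflection y k) y *\<^sub>R
        partial_derivative k (\<lambda>y. ?\<xi> y j) (reflection y))"
      by (rule smooth_partial_compose[OF f(2) Q reflQ smooth_mapD[OF f(5)] smooth_map_reflection[OF Q] y i])
    also have "\<dots> = (\<Sum>k<d. if k = i then (if i = 0 then -1 else 1) *\<^sub>R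
        partial_derivative i (\<lambda>y. ?\<xi> y j) (reflection y) else 0)"
      by (intro sum.cong) (auto simp: partial_derivative_reflection)
    also have "\<dots> = (if i = 0 then -1 else 1) *\<^sub>R partial_derivative i (\<lambda>y. ?\<xi> y j) (reflection y)"
      using i by simp
    finally show ?thesis .
  qed
  have "immersion d Q ?\<xi>'"
    unfolding immersion_def
  proof (intro conjI ballI allI impI sm)
    fix y and v :: "nat \<Rightarrow> real" and l
    assume y: "y \<in> Q" and l: "l < d"
      and 0: "\<forall>j. (\<Sum>i<d. v i *\<^sub>R partial_derivative i (\<lambda>y. ?\<xi>' y j) y) = 0"
    let ?v = "\<lambda>i. v i * (if i = 0 then -1 else 1)"
    have "(\<Sum>i<d. ?v i *\<^sub>R partial_derivative i (\<lambda>y. ?\<xi> y j) (reflection y)) = 0" for j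
    proof -
      have "(\<Sum>i<d. ?v i *\<^sub>R partial_derivative i (\<lambda>y. ?\<xi> y j) (reflection y)) =
        (\<Sum>i<d. v i *\<^sub>R partial_derivative i (\<lambda>y. ?\<xi>' y j) y)"
        by (intro sum.cong) (auto simp: part[OF y])
      then show ?thesis using 0 by simp
    qed
    then have "?v l = 0" using immersionD[OF f(6) reflQ[OF y] _ l, where v = ?v] by blast
    then show "v l = 0" by (simp split: if_splits)
  qed
  then show "?c \<in> charts (submanifold d S)" using chart' by (simp add: submanifold_charts_iff Q_def)
  assume x: "x \<in> ?P"
  define y where "y = reflection x"
  have y: "y \<in> Q" "reflection y = x" using x by (auto simp: y_def Q_def)
  let ?A = "\<lambda>i j. if i < d then angular_velocity ?\<xi> i (Suc j) x else N (i - d) (?\<xi> x) (Suc j)"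
  have eq: "Matrix.mat m m (\<lambda>(i, j). if i < d then angular_velocity ?\<xi>' i (Suc j) y else N (i - d) (?\<xi>' y) (Suc j)) =
     Matrix.mat m m (\<lambda>(i, j). (if i = 0 then -1 else 1) * ?A i j)"
    using d by (intro cong_mat) (auto simp: angular_velocity_def part[OF y(1)] y(2) \<xi>'[OF y(1)])
  have "(\<Prod>i<m. if i = 0 then -1 else 1 :: real) = (\<Prod>i\<in>{0::nat}. -1)"
    using d dim_le by (intro prod.mono_neutral_cong_right) auto
  then have "form ?\<xi>' y = - form ?\<xi> x"
    unfolding orientation_form_def eq det_scale_rows by simp
  then show "form ?\<xi>' (reflection x) = - form ?\<xi> x" by (simp add: y_def)
qed

text \<open>Small charts carry either sign of the form; in dimension 0 there is nothing to reflect.\<close>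

lemma chart_with_sign:
  assumes d: "d > 0" and z: "z \<in> A" and A: "openin (top_of_set S) A" and \<epsilon>: "\<epsilon> = 1 \<or> \<epsilon> = (-1::real)"
  shows "\<exists>U \<phi>. (U, \<phi>) \<in> charts (submanifold d S) \<and> z \<in> U \<and> U \<subseteq> A \<and>
    (\<forall>x\<in>\<phi> ` U. \<epsilon> * form (inv_into U \<phi>) x > 0)"
proof -
  have "z \<in> S" using z openin_subset[OF A] by auto
  then obtain V \<phi> where c: "(V, \<phi>) \<in> charts (submanifold d S)" "z \<in> V"
    using graph unfolding locally_linear_graph_def by blast
  note f = chart_facts[OF c(1)]
  define \<sigma> where "\<sigma> = sgn (form (inv_into V \<phi>) (\<phi> z))"
  have nz: "form (inv_into V \<phi>) (\<phi> z) \<noteq> 0" using orientation_form_nonzero[OF c(1)] c(2) by blast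
  let ?B = "{t \<in> \<phi> ` V. form (inv_into V \<phi>) t \<in> {r. \<sigma> * r > 0}}"
  have "open {r::real. \<sigma> * r > 0}" by (intro open_Collect_less continuous_intros)
  then have B: "openin (Euclidean_space d) ?B"
    using openin_Euclidean_preimage[OF f(2) continuous_on_form[OF c(1)], of UNIV "{r. \<sigma> * r > 0}"] by simp
  define U where "U = {x \<in> V. \<phi> x \<in> ?B} \<inter> A"
  have U: "openin (top_of_set S) U" "U \<subseteq> V" "U \<subseteq> A"
    using is_chart_open_preimage[OF f(1) B] A by (auto simp: U_def)
  have zU: "z \<in> U" using c(2) z nz by (auto simp: U_def \<sigma>_def sgn_if)
  have cU: "(U, \<phi>) \<in> charts (submanifold d S)" by (rule submanifold_chart_restrict[OF c(1) U(1,2)])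
  have sign: "\<sigma> * form (inv_into U \<phi>) x > 0" if x: "x \<in> \<phi> ` U" for x
  proof -
    have "form (inv_into U \<phi>) x = jacobian_det d (transition (U, \<phi>) (V, \<phi>)) x *
        form (inv_into V \<phi>) (transition (U, \<phi>) (V, \<phi>) x)"
      by (rule form_transition[OF cU c(1)]) (use x U in auto)
    moreover have tr: "transition (U, \<phi>) (V, \<phi>) y = y" if "y \<in> \<phi> ` U" for y
      using that U f(3) chart_facts(3)[OF cU] by (auto simp: transition_def)
    moreover have "jacobian_det d (transition (U, \<phi>) (V, \<phi>)) x = 1"
    proof -
      have "partial_derivative j (\<lambda>y. transition (U, \<phi>) (V, \<phi>) y i) x = (if i = j then 1 else 0)"
        if j: "j < d" for i j
      proof -
        have "partial_derivative j (\<lambda>y. transition (U, \<phi>) (V, \<phi>) y i) x = partial_derivative j (\<lambda>y. y i) x"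
          by (rule partial_derivative_cong[OF chart_facts(2)[OF cU] _ x j]) (simp add: tr)
        also have "\<dots> = (if i = j then 1 else 0)"
          by (rule partial_derivative_eqI)
            (cases "i = j", auto intro: has_vector_derivative_const simp: has_vector_derivative_id)
        finally show ?thesis .
      qed
      then have "Matrix.mat d d (\<lambda>(i, j). partial_derivative j (\<lambda>y. transition (U, \<phi>) (V, \<phi>) y i) x) = 1\<^sub>m d"
        by (intro eq_matI) auto
      then show ?thesis by (simp add: jacobian_det_def)
    qed
    ultimately have "form (inv_into U \<phi>) x = form (inv_into V \<phi>) x" using x by simp
    moreover have "x \<in> ?B" using x by (auto simp: U_def)
    ultimately show ?thesis by simp
  qed
  have "\<sigma> = 1 \<or> \<sigma> = -1" using nz by (auto simp: \<sigma>_def sgn_if)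
  then consider "\<sigma> = \<epsilon>" | "\<sigma> = - \<epsilon>" using \<epsilon> by auto
  then show ?thesis
  proof cases
    case 1
    then show ?thesis using cU zU U(3) sign by blast
  next
    case 2
    have "\<epsilon> * form (inv_into U (\<lambda>z. reflection (\<phi> z))) x > 0" if "x \<in> (\<lambda>z. reflection (\<phi> z)) ` U" for x
      using that reflected_chart(2)[OF d cU] sign 2 by fastforce
    then show ?thesis using reflected_chart(1)[OF d cU] zU U(3) by blast
  qed
qed

end

lemma orientable_dimension_0:
  assumes "smooth_atlas 0 (topology_of M) (charts M)" "dimension M = 0"
  shows "orientable M"
  unfolding orientable_def oriented_atlas_def
  using assms by (intro exI[of _ "charts M"]) (auto simp: smooth_atlas_def jacobian_det_def)

section \<open>Explicit charts\<close>

subsection \<open>The torus\<close>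

definition arc_point :: "complex \<Rightarrow> real \<Rightarrow> complex" where
  "arc_point c t = c * (of_real (sqrt (1 - t * t)) + \<i> * of_real t)"

lemma abs_less_1_square: "\<bar>t\<bar> < 1 \<Longrightarrow> 1 - t * t > (0::real)"
  using abs_square_less_1[of t] by (simp add: power2_eq_square)

lemma cnj_mult_unit: "norm c = 1 \<Longrightarrow> cnj c * c = 1"
  using complex_norm_square[of c] by (simp add: mult.commute)

lemma norm_arc_point:
  assumes "norm c = 1" "\<bar>t\<bar> < 1"
  shows "norm (arc_point c t) = 1"
proof -
  have "norm (of_real (sqrt (1 - t * t)) + \<i> * of_real t) = sqrt ((sqrt (1 - t * t))\<^sup>2 + t\<^sup>2)"
    by (simp add: cmod_def)
  also have "\<dots> = 1" using abs_less_1_square[OF assms(2)] by (simp add: power2_eq_square)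
  finally show ?thesis using assms(1) by (simp add: arc_point_def norm_mult)
qed

lemma cnj_mult_arc_point:
  assumes "norm c = 1"
  shows "cnj c * arc_point c t = of_real (sqrt (1 - t * t)) + \<i> * of_real t"
  using cnj_mult_unit[OF assms] by (simp add: arc_point_def mult.assoc[symmetric])

lemma arc_point_inverse:
  assumes c: "norm c = 1" and w: "norm w = 1" and pos: "Re (cnj c * w) > 0"
  shows "\<bar>Im (cnj c * w)\<bar> < 1" "arc_point c (Im (cnj c * w)) = w"
proof -
  let ?u = "cnj c * w"
  have "norm ?u = 1" using c w by (simp add: norm_mult)
  then have sq: "(Re ?u)\<^sup>2 + (Im ?u)\<^sup>2 = 1" using cmod_power2[of ?u] by simp
  then have "(Im ?u)\<^sup>2 < 1" using zero_less_power[OF pos, of 2] by linarith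
  then show "\<bar>Im ?u\<bar> < 1" by (simp add: abs_square_less_1)
  have "1 - Im ?u * Im ?u = (Re ?u)\<^sup>2" using sq by (simp add: power2_eq_square)
  then have "sqrt (1 - Im ?u * Im ?u) = Re ?u" using pos by (simp only: real_sqrt_unique)
  then have "of_real (sqrt (1 - Im ?u * Im ?u)) + \<i> * of_real (Im ?u) = ?u"
    by (simp only: complex_eq[symmetric])
  then have "arc_point c (Im ?u) = c * ?u" by (simp only: arc_point_def)
  also have "\<dots> = w" using cnj_mult_unit[OF c] by (simp add: mult.assoc[symmetric] mult.commute[of c])
  finally show "arc_point c (Im ?u) = w" .
qed

lemma smooth_arc_point:
  assumes P: "openin (Euclidean_space d) P" and "\<And>x. x \<in> P \<Longrightarrow> \<bar>x i\<bar> < 1"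
  shows "smooth d P (\<lambda>x. arc_point c (x i))"
proof -
  have "1 - x i * x i > 0" if "x \<in> P" for x using abs_less_1_square[OF assms(2)[OF that]] .
  then show ?thesis unfolding arc_point_def
    by (intro smooth_mult smooth_const smooth_add smooth_linear[OF bounded_linear_of_real] smooth_sqrt
        smooth_diff smooth_coord P)
qed

definition open_cube :: "nat \<Rightarrow> (nat \<Rightarrow> real) set" where
  "open_cube d = {t \<in> coord_space d. \<forall>i<d. \<bar>t i\<bar> < 1}"

lemma openin_open_cube: "openin (Euclidean_space d) (open_cube d)"
proof -
  have "open (\<Inter>i\<in>{..<d}. {t::nat \<Rightarrow> real. \<bar>t i\<bar> < 1})"
    by (intro open_INT ballI open_Collect_less continuous_intros continuous_on_product_coordinates) auto
  moreover have "open_cube d = coord_space d \<inter> (\<Inter>i\<in>{..<d}. {t. \<bar>t i\<bar> < 1})"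
    by (auto simp: open_cube_def)
  ultimately show ?thesis unfolding openin_Euclidean_space_open by blast
qed

lemma open_Collect_coordinates_Re_pos:
  assumes "finite J"
  shows "open {w :: nat \<Rightarrow> complex. \<forall>j\<in>J. Re (cnj (z j) * w j) > 0}"
proof -
  have "open (\<Inter>j\<in>J. {w :: nat \<Rightarrow> complex. Re (cnj (z j) * w j) > 0})"
    using assms by (intro open_INT ballI open_Collect_less continuous_intros continuous_on_product_coordinates)
  moreover have "{w. \<forall>j\<in>J. Re (cnj (z j) * w j) > 0} = (\<Inter>j\<in>J. {w. Re (cnj (z j) * w j) > 0})" by auto
  ultimately show ?thesis by simp
qed

lemma locally_linear_graph_torus: "locally_linear_graph d (torus_set d)"
  unfolding locally_linear_graph_def
proof
  fix z assume z: "z \<in> torus_set d"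
  let ?a = "\<lambda>i. - \<i> * cnj (z (Suc i))"
  define W where "W = torus_set d \<inter> {w. \<forall>j\<in>{1..d}. Re (cnj (z j) * w j) > 0}"
  define \<Psi> where "\<Psi> t = (\<lambda>j\<in>{1..d}. arc_point (z j) (t (j - 1)))" for t
  have W: "openin (top_of_set (torus_set d)) W"
    unfolding W_def by (intro openin_open_Int open_Collect_coordinates_Re_pos) simp
  have coord: "lin_coord d ?a Suc w i = (if i < d then Im (cnj (z (Suc i)) * w (Suc i)) else 0)" for w i
    by (simp add: lin_coord_def)
  have "(W, lin_coord d ?a Suc) \<in> charts (submanifold d (torus_set d))"
  proof (rule lin_coord_chartI[where \<Psi> = \<Psi>, OF openin_open_cube _ W])
    show "smooth_map d (open_cube d) \<Psi>"
      unfolding smooth_map_def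
    proof
      fix j
      show "smooth d (open_cube d) (\<lambda>t. \<Psi> t j)"
        by (cases "j \<in> {1..d}")
          (auto simp: \<Psi>_def open_cube_def[symmetric] intro!: smooth_const openin_open_cube smooth_arc_point,
           auto simp: open_cube_def)
    qed
    fix t assume t: "t \<in> open_cube d"
    then have t1: "\<bar>t (j - 1)\<bar> < 1" if "j \<in> {1..d}" for j using that by (auto simp: open_cube_def)
    have "Re (cnj (z j) * \<Psi> t j) > 0" if j: "j \<in> {1..d}" for j
      using cnj_mult_arc_point[OF torus_setD(1)[OF z j]] abs_less_1_square[OF t1[OF j]] j by (simp add: \<Psi>_def)
    then show "\<Psi> t \<in> W"
      using norm_arc_point[OF torus_setD(1)[OF z] t1] by (auto simp: W_def torus_set_def \<Psi>_def PiE_iff)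
    show "lin_coord d ?a Suc (\<Psi> t) = t"
    proof
      fix i
      show "lin_coord d ?a Suc (\<Psi> t) i = t i"
      proof (cases "i < d")
        case True
        then have "lin_coord d ?a Suc (\<Psi> t) i = Im (cnj (z (Suc i)) * \<Psi> t (Suc i))" using coord by presburger
        also have "\<Psi> t (Suc i) = arc_point (z (Suc i)) (t i)" using True by (simp add: \<Psi>_def)
        finally show ?thesis using cnj_mult_arc_point[OF torus_setD(1)[OF z], of "Suc i" "t i"] True by simp
      next
        case False
        then show ?thesis using t coord[of "\<Psi> t" i] by (simp add: open_cube_def coord_space_iff)
      qed
    qed
  next
    fix w assume w: "w \<in> W"
    have wT: "w \<in> torus_set d" using w by (simp add: W_def)
    have inv: "\<bar>Im (cnj (z j) * w j)\<bar> < 1" "arc_point (z j) (Im (cnj (z j) * w j)) = w j" if j: "j \<in> {1..d}" for j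
      using arc_point_inverse[OF torus_setD(1)[OF z j] torus_setD(1)[OF wT j]] w j by (auto simp: W_def)
    show "lin_coord d ?a Suc w \<in> open_cube d"
      unfolding open_cube_def
    proof (intro CollectI conjI allI impI lin_coord_in_space)
      fix i assume "i < d"
      then show "\<bar>lin_coord d ?a Suc w i\<bar> < 1" using inv(1)[of "Suc i"] coord[of w i] by simp
    qed
    show "\<Psi> (lin_coord d ?a Suc w) = w"
    proof
      fix j
      show "\<Psi> (lin_coord d ?a Suc w) j = w j"
      proof (cases "j \<in> {1..d}")
        case True
        then have "j - 1 < d" "Suc (j - 1) = j" by auto
        then have "lin_coord d ?a Suc w (j - 1) = Im (cnj (z j) * w j)" using coord[of w "j - 1"] by simp
        then show ?thesis using inv(2)[OF True] True by (simp add: \<Psi>_def)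
      next
        case False
        then show ?thesis using torus_setD(2)[OF wT False] unfolding \<Psi>_def by (simp only: restrict_apply if_False)
      qed
    qed
  qed
  moreover have "Re (cnj (z j) * z j) > 0" if "j \<in> {1..d}" for j
    unfolding cnj_mult_unit[OF torus_setD(1)[OF z that]] by simp
  then have "z \<in> W" using z by (simp add: W_def del: times_complex.sel)
  ultimately show "\<exists>W a \<kappa>. z \<in> W \<and> (W, lin_coord d a \<kappa>) \<in> charts (submanifold d (torus_set d))" by blast
qed

lemma framed_torus: "framed_submanifold d d (torus_set d) (\<lambda>_ _ _. 0)"
proof
  show "locally_linear_graph d (torus_set d)" by (rule locally_linear_graph_torus)
  fix U \<phi> x assume c: "(U, \<phi>) \<in> charts (submanifold d (torus_set d))" and x: "x \<in> \<phi> ` U"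
  let ?\<xi> = "inv_into U \<phi>"
  have \<phi>: "is_chart d (top_of_set (torus_set d)) (U, \<phi>)" and im: "immersion d (\<phi> ` U) ?\<xi>"
    using c by (simp_all add: submanifold_charts_iff)
  have T: "?\<xi> y \<in> torus_set d" if "y \<in> \<phi> ` U" for y
    using that chart_image_subset[OF \<phi>] inv_into_into[OF that] by blast
  have pd: "partial_derivative i (\<lambda>y. ?\<xi> y j) x = \<i> * ?\<xi> x j * of_real (angular_velocity ?\<xi> i j x)"
    if "i < d" "j \<in> {1..d}" for i j
    by (rule partial_derivative_torus(1)[OF is_chart_image_open[OF \<phi>] submanifold_inverse_smooth[OF c] _ x that])
      (rule T)
  have pd0: "partial_derivative i (\<lambda>y. ?\<xi> y j) x = 0" if "i < d" "j \<notin> {1..d}" for i j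
    by (rule partial_derivative_torus(2)[OF is_chart_image_open[OF \<phi>] submanifold_inverse_smooth[OF c] _ x that])
      (rule T)
  show "orientation_form d d (\<lambda>_ _ _. 0) ?\<xi> x \<noteq> 0"
  proof
    assume "orientation_form d d (\<lambda>_ _ _. 0) ?\<xi> x = 0"
    then obtain v where v: "\<exists>i<d. v i \<noteq> 0"
      "\<forall>k<d. (\<Sum>i<d. v i * (if i < d then angular_velocity ?\<xi> i (Suc k) x else 0)) = 0"
      unfolding orientation_form_def using det_zero_left_null_vector by blast
    have "(\<Sum>i<d. v i *\<^sub>R partial_derivative i (\<lambda>y. ?\<xi> y j) x) = 0" for j
    proof (cases "j \<in> {1..d}")
      case True
      then have "j - 1 < d" "Suc (j - 1) = j" by auto
      then have "(\<Sum>i<d. v i * angular_velocity ?\<xi> i j x) = 0" using v(2)[rule_format, of "j - 1"] by simp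
      have "(\<Sum>i<d. v i *\<^sub>R partial_derivative i (\<lambda>y. ?\<xi> y j) x) =
          (\<Sum>i<d. \<i> * ?\<xi> x j * of_real (v i * angular_velocity ?\<xi> i j x))"
        using pd[OF _ True] by (intro sum.cong) (auto simp: scaleR_conv_of_real)
      also have "\<dots> = \<i> * ?\<xi> x j * of_real (\<Sum>i<d. v i * angular_velocity ?\<xi> i j x)"
        by (simp only: sum_distrib_left of_real_sum)
      finally show ?thesis using \<open>(\<Sum>i<d. v i * angular_velocity ?\<xi> i j x) = 0\<close> by simp
    qed (simp add: pd0)
    then have "v i = 0" if "i < d" for i using immersionD[OF im x _ that, where v = v] by blast
    then show False using v(1) by blast
  qed
qed auto

subsection \<open>Triangles with two given sides\<close>

text \<open>
  A unit vector \<open>w\<close> with \<open>D = p w + q w'\<close> for another unit vector \<open>w'\<close>: the apex of a triangle with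
  base \<open>D\<close> and sides \<open>p\<close>, \<open>q\<close>, the sign \<open>\<epsilon>\<close> telling on which side of the base it lies.
\<close>

definition apex :: "real \<Rightarrow> real \<Rightarrow> real \<Rightarrow> complex \<Rightarrow> complex" where
  "apex \<epsilon> p q D =
     (let r = Re D * Re D + Im D * Im D; A = (r + (p * p - q * q)) * inverse (2 * p * r)
      in D * (of_real A + \<i> * of_real (\<epsilon> * sqrt (inverse r - A * A))))"

definition triangle_condition :: "real \<Rightarrow> real \<Rightarrow> complex \<Rightarrow> bool" where
  "triangle_condition p q D \<longleftrightarrow>
     (let r = Re D * Re D + Im D * Im D in (r + (p * p - q * q))\<^sup>2 < 4 * p\<^sup>2 * r)"

lemma triangle_condition_pos:
  assumes p: "p > 0" and tri: "triangle_condition p q D"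
  defines "r \<equiv> Re D * Re D + Im D * Im D"
  shows "r > 0" and "inverse r - ((r + (p * p - q * q)) * inverse (2 * p * r))\<^sup>2 > 0"
proof -
  have *: "(r + (p * p - q * q))\<^sup>2 < 4 * p\<^sup>2 * r" using tri by (simp add: triangle_condition_def r_def Let_def)
  then have "0 < 4 * p\<^sup>2 * r" using zero_le_power2 le_less_trans by blast
  then show r: "r > 0" using p by (simp add: zero_less_mult_iff)
  have "((r + (p * p - q * q)) * inverse (2 * p * r))\<^sup>2 = (r + (p * p - q * q))\<^sup>2 / (2 * p * r)\<^sup>2"
    by (simp only: power_mult_distrib[of "r + (p * p - q * q)"] power_inverse divide_inverse)
  also have "(2 * p * r)\<^sup>2 = 4 * p\<^sup>2 * r\<^sup>2" by (simp add: power_mult_distrib)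
  also have "(r + (p * p - q * q))\<^sup>2 / (4 * p\<^sup>2 * r\<^sup>2) < (4 * p\<^sup>2 * r) / (4 * p\<^sup>2 * r\<^sup>2)"
    using * p r by (intro divide_strict_right_mono) auto
  also have "\<dots> = inverse r" using p r by (simp add: power2_eq_square divide_simps)
  finally show "inverse r - ((r + (p * p - q * q)) * inverse (2 * p * r))\<^sup>2 > 0" by simp
qed

lemma triangle_discriminant:
  assumes p: "p > 0" and q: "q > 0" and D: "D \<noteq> 0" and "\<bar>p - q\<bar> \<le> norm D" "norm D \<le> p + q"
  shows "let r = Re D * Re D + Im D * Im D; A = (r + (p * p - q * q)) * inverse (2 * p * r)
      in inverse r - A * A \<ge> 0"
proof -
  define r where "r = Re D * Re D + Im D * Im D"
  have r: "r = (norm D)\<^sup>2" using cmod_power2[of D] by (simp add: power2_eq_square r_def)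
  then have rp: "r > 0" using D by simp
  have "0 \<le> ((q - (norm D - p)) * (q + (norm D - p))) * (((norm D + p) - q) * ((norm D + p) + q))"
    using assms by (intro mult_nonneg_nonneg) (auto simp: abs_le_iff)
  also have "\<dots> = 4 * p\<^sup>2 * r - (r + (p * p - q * q))\<^sup>2"
    by (simp add: r power2_eq_square algebra_simps)
  finally have "(r + (p * p - q * q))\<^sup>2 / (2 * p * r)\<^sup>2 \<le> 4 * p\<^sup>2 * r / (2 * p * r)\<^sup>2"
    by (intro divide_right_mono) auto
  also have "4 * p\<^sup>2 * r / (2 * p * r)\<^sup>2 = inverse r"
    using p rp by (simp add: power2_eq_square divide_simps)
  also have "(r + (p * p - q * q))\<^sup>2 / (2 * p * r)\<^sup>2 =
      (r + (p * p - q * q)) * inverse (2 * p * r) * ((r + (p * p - q * q)) * inverse (2 * p * r))"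
    by (simp only: power2_eq_square divide_inverse inverse_mult_distrib mult_ac)
  finally show ?thesis by (simp only: Let_def r_def[symmetric] diff_ge_0_iff_ge)
qed

lemma triangle_conditionI:
  assumes p: "p > 0" and q: "q > 0" and "\<bar>p - q\<bar> < norm D" "norm D < p + q"
  shows "triangle_condition p q D"
proof -
  let ?s = "norm D"
  have r: "Re D * Re D + Im D * Im D = ?s\<^sup>2" using cmod_power2[of D] by (simp add: power2_eq_square)
  have "(q - (?s - p)) > 0" "(q + (?s - p)) > 0" "((?s + p) - q) > 0" "(?s + p) + q > 0"
    using assms by (auto simp: abs_less_iff)
  then have "0 < ((q - (?s - p)) * (q + (?s - p))) * (((?s + p) - q) * ((?s + p) + q))"
    by (intro mult_pos_pos)
  also have "\<dots> = 4 * p\<^sup>2 * ?s\<^sup>2 - (?s\<^sup>2 + (p * p - q * q))\<^sup>2"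
    by (simp add: power2_eq_square algebra_simps)
  finally show ?thesis by (simp add: triangle_condition_def r)
qed

lemma apex_norms:
  assumes p: "p > 0" and q: "q > 0" and D: "D \<noteq> 0" and \<epsilon>: "\<epsilon> = 1 \<or> \<epsilon> = -1"
    and disc: "(let r = Re D * Re D + Im D * Im D; A = (r + (p * p - q * q)) * inverse (2 * p * r)
      in inverse r - A * A \<ge> 0)"
  shows "norm (apex \<epsilon> p q D) = 1" "norm (D - of_real p * apex \<epsilon> p q D) = q"
proof -
  define r where "r = Re D * Re D + Im D * Im D"
  define A where "A = (r + (p * p - q * q)) * inverse (2 * p * r)"
  define s where "s = sqrt (inverse r - A * A)"
  have nD: "(norm D)\<^sup>2 = r" using cmod_power2[of D] by (simp add: r_def power2_eq_square)
  have r: "r > 0" using nD D by (metis zero_less_norm_iff zero_less_power)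
  have s: "s * s = inverse r - A * A" using disc by (simp add: s_def Let_def r_def A_def)
  have \<epsilon>2: "\<epsilon> * \<epsilon> = 1" using \<epsilon> by auto
  have apex: "apex \<epsilon> p q D = D * (of_real A + \<i> * of_real (\<epsilon> * s))"
    by (simp add: apex_def Let_def r_def A_def s_def)
  have \<epsilon>s: "(\<epsilon> * s)\<^sup>2 = inverse r - A * A"
  proof -
    have "(\<epsilon> * s)\<^sup>2 = (\<epsilon> * \<epsilon>) * (s * s)" by (simp add: power2_eq_square mult_ac)
    then show ?thesis using s \<epsilon>2 by simp
  qed
  have rect: "(norm (of_real a + \<i> * of_real b :: complex))\<^sup>2 = a\<^sup>2 + b\<^sup>2" for a b by (simp add: cmod_power2)
  have "(norm (apex \<epsilon> p q D))\<^sup>2 = r * (A\<^sup>2 + (\<epsilon> * s)\<^sup>2)"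
    by (simp only: apex norm_mult power_mult_distrib[of "norm D"] nD rect)
  also have "\<dots> = 1" using r unfolding \<epsilon>s by (simp add: power2_eq_square)
  finally show "norm (apex \<epsilon> p q D) = 1"
    using power2_eq_imp_eq[of "norm (apex \<epsilon> p q D)" 1] by simp
  have "D - of_real p * apex \<epsilon> p q D = D * (of_real (1 - p * A) + \<i> * of_real (- p * (\<epsilon> * s)))"
    by (simp add: apex algebra_simps)
  then have "(norm (D - of_real p * apex \<epsilon> p q D))\<^sup>2 =
      r * (norm (of_real (1 - p * A) + \<i> * of_real (- p * (\<epsilon> * s)) :: complex))\<^sup>2"
    by (simp only: norm_mult power_mult_distrib nD)
  also have "\<dots> = r * ((1 - p * A)\<^sup>2 + (- p * (\<epsilon> * s))\<^sup>2)" by (simp only: rect)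
  also have "(- p * (\<epsilon> * s))\<^sup>2 = p\<^sup>2 * (\<epsilon> * s)\<^sup>2"
    by (simp only: power_mult_distrib[of "- p"] power2_minus)
  also have "r * ((1 - p * A)\<^sup>2 + p\<^sup>2 * (\<epsilon> * s)\<^sup>2) = r - 2 * p * (A * r) + p\<^sup>2 * (r * inverse r)"
    unfolding \<epsilon>s by (simp add: power2_eq_square algebra_simps)
  also have "A * r = (r + (p * p - q * q)) / (2 * p)" using r p by (simp add: A_def field_simps)
  finally have "(norm (D - of_real p * apex \<epsilon> p q D))\<^sup>2 = q\<^sup>2"
    using r p by (simp add: power2_eq_square)
  then show "norm (D - of_real p * apex \<epsilon> p q D) = q" using q by (simp add: power2_eq_iff_nonneg)
qed

lemma apex_props:
  assumes p: "p > 0" and q: "q > 0" and tri: "triangle_condition p q D" and \<epsilon>: "\<epsilon> = 1 \<or> \<epsilon> = -1"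
  shows "norm (apex \<epsilon> p q D) = 1" "norm (D - of_real p * apex \<epsilon> p q D) = q"
    "\<epsilon> * Im (cnj D * apex \<epsilon> p q D) > 0"
proof -
  define r where "r = Re D * Re D + Im D * Im D"
  define A where "A = (r + (p * p - q * q)) * inverse (2 * p * r)"
  define s where "s = sqrt (inverse r - A * A)"
  have r: "r > 0" and disc: "inverse r - A * A > 0"
    using triangle_condition_pos[OF p tri] by (simp_all add: r_def A_def power2_eq_square)
  have "D \<noteq> 0" using r by (auto simp: r_def)
  then show "norm (apex \<epsilon> p q D) = 1" "norm (D - of_real p * apex \<epsilon> p q D) = q"
    using apex_norms[OF p q _ \<epsilon>, of D] disc by (simp_all add: Let_def r_def A_def)
  have s: "s > 0" using disc by (simp add: s_def)
  have \<epsilon>2: "\<epsilon> * \<epsilon> = 1" using \<epsilon> by auto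
  have nD: "(norm D)\<^sup>2 = r" using cmod_power2[of D] by (simp add: r_def power2_eq_square)
  have apex: "apex \<epsilon> p q D = D * (of_real A + \<i> * of_real (\<epsilon> * s))"
    by (simp add: apex_def Let_def r_def A_def s_def)
  have "cnj D * apex \<epsilon> p q D = of_real r * (of_real A + \<i> * of_real (\<epsilon> * s))"
    using complex_norm_square[of D] nD by (simp add: apex mult.assoc[symmetric] mult.commute[of "cnj D"])
  then have "\<epsilon> * Im (cnj D * apex \<epsilon> p q D) = (\<epsilon> * \<epsilon>) * (r * s)" by simp
  then show "\<epsilon> * Im (cnj D * apex \<epsilon> p q D) > 0" using \<epsilon>2 r s by simp
qed

text \<open>
  Writing \<open>u\<close> for the product of \<open>w\<close> with the conjugate of \<open>D\<close>, the second side length determines the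
  real part of \<open>u\<close>, hence the absolute value of its imaginary part, whose sign is \<open>\<epsilon>\<close>.
\<close>

lemma apex_unique:
  assumes p: "p > 0" and \<epsilon>: "\<epsilon> = 1 \<or> \<epsilon> = -1"
    and w: "norm w = 1" "norm (D - of_real p * w) = q" "\<epsilon> * Im (cnj D * w) > 0"
  shows "triangle_condition p q D" "apex \<epsilon> p q D = w"
proof -
  define r where "r = Re D * Re D + Im D * Im D"
  define A where "A = (r + (p * p - q * q)) * inverse (2 * p * r)"
  have nD: "(norm D)\<^sup>2 = r" using cmod_power2[of D] by (simp add: r_def power2_eq_square)
  have "D \<noteq> 0" using w(3) by auto
  then have r: "r > 0" using nD by (metis zero_less_norm_iff zero_less_power)
  define u where "u = cnj D * w"
  have Du: "D * u = of_real r * w"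
    using complex_norm_square[of D] nD by (simp add: u_def mult.assoc[symmetric])
  have "(norm u)\<^sup>2 = r" using w(1) nD by (simp add: u_def norm_mult power_mult_distrib)
  then have u2: "(Re u)\<^sup>2 + (Im u)\<^sup>2 = r" by (simp add: cmod_power2)
  have "q\<^sup>2 = (norm (D - of_real p * w))\<^sup>2" using w(2) by simp
  also have "\<dots> = (Re D - p * Re w)\<^sup>2 + (Im D - p * Im w)\<^sup>2" by (simp add: cmod_power2)
  also have "\<dots> = r - 2 * p * Re u + p\<^sup>2 * ((Re w)\<^sup>2 + (Im w)\<^sup>2)"
    by (simp add: u_def r_def power2_eq_square algebra_simps)
  also have "(Re w)\<^sup>2 + (Im w)\<^sup>2 = (norm w)\<^sup>2" by (simp add: cmod_power2)
  finally have Reu: "2 * p * Re u = r + (p * p - q * q)" using w(1) by (simp add: power2_eq_square)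
  have "(Im u)\<^sup>2 > 0" using w(3) by (auto simp: u_def)
  then have "(Re u)\<^sup>2 < r" using u2 by linarith
  then have "4 * p\<^sup>2 * (Re u)\<^sup>2 < 4 * p\<^sup>2 * r" using p by simp
  then have "(2 * p * Re u)\<^sup>2 < 4 * p\<^sup>2 * r" by (simp add: power_mult_distrib)
  then show "triangle_condition p q D"
    unfolding Reu by (simp add: triangle_condition_def r_def Let_def)
  have A: "A = Re u / r" unfolding A_def Reu[symmetric] using p r by (simp add: field_simps)
  have "inverse r - A * A = (r - (Re u)\<^sup>2) / r\<^sup>2"
    using r by (simp add: A power2_eq_square field_simps)
  also have "r - (Re u)\<^sup>2 = (Im u)\<^sup>2" using u2 by simp
  finally have "sqrt (inverse r - A * A) = \<bar>Im u\<bar> / r" using r by (simp add: real_sqrt_divide)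
  moreover have "\<epsilon> * \<bar>Im u\<bar> = Im u" using \<epsilon> w(3) by (auto simp: u_def)
  ultimately have "\<epsilon> * sqrt (inverse r - A * A) = Im u / r" by (metis times_divide_eq_right)
  then have "apex \<epsilon> p q D = D * (of_real (Re u / r) + \<i> * of_real (Im u / r))"
    unfolding apex_def Let_def r_def[symmetric] A_def[symmetric] by (simp only: A[symmetric])
  also have "\<dots> = D * u / of_real r" by (simp add: complex_eq_iff Re_divide_of_real Im_divide_of_real diff_divide_distrib add_divide_distrib)
  also have "\<dots> = w" using Du r by simp
  finally show "apex \<epsilon> p q D = w" .
qed

lemma smooth_apex:
  assumes P: "openin (Euclidean_space d) P" and D: "smooth d P D" and p: "p > 0"
    and tri: "\<And>x. x \<in> P \<Longrightarrow> triangle_condition p q (D x)"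
  shows "smooth d P (\<lambda>x. apex \<epsilon> p q (D x))"
proof -
  define r where "r x = Re (D x) * Re (D x) + Im (D x) * Im (D x)" for x
  define A where "A x = (r x + (p * p - q * q)) * inverse (2 * p * r x)" for x
  have r: "smooth d P r" unfolding r_def[abs_def]
    by (intro smooth_add smooth_mult smooth_linear[OF bounded_linear_Re] smooth_linear[OF bounded_linear_Im] D P)
  have rp: "r x > 0" if "x \<in> P" for x
    unfolding r_def by (rule triangle_condition_pos(1)[OF p tri[OF that]])
  have disc: "inverse (r x) - A x * A x > 0" if "x \<in> P" for x
    using triangle_condition_pos(2)[OF p tri[OF that]] by (simp only: power2_eq_square A_def r_def)
  have "2 * p * r x \<noteq> 0" "r x \<noteq> 0" if "x \<in> P" for x using rp[OF that] p by simp_all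
  then have A: "smooth d P A" and ir: "smooth d P (\<lambda>x. inverse (r x))"
    unfolding A_def[abs_def] by (intro smooth_mult smooth_add smooth_inverse smooth_const r P; simp)+
  have "smooth d P (\<lambda>x. sqrt (inverse (r x) - A x * A x))"
    by (intro smooth_sqrt disc smooth_diff smooth_mult ir A P)
  then have "smooth d P (\<lambda>x. D x * (of_real (A x) + \<i> * of_real (\<epsilon> * sqrt (inverse (r x) - A x * A x))))"
    by (intro smooth_mult[OF P] smooth_add[OF P] smooth_const[OF P] D smooth_linear[OF bounded_linear_of_real P] A)
  then show ?thesis by (simp only: apex_def Let_def A_def r_def)
qed

section \<open>The polygon space as a framed submanifold\<close>

lemma Im_affine:
  "Im (of_real c * (w - of_real b * 1)) = c * Im w" "Im (of_real b * 1 + of_real c * w) = c * Im w"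
  by simp_all

locale polygons =
  fixes n :: nat and l :: "nat \<Rightarrow> real"
  assumes n3: "n \<ge> 3" and lengths: "length_vector n l" and gen: "generic n l"
begin

abbreviation "M \<equiv> polygon_set n l"

lemma length_pos: "j \<in> {1..n} \<Longrightarrow> l j > 0"
  using lengths by (simp add: length_vector_def)

lemma polygon_in_torus: "M \<subseteq> torus_set (n - 1)"
  by (auto simp: polygon_set_def)

lemma polygon_norm: "z \<in> M \<Longrightarrow> j \<in> {1..n-1} \<Longrightarrow> norm (z j) = 1"
  using torus_setD(1) polygon_in_torus by blast

lemma polygon_outside: "z \<in> M \<Longrightarrow> j \<notin> {1..n-1} \<Longrightarrow> z j = undefined"
  using torus_setD(2) polygon_in_torus by blast

lemma polygon_sum: "z \<in> M \<Longrightarrow> (\<Sum>j=1..n-1. of_real (l j) * z j) = of_real (l n)"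
  by (simp add: polygon_set_def)

lemma polygon_sum_Re: "z \<in> M \<Longrightarrow> (\<Sum>j=1..n-1. l j * Re (z j)) = l n"
  using arg_cong[OF polygon_sum, of z Re] by (simp add: Re_sum)

lemma polygon_sum_Im: "z \<in> M \<Longrightarrow> (\<Sum>j=1..n-1. l j * Im (z j)) = 0"
  using arg_cong[OF polygon_sum, of z Im] by (simp add: Im_sum)

text \<open>A polygon all of whose edges are parallel would split the lengths into two equal halves.\<close>

lemma polygon_nonreal:
  assumes z: "z \<in> M"
  shows "\<exists>j\<in>{1..n-1}. Im (z j) \<noteq> 0"
proof (rule ccontr)
  assume "\<not> ?thesis"
  then have re: "Re (z j) = 1 \<or> Re (z j) = -1" if "j \<in> {1..n-1}" for j
    using polygon_norm[OF z that] that cmod_power2[of "z j"] by (simp add: power2_eq_1_iff)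
  let ?S = "{j \<in> {1..n-1}. Re (z j) = 1}"
  have S: "?S \<subseteq> {1..n}" by auto
  have "{1..n} = insert n {1..n-1}" using n3 by auto
  then have co: "{1..n} - ?S = insert n ({1..n-1} - ?S)" using n3 by auto
  have "(\<Sum>j\<in>{1..n} - ?S. l j) = l n + (\<Sum>j\<in>{1..n-1} - ?S. l j)"
    unfolding co using n3 by (subst sum.insert) auto
  also have "l n = (\<Sum>j\<in>{1..n-1}. l j * Re (z j))" using polygon_sum_Re[OF z] by simp
  also have "\<dots> = (\<Sum>j\<in>{1..n-1} - ?S. l j * Re (z j)) + (\<Sum>j\<in>?S. l j * Re (z j))"
    by (rule sum.subset_diff) auto
  also have "(\<Sum>j\<in>?S. l j * Re (z j)) = (\<Sum>j\<in>?S. l j)" by (intro sum.cong) auto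
  also have "(\<Sum>j\<in>{1..n-1} - ?S. l j * Re (z j)) = (\<Sum>j\<in>{1..n-1} - ?S. - l j)"
    using re by (intro sum.cong refl) force
  finally have "(\<Sum>j\<in>?S. l j) = (\<Sum>j\<in>{1..n} - ?S. l j)" by (simp add: sum_negf)
  then show False using gen S unfolding generic_def by blast
qed

lemma polygon_independent_edges:
  assumes z: "z \<in> M"
  shows "\<exists>j\<in>{1..n-1}. \<exists>k\<in>{1..n-1}. Im (cnj (z k) * z j) \<noteq> 0"
proof (rule ccontr)
  assume "\<not> ?thesis"
  then have 0: "Im (cnj (z k) * z j) = 0" if "j \<in> {1..n-1}" "k \<in> {1..n-1}" for j k using that by blast
  obtain k where k: "k \<in> {1..n-1}" "Im (z k) \<noteq> 0" using polygon_nonreal[OF z] by blast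
  have "cnj (z k) * of_real (l n) = (\<Sum>j=1..n-1. cnj (z k) * (of_real (l j) * z j))"
    unfolding polygon_sum[OF z, symmetric] by (rule sum_distrib_left)
  then have "Im (cnj (z k) * of_real (l n)) = (\<Sum>j=1..n-1. Im (cnj (z k) * (of_real (l j) * z j)))"
    by (simp only: Im_sum)
  also have "\<dots> = (\<Sum>j=1..n-1. l j * Im (cnj (z k) * z j))" by (intro sum.cong) (auto simp: algebra_simps)
  also have "\<dots> = 0" using 0 k(1) by (intro sum.neutral) auto
  finally show False using k(2) length_pos[of n] n3 by simp
qed

text \<open>
  Two edges that are not parallel are determined, up to the side they turn to, by the other edges.
\<close>

lemma polygon_graph: "locally_linear_graph (n - 3) M"
  unfolding locally_linear_graph_def
proof
  fix z assume z: "z \<in> M"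
  define d where "d = n - 3"
  obtain j k where j: "j \<in> {1..n-1}" and k: "k \<in> {1..n-1}" and jk: "Im (cnj (z k) * z j) \<noteq> 0"
    using polygon_independent_edges[OF z] by blast
  have neq: "j \<noteq> k" using jk by auto
  define \<epsilon> where "\<epsilon> = sgn (Im (cnj (z k) * z j))"
  have \<epsilon>: "\<epsilon> = 1 \<or> \<epsilon> = -1" and \<epsilon>z: "\<epsilon> * Im (cnj (z k) * z j) > 0" using jk by (auto simp: \<epsilon>_def sgn_if)
  have lj: "l j > 0" and lk: "l k > 0" using j k length_pos by auto
  define R where "R = {1..n-1} - {j, k}"
  have "card R = d" using j k neq n3 by (simp add: R_def d_def card_Diff_subset)
  then obtain e where e: "bij_betw e {0..<d} R"
    using ex_bij_betw_nat_finite[of R] by (auto simp: R_def)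
  define e' where "e' = the_inv_into {0..<d} e"
  have e'R: "e' i < d" "e (e' i) = i" if "i \<in> R" for i
    using bij_betw_apply[OF bij_betw_the_inv_into[OF e] that] f_the_inv_into_f_bij_betw[OF e] that
    by (auto simp: e'_def)
  have eR: "e i \<in> R" "e' (e i) = i" if "i < d" for i
    using that e by (auto simp: e'_def bij_betw_def the_inv_into_f_f)
  have zR: "norm (z i) = 1" if "i \<in> R" for i using that polygon_norm[OF z] by (auto simp: R_def)
  define a where "a = (\<lambda>i. - \<i> * cnj (z (e i)))"
  have coord: "lin_coord d a e w i = (if i < d then Im (cnj (z (e i)) * w (e i)) else 0)" for w i
    by (simp add: lin_coord_def a_def)
  define D where "D t = of_real (l n) - (\<Sum>i\<in>R. of_real (l i) * arc_point (z i) (t (e' i)))" for t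
  define ap where "ap t = apex \<epsilon> (l j) (l k) (D t)" for t
  define \<Psi> where "\<Psi> t = (\<lambda>i\<in>{1..n-1}. if i = j then ap t
     else if i = k then of_real (inverse (l k)) * (D t - of_real (l j) * ap t) else arc_point (z i) (t (e' i)))" for t
  have \<Psi>_simps: "\<Psi> t j = ap t" "\<Psi> t k = of_real (inverse (l k)) * (D t - of_real (l j) * ap t)"
    "i \<in> R \<Longrightarrow> \<Psi> t i = arc_point (z i) (t (e' i))" for t i
    using j k neq by (auto simp: \<Psi>_def R_def)
  have split: "{1..n-1} = insert j (insert k R)" "j \<notin> insert k R" "k \<notin> R" "finite R"
    using j k neq by (auto simp: R_def)
  have smooth_arc: "smooth d (open_cube d) (\<lambda>t. arc_point (z i) (t (e' i)))" if "i \<in> R" for i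
    using e'R[OF that] by (intro smooth_arc_point openin_open_cube) (auto simp: open_cube_def)
  have smooth_D: "smooth d (open_cube d) D"
    unfolding D_def[abs_def]
    by (intro smooth_diff smooth_const smooth_sum smooth_mult smooth_arc openin_open_cube)
  define P where "P = {t \<in> open_cube d. D t \<in> {D. triangle_condition (l j) (l k) D}}"
  have "open {D. triangle_condition (l j) (l k) D}"
    unfolding triangle_condition_def Let_def by (intro open_Collect_less continuous_intros)
  then have P: "openin (Euclidean_space d) P"
    unfolding P_def
    by (intro openin_Euclidean_preimage[where S = UNIV] openin_open_cube smooth_continuous_on[OF smooth_D]) auto
  have Pc: "P \<subseteq> open_cube d" by (auto simp: P_def)
  define W where "W = M \<inter> {w. (\<forall>i\<in>R. Re (cnj (z i) * w i) > 0) \<and> \<epsilon> * Im (cnj (w k) * w j) > 0}"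
  have "open {w :: nat \<Rightarrow> complex. \<epsilon> * Im (cnj (w k) * w j) > 0}"
    by (intro open_Collect_less continuous_intros continuous_on_product_coordinates)
  then have "open ({w. \<forall>i\<in>R. Re (cnj (z i) * w i) > 0} \<inter> {w. \<epsilon> * Im (cnj (w k) * w j) > 0})"
    using split(4) by (intro open_Int open_Collect_coordinates_Re_pos)
  then have W: "openin (top_of_set M) W"
    unfolding W_def Collect_conj_eq by (rule openin_open_Int)
  have smooth_ap: "smooth d P ap"
    unfolding ap_def[abs_def]
    by (rule smooth_apex[OF P smooth_subset[OF smooth_D Pc] lj]) (simp add: P_def)
  have sum_split: "(\<Sum>i=1..n-1. of_real (l i) * w i) =
      of_real (l j) * w j + (of_real (l k) * w k + (\<Sum>i\<in>R. of_real (l i) * w i))" for w :: "nat \<Rightarrow> complex"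
    using split by simp
  have "(W, lin_coord d a e) \<in> charts (submanifold d M)"
  proof (rule lin_coord_chartI[where \<Psi> = \<Psi>, OF P _ W])
    show "smooth_map d P \<Psi>"
      unfolding smooth_map_def
    proof
      fix i
      consider "i = j" | "i = k" | "i \<in> R" | "i \<notin> {1..n-1}" using split by blast
      then show "smooth d P (\<lambda>t. \<Psi> t i)"
      proof cases
        case 1
        then show ?thesis using smooth_ap by (simp add: \<Psi>_simps)
      next
        case 2
        then show ?thesis unfolding 2 \<Psi>_simps
          by (intro smooth_mult[OF P] smooth_const[OF P] smooth_diff[OF P] smooth_subset[OF smooth_D Pc] smooth_ap)
      next
        case 3
        show ?thesis unfolding \<Psi>_simps(3)[OF 3] by (rule smooth_subset[OF smooth_arc[OF 3] Pc])
      next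
        case 4
        then show ?thesis unfolding \<Psi>_def by (simp only: restrict_apply if_False smooth_const[OF P])
      qed
    qed
    fix t assume t: "t \<in> P"
    then have tri: "triangle_condition (l j) (l k) (D t)" by (simp add: P_def)
    have t1: "\<bar>t i\<bar> < 1" if "i < d" for i using t that by (auto simp: P_def open_cube_def)
    note ap = apex_props[OF lj lk tri \<epsilon>, folded ap_def]
    have "norm (\<Psi> t i) = 1" if "i \<in> {1..n-1}" for i
    proof -
      consider "i = j" | "i = k" | "i \<in> R" using split \<open>i \<in> {1..n-1}\<close> by blast
      then show ?thesis
      proof cases
        case 2
        then show ?thesis using ap(2) lk by (simp add: \<Psi>_simps norm_mult norm_inverse)
      next
        case 3
        then show ?thesis using norm_arc_point[OF zR[OF 3] t1[OF e'R(1)[OF 3]]] by (simp add: \<Psi>_simps)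
      qed (use ap(1) in \<open>simp add: \<Psi>_simps\<close>)
    qed
    then have "\<Psi> t \<in> torus_set (n - 1)" by (auto simp: torus_set_def PiE_iff \<Psi>_def)
    moreover have "(\<Sum>i=1..n-1. of_real (l i) * \<Psi> t i) = of_real (l n)"
    proof -
      have "(\<Sum>i\<in>R. of_real (l i) * \<Psi> t i) = of_real (l n) - D t"
        by (simp add: D_def \<Psi>_simps)
      moreover have "of_real (l k) * \<Psi> t k = D t - of_real (l j) * ap t"
        using lk by (simp add: \<Psi>_simps mult.assoc[symmetric] of_real_mult[symmetric] del: of_real_mult)
      ultimately show ?thesis unfolding sum_split \<Psi>_simps(1) by simp
    qed
    moreover have "Re (cnj (z i) * \<Psi> t i) > 0" if "i \<in> R" for i
      unfolding \<Psi>_simps(3)[OF that] cnj_mult_arc_point[OF zR[OF that]]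
      using abs_less_1_square[OF t1[OF e'R(1)[OF that]]] by simp
    moreover have "\<epsilon> * Im (cnj (\<Psi> t k) * \<Psi> t j) > 0"
    proof -
      have "cnj (\<Psi> t k) * \<Psi> t j = of_real (inverse (l k)) * (cnj (D t) * ap t - of_real (l j) * (cnj (ap t) * ap t))"
        by (simp add: \<Psi>_simps algebra_simps)
      also have "cnj (ap t) * ap t = 1" by (rule cnj_mult_unit[OF ap(1)])
      finally have "Im (cnj (\<Psi> t k) * \<Psi> t j) = inverse (l k) * Im (cnj (D t) * ap t)"
        by (simp only: Im_affine)
      then have "\<epsilon> * Im (cnj (\<Psi> t k) * \<Psi> t j) = inverse (l k) * (\<epsilon> * Im (cnj (D t) * ap t))"
        by (simp only: mult.left_commute)
      moreover have "inverse (l k) * (\<epsilon> * Im (cnj (D t) * ap t)) > 0" by (rule mult_pos_pos[OF positive_imp_inverse_positive[OF lk] ap(3)])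
      ultimately show ?thesis by (simp only:)
    qed
    ultimately show "\<Psi> t \<in> W" unfolding W_def polygon_set_def by blast
    show "lin_coord d a e (\<Psi> t) = t"
    proof
      fix i
      show "lin_coord d a e (\<Psi> t) i = t i"
      proof (cases "i < d")
        case True
        then have "lin_coord d a e (\<Psi> t) i = Im (cnj (z (e i)) * \<Psi> t (e i))" using coord by presburger
        also have "\<Psi> t (e i) = arc_point (z (e i)) (t i)" using eR[OF True] by (simp add: \<Psi>_simps)
        finally show ?thesis using cnj_mult_arc_point[OF zR[OF eR(1)[OF True]], of "t i"] by simp
      next
        case False
        then show ?thesis using t coord[of "\<Psi> t" i] by (simp add: P_def open_cube_def coord_space_iff)
      qed
    qed
  next
    fix w assume w: "w \<in> W"
    then have wM: "w \<in> M" and w1: "\<And>i. i \<in> R \<Longrightarrow> Re (cnj (z i) * w i) > 0"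
      and w2: "\<epsilon> * Im (cnj (w k) * w j) > 0" unfolding W_def by blast+
    let ?t = "lin_coord d a e w"
    have inv: "\<bar>Im (cnj (z i) * w i)\<bar> < 1" "arc_point (z i) (Im (cnj (z i) * w i)) = w i" if i: "i \<in> R" for i
      using arc_point_inverse[OF zR[OF i] _ w1[OF i]] polygon_norm[OF wM] i by (auto simp: R_def)
    have t_R: "?t (e' i) = Im (cnj (z i) * w i)" if "i \<in> R" for i
      using coord[of w "e' i"] e'R[OF that] by simp
    have arc: "arc_point (z i) (?t (e' i)) = w i" if "i \<in> R" for i
      unfolding t_R[OF that] by (rule inv(2)[OF that])
    have cube: "?t \<in> open_cube d"
      unfolding open_cube_def
    proof (intro CollectI conjI allI impI lin_coord_in_space)
      fix i assume "i < d"
      then show "\<bar>?t i\<bar> < 1" using inv(1)[OF eR(1), of i] coord[of w i] by simp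
    qed
    have "D ?t = of_real (l n) - (\<Sum>i\<in>R. of_real (l i) * w i)"
      unfolding D_def by (intro arg_cong2[where f = "(-)"] sum.cong refl) (simp add: arc)
    then have D: "D ?t = of_real (l j) * w j + of_real (l k) * w k"
      using polygon_sum[OF wM] sum_split[of w] by simp
    have "norm (w j) = 1" "norm (D ?t - of_real (l j) * w j) = l k"
      using polygon_norm[OF wM] j k lk by (simp_all add: D norm_mult)
    moreover have "\<epsilon> * Im (cnj (D ?t) * w j) > 0"
    proof -
      have "cnj (D ?t) * w j = of_real (l j) * (cnj (w j) * w j) + of_real (l k) * (cnj (w k) * w j)"
        by (simp add: D algebra_simps)
      also have "cnj (w j) * w j = 1" by (rule cnj_mult_unit) (use polygon_norm[OF wM j] in simp)
      finally have "Im (cnj (D ?t) * w j) = l k * Im (cnj (w k) * w j)" by (simp only: Im_affine)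
      then have "\<epsilon> * Im (cnj (D ?t) * w j) = l k * (\<epsilon> * Im (cnj (w k) * w j))"
        by (simp only: mult.left_commute)
      moreover have "l k * (\<epsilon> * Im (cnj (w k) * w j)) > 0" by (rule mult_pos_pos[OF lk w2])
      ultimately show ?thesis by (simp only:)
    qed
    ultimately have tri: "triangle_condition (l j) (l k) (D ?t)" and ap: "ap ?t = w j"
      unfolding ap_def by (rule apex_unique[OF lj \<epsilon>])+
    show "?t \<in> P" using cube tri by (simp add: P_def)
    show "\<Psi> ?t = w"
    proof
      fix i
      consider "i = j" | "i = k" | "i \<in> R" | "i \<notin> {1..n-1}" using split by blast
      then show "\<Psi> ?t i = w i"
      proof cases
        case 2
        have "of_real (inverse (l k)) * (of_real (l k) * w k) = w k"
          using lk by (simp add: mult.assoc[symmetric] of_real_mult[symmetric] del: of_real_mult)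
        then show ?thesis unfolding 2 by (simp add: \<Psi>_simps D ap)
      next
        case 4
        then show ?thesis using polygon_outside[OF wM 4] unfolding \<Psi>_def by (simp only: restrict_apply if_False)
      qed (simp_all add: \<Psi>_simps ap arc)
    qed
  qed
  moreover have "Re (cnj (z i) * z i) > 0" if "i \<in> R" for i unfolding cnj_mult_unit[OF zR[OF that]] by simp
  then have "z \<in> W" using z \<epsilon>z unfolding W_def by blast
  ultimately show "\<exists>W a \<kappa>. z \<in> W \<and> (W, lin_coord (n - 3) a \<kappa>) \<in> charts (submanifold (n - 3) M)"
    unfolding d_def by blast
qed

end

text \<open>
  The gradients of the real and of the imaginary part of the closing condition, with respect to
  the edge directions: a frame of the normal bundle of the polygon space in the torus.
\<close>

definition polygon_frame :: "(nat \<Rightarrow> real) \<Rightarrow> nat \<Rightarrow> (nat \<Rightarrow> complex) \<Rightarrow> nat \<Rightarrow> real" where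
  "polygon_frame l r z j = (if r = 0 then - (l j * Im (z j)) else l j * Re (z j))"

context polygons
begin

text \<open>
  The closing condition is constant on the polygon space; differentiate it.
\<close>

lemma polygon_frame_orthogonal:
  assumes P: "openin (Euclidean_space e) P" and \<xi>: "smooth_map e P \<xi>" and "\<And>y. y \<in> P \<Longrightarrow> \<xi> y \<in> M"
    and x: "x \<in> P" and i: "i < e"
  shows "(\<Sum>j=1..n-1. angular_velocity \<xi> i j x * polygon_frame l r (\<xi> x) j) = 0"
proof -
  let ?D = "\<lambda>j. partial_derivative i (\<lambda>y. \<xi> y j) x"
  have "has_partial (\<lambda>y. \<Sum>j=1..n-1. of_real (l j) * \<xi> y j) i x (\<Sum>j=1..n-1. of_real (l j) * ?D j)"
    by (intro has_vector_derivative_sum bounded_linear.has_vector_derivative[OF bounded_linear_mult_right]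
        smooth_has_partial[OF smooth_mapD[OF \<xi>] x i])
  then have "(\<Sum>j=1..n-1. of_real (l j) * ?D j) = partial_derivative i (\<lambda>y. \<Sum>j=1..n-1. of_real (l j) * \<xi> y j) x"
    by (rule partial_derivative_eqI[symmetric])
  also have "\<dots> = 0"
    by (rule partial_derivative_const_coordinate[OF P _ x i]) (rule polygon_sum[OF assms(3)])
  finally have "(\<Sum>j=1..n-1. of_real (l j) * ?D j) = 0" .
  moreover have "?D j = \<i> * \<xi> x j * of_real (angular_velocity \<xi> i j x)" if "j \<in> {1..n-1}" for j
    by (rule partial_derivative_torus(1)[OF P \<xi> _ x i that]) (use assms(3) polygon_in_torus in blast)
  ultimately have "(\<Sum>j=1..n-1. of_real (l j) * (\<i> * \<xi> x j * of_real (angular_velocity \<xi> i j x))) = 0"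
    by simp
  then have "(\<Sum>j=1..n-1. Re (of_real (l j) * (\<i> * \<xi> x j * of_real (angular_velocity \<xi> i j x)))) = 0"
    "(\<Sum>j=1..n-1. Im (of_real (l j) * (\<i> * \<xi> x j * of_real (angular_velocity \<xi> i j x)))) = 0"
    by (simp_all only: Re_sum[symmetric] Im_sum[symmetric] zero_complex.sel)
  then show ?thesis by (cases "r = 0") (simp_all add: polygon_frame_def sum_negf mult_ac)
qed

text \<open>
  A vanishing combination of the rows has a normal part that is also tangential, hence is zero. Were
  its coefficients not zero, all edges would be parallel. So only tangential rows are left, and these
  are independent because the parametrization is an immersion.
\<close>

sublocale framed_submanifold "n - 3" "n - 1" M "polygon_frame l"
proof
  show "n - 3 \<le> n - 1" by simp
  show "M \<subseteq> torus_set (n - 1)" by (rule polygon_in_torus)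
  show "locally_linear_graph (n - 3) M" by (rule polygon_graph)
  show "continuous_on M (\<lambda>z. polygon_frame l r z j)" for r j
    unfolding polygon_frame_def
    by (cases "r = 0") (auto intro!: continuous_intros continuous_on_subset[OF continuous_on_product_coordinates])
  fix U \<phi> x assume c: "(U, \<phi>) \<in> charts (submanifold (n - 3) M)" and x: "x \<in> \<phi> ` U"
  define d where "d = n - 3"
  let ?\<xi> = "inv_into U \<phi>"
  have \<phi>: "is_chart d (top_of_set M) (U, \<phi>)" and im: "immersion d (\<phi> ` U) ?\<xi>"
    using c by (simp_all add: submanifold_charts_iff d_def)
  have UM: "?\<xi> y \<in> M" if "y \<in> \<phi> ` U" for y
    using that chart_image_subset[OF \<phi>] inv_into_into[OF that] by blast
  note P = is_chart_image_open[OF \<phi>] and sm = submanifold_inverse_smooth[OF c, folded d_def]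
  define z where "z = ?\<xi> x"
  have z: "z \<in> M" unfolding z_def by (rule UM[OF x])
  let ?a = "\<lambda>i j. angular_velocity ?\<xi> i j x"
  show "orientation_form (n - 3) (n - 1) (polygon_frame l) ?\<xi> x \<noteq> 0"
  proof
    assume "orientation_form (n - 3) (n - 1) (polygon_frame l) ?\<xi> x = 0"
    then obtain v where v: "\<exists>i<n-1. v i \<noteq> 0"
      "\<forall>k<n-1. (\<Sum>i<n-1. v i * (if i < d then ?a i (Suc k) else polygon_frame l (i - d) z (Suc k))) = 0"
      unfolding orientation_form_def d_def z_def using det_zero_left_null_vector by blast
    have nd: "n - 1 = Suc (Suc d)" using n3 by (simp add: d_def)
    define b where "b j = v d * polygon_frame l 0 z j + v (Suc d) * polygon_frame l 1 z j" for j
    have va: "(\<Sum>i<d. v i * ?a i j) = - b j" if j: "j \<in> {1..n-1}" for j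
    proof -
      have j': "j - 1 < n - 1" "Suc (j - 1) = j" using j by auto
      have "(\<Sum>i<n-1. v i * (if i < d then ?a i j else polygon_frame l (i - d) z j)) = 0"
        using v(2)[rule_format, OF j'(1)] unfolding j'(2) .
      moreover have "(\<Sum>i<n-1. v i * (if i < d then ?a i j else polygon_frame l (i - d) z j)) =
          (\<Sum>i<d. v i * ?a i j) + b j"
        unfolding nd by (simp add: b_def)
      ultimately show ?thesis by simp
    qed
    have ab: "(\<Sum>j=1..n-1. ?a i j * b j) = 0" if i: "i < d" for i
    proof -
      have "(\<Sum>j=1..n-1. ?a i j * polygon_frame l r z j) = 0" for r
        unfolding z_def by (rule polygon_frame_orthogonal[OF P sm UM x i])
      moreover have "(\<Sum>j=1..n-1. ?a i j * b j) = v d * (\<Sum>j=1..n-1. ?a i j * polygon_frame l 0 z j)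
          + v (Suc d) * (\<Sum>j=1..n-1. ?a i j * polygon_frame l 1 z j)"
        by (simp add: b_def sum_distrib_left sum.distrib[symmetric] algebra_simps)
      ultimately show ?thesis by simp
    qed
    have "(\<Sum>j=1..n-1. b j * b j) = - (\<Sum>j=1..n-1. (\<Sum>i<d. v i * ?a i j) * b j)"
      by (simp add: va sum_negf)
    also have "(\<Sum>j=1..n-1. (\<Sum>i<d. v i * ?a i j) * b j) = (\<Sum>i<d. v i * (\<Sum>j=1..n-1. ?a i j * b j))"
      unfolding sum_distrib_right sum_distrib_left by (subst sum.swap) (simp add: mult_ac)
    also have "\<dots> = 0" by (intro sum.neutral ballI) (use ab in simp)
    finally have "(\<Sum>j=1..n-1. b j * b j) = 0" by simp
    then have b0: "b j = 0" if "j \<in> {1..n-1}" for j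
      using that sum_nonneg_eq_0_iff[of "{1..n-1}" "\<lambda>j. b j * b j"] by auto
    have par: "v (Suc d) * Re (z j) = v d * Im (z j)" if j: "j \<in> {1..n-1}" for j
    proof -
      have "l j * (v (Suc d) * Re (z j) - v d * Im (z j)) = 0"
        using b0[OF j] by (simp add: b_def polygon_frame_def algebra_simps)
      moreover have "j \<in> {1..n}" using j by auto
      ultimately show ?thesis using length_pos[of j] by auto
    qed
    have "v (Suc d) * l n = (\<Sum>j=1..n-1. l j * (v (Suc d) * Re (z j)))"
      unfolding polygon_sum_Re[OF z, symmetric] sum_distrib_left by (simp add: mult_ac)
    also have "\<dots> = (\<Sum>j=1..n-1. l j * (v d * Im (z j)))" using par by (intro sum.cong) auto
    also have "\<dots> = v d * (\<Sum>j=1..n-1. l j * Im (z j))" unfolding sum_distrib_left by (simp add: mult_ac)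
    also have "\<dots> = 0" by (simp only: polygon_sum_Im[OF z] mult_zero_right)
    finally have v1: "v (Suc d) = 0" using length_pos[of n] n3 by simp
    obtain j where "j \<in> {1..n-1}" "Im (z j) \<noteq> 0" using polygon_nonreal[OF z] by blast
    then have v0: "v d = 0" using par[of j] v1 by simp
    have "(\<Sum>i<d. v i *\<^sub>R partial_derivative i (\<lambda>y. ?\<xi> y j) x) = 0" for j
    proof (cases "j \<in> {1..n-1}")
      case True
      have "partial_derivative i (\<lambda>y. ?\<xi> y j) x = \<i> * ?\<xi> x j * of_real (?a i j)" if "i < d" for i
        by (rule partial_derivative_torus(1)[OF P sm _ x that True]) (use UM polygon_in_torus in blast)
      then have "(\<Sum>i<d. v i *\<^sub>R partial_derivative i (\<lambda>y. ?\<xi> y j) x) =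
          (\<Sum>i<d. \<i> * ?\<xi> x j * of_real (v i * ?a i j))"
        by (intro sum.cong) (auto simp: scaleR_conv_of_real)
      also have "\<dots> = \<i> * ?\<xi> x j * of_real (\<Sum>i<d. v i * ?a i j)"
        by (simp only: sum_distrib_left of_real_sum)
      also have "(\<Sum>i<d. v i * ?a i j) = 0" using va[OF True] b0[OF True] by simp
      finally show ?thesis by simp
    next
      case False
      have "partial_derivative i (\<lambda>y. ?\<xi> y j) x = 0" if "i < d" for i
        by (rule partial_derivative_torus(2)[OF P sm _ x that False]) (use UM polygon_in_torus in blast)
      then show ?thesis by simp
    qed
    then have "v i = 0" if "i < d" for i using immersionD[OF im x _ that, where v = v] by blast
    then show False using v(1) v0 v1 nd by (auto simp: less_Suc_eq)
  qed
qed

end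

section \<open>Jacobians of coordinate changes\<close>

lemma overlap_open:
  assumes "is_chart d X c" "is_chart d X c'"
  shows "openin (Euclidean_space d) (overlap c c')"
proof -
  obtain U \<phi> V \<psi> where eq: "c = (U, \<phi>)" "c' = (V, \<psi>)" by (cases c, cases c')
  have "openin X (U \<inter> V)"
    using is_chart_open assms unfolding eq by blast
  then show ?thesis using is_chart_open_image[of d X U \<phi> "U \<inter> V"] assms(1) by (simp add: eq overlap_def)
qed

lemma transition_chain:
  assumes "is_chart d X c" "is_chart d X c'" "x \<in> overlap c c'" "x \<in> overlap c c''"
  shows "transition c c' x \<in> overlap c' c''" "transition c' c'' (transition c c' x) = transition c c'' x"
proof -
  obtain U \<phi> V \<psi> W \<theta> where eq: "c = (U, \<phi>)" "c' = (V, \<psi>)" "c'' = (W, \<theta>)" by (cases c, cases c', cases c'')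
  have inj: "inj_on \<phi> U" "inj_on \<psi> V" using assms is_chart_inj unfolding eq by blast+
  obtain z where z: "z \<in> U" "z \<in> V" "x = \<phi> z" using assms(3) by (auto simp: eq overlap_def)
  obtain z' where z': "z' \<in> U" "z' \<in> W" "x = \<phi> z'" using assms(4) by (auto simp: eq overlap_def)
  have "z' = z" using inj_onD[OF inj(1), of z' z] z z' by simp
  then show "transition c c' x \<in> overlap c' c''" "transition c' c'' (transition c c' x) = transition c c'' x"
    using z z' inj by (auto simp: eq overlap_def transition_def)
qed

lemma transition_self:
  assumes "is_chart d X c" "x \<in> overlap c c"
  shows "transition c c x = x"
proof -
  obtain U \<phi> where eq: "c = (U, \<phi>)" by (cases c)
  have "inj_on \<phi> U" using assms(1) is_chart_inj unfolding eq by blast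
  then show ?thesis using assms(2) by (auto simp: eq overlap_def transition_def)
qed

lemma jacobian_det_local:
  assumes "openin (Euclidean_space d) P" "\<And>y. y \<in> P \<Longrightarrow> f y = g y" "x \<in> P"
  shows "jacobian_det d f x = jacobian_det d g x"
proof -
  have "partial_derivative j (\<lambda>y. f y i) x = partial_derivative j (\<lambda>y. g y i) x" if "j < d" for i j
    by (rule partial_derivative_cong[OF assms(1) _ assms(3) that]) (simp add: assms(2))
  then show ?thesis unfolding jacobian_det_def
    by (intro arg_cong[where f = Determinant.det] cong_mat) auto
qed

lemma jacobian_det_id: "jacobian_det d (\<lambda>x. x) x = 1"
proof -
  have "partial_derivative j (\<lambda>y. y i) x = (if i = j then 1 else 0)" for i j :: nat
    by (rule partial_derivative_eqI)
      (cases "i = j", auto intro: has_vector_derivative_const simp: has_vector_derivative_id)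
  then have "Matrix.mat d d (\<lambda>(i, j). partial_derivative j (\<lambda>y. y i) x) = 1\<^sub>m d"
    by (intro eq_matI) auto
  then show ?thesis by (simp add: jacobian_det_def)
qed

lemma jacobian_det_compose:
  assumes V: "openin (Euclidean_space d) V" and U: "openin (Euclidean_space d) U"
    and gV: "\<And>x. x \<in> U \<Longrightarrow> g x \<in> V" and f: "smooth_map d V f" and g: "smooth_map d U g" and x: "x \<in> U"
  shows "jacobian_det d (\<lambda>x. f (g x)) x = jacobian_det d f (g x) * jacobian_det d g x"
proof -
  let ?F = "Matrix.mat d d (\<lambda>(i, j). partial_derivative j (\<lambda>y. f y i) (g x))"
  let ?G = "Matrix.mat d d (\<lambda>(i, j). partial_derivative j (\<lambda>y. g y i) x)"
  have "Matrix.mat d d (\<lambda>(i, j). partial_derivative j (\<lambda>y. f (g y) i) x) = ?F * ?G"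
  proof (rule eq_matI)
    fix i j assume "i < dim_row (?F * ?G)" "j < dim_col (?F * ?G)"
    then have ij: "i < d" "j < d" by auto
    then show "Matrix.mat d d (\<lambda>(i, j). partial_derivative j (\<lambda>y. f (g y) i) x) $$ (i, j) = (?F * ?G) $$ (i, j)"
      using smooth_partial_compose[OF V U gV smooth_mapD[OF f] g x ij(2), of i]
      by (simp add: scalar_prod_def lessThan_atLeast0 mult.commute)
  qed auto
  then show ?thesis unfolding jacobian_det_def using det_mult[of ?F d ?G] by simp
qed

text \<open>
  The coordinate changes between three charts compose on the common part of their domains.
\<close>

lemma jacobian_det_transition_chain:
  assumes c: "is_chart d X c" "is_chart d X c'" "is_chart d X c''"
    and comp: "compatible d c c'" "compatible d c' c''"
    and x: "x \<in> overlap c c'" "x \<in> overlap c c''"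
  shows "jacobian_det d (transition c c'') x =
    jacobian_det d (transition c' c'') (transition c c' x) * jacobian_det d (transition c c') x"
proof -
  let ?P = "overlap c c' \<inter> overlap c c''"
  have P: "openin (Euclidean_space d) ?P" using overlap_open c by blast
  have "jacobian_det d (transition c c'') x = jacobian_det d (\<lambda>y. transition c' c'' (transition c c' y)) x"
    by (rule jacobian_det_local[OF P]) (use x transition_chain[OF c(1,2)] in auto)
  also have "\<dots> = jacobian_det d (transition c' c'') (transition c c' x) * jacobian_det d (transition c c') x"
  proof (rule jacobian_det_compose[OF overlap_open[OF c(2,3)] P])
    show "smooth_map d (overlap c' c'') (transition c' c'')" using comp by (simp add: compatible_def)
    have "smooth_map d (overlap c c') (transition c c')" using comp by (simp add: compatible_def)
    then show "smooth_map d ?P (transition c c')" by (rule smooth_map_subset) blast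
  qed (use x transition_chain[OF c(1,2)] in auto)
  finally show ?thesis .
qed

lemma jacobian_det_transition_nonzero:
  assumes c: "is_chart d X c" "is_chart d X c'" and comp: "compatible d c c'" and x: "x \<in> overlap c c'"
  shows "jacobian_det d (transition c c') x \<noteq> 0"
proof -
  have xx: "x \<in> overlap c c" using x by (cases c, cases c') (auto simp: overlap_def)
  have comp': "compatible d c' c" using comp by (simp add: compatible_def)
  have "jacobian_det d (transition c c) x = jacobian_det d (\<lambda>x. x) x"
    by (rule jacobian_det_local[OF overlap_open[OF c(1,1)] transition_self[OF c(1)] xx])
  then have "jacobian_det d (transition c' c) (transition c c' x) * jacobian_det d (transition c c') x = 1"
    using jacobian_det_transition_chain[OF c(1,2,1) comp comp' x xx] by (simp add: jacobian_det_id)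
  then show ?thesis by auto
qed

lemma continuous_on_jacobian_det:
  assumes P: "openin (Euclidean_space d) P" and f: "smooth_map d P f"
  shows "continuous_on P (jacobian_det d f)"
proof -
  have "tcd d 0 P (\<lambda>x. partial_derivative j (\<lambda>y. f y i) x)" if "j < d" for i j
    using smoothD[OF smooth_partial[OF smooth_mapD[OF f] that], where k = 0] .
  then have "tcd d 0 P (\<lambda>x. Determinant.det (Matrix.mat d d (\<lambda>(i, j). partial_derivative j (\<lambda>y. f y i) x)))"
    by (intro tcd_det[where A = "\<lambda>x i j. partial_derivative j (\<lambda>y. f y i) x", OF P])
  then show ?thesis unfolding times_continuously_differentiable.simps(1) jacobian_det_def[abs_def] .
qed

section \<open>Complex conjugation of polygons\<close>

context polygons
begin

abbreviation "cj \<equiv> conjugation n"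

lemma conjugation_apply: "j \<in> {1..n-1} \<Longrightarrow> cj z j = cnj (z j)" "j \<notin> {1..n-1} \<Longrightarrow> cj z j = undefined"
  unfolding conjugation_def by (simp_all only: restrict_apply if_True if_False)

lemma conjugation_invol:
  assumes "z \<in> M" shows "cj (cj z) = z"
proof
  fix j
  show "cj (cj z) j = z j"
  proof (cases "j \<in> {1..n-1}")
    case False
    then show ?thesis using polygon_outside[OF assms False] conjugation_apply(2)[OF False] by simp
  qed (simp only: conjugation_apply complex_cnj_cnj)
qed

lemma conjugation_polygon:
  assumes "z \<in> M" shows "cj z \<in> M"
proof -
  have "cj z \<in> torus_set (n - 1)"
    unfolding torus_set_def
  proof (rule PiE_I)
    show "cj z j \<in> sphere 0 1" if "j \<in> {1..n-1}" for j
      unfolding conjugation_apply(1)[OF that] using polygon_norm[OF assms that] by simp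
  qed (rule conjugation_apply(2))
  moreover have "(\<Sum>j=1..n-1. of_real (l j) * cj z j) = cnj (\<Sum>j=1..n-1. of_real (l j) * z j)"
    unfolding cnj_sum by (intro sum.cong refl) (simp only: conjugation_apply complex_cnj_mult complex_cnj_complex_of_real)
  then have "(\<Sum>j=1..n-1. of_real (l j) * cj z j) = of_real (l n)"
    by (simp only: polygon_sum[OF assms] complex_cnj_complex_of_real)
  ultimately show ?thesis by (simp only: polygon_set_def mem_Collect_eq conj_absorb simp_thms)
qed

lemma conjugation_image_iff:
  assumes "A \<subseteq> M" shows "z \<in> cj ` A \<longleftrightarrow> z \<in> M \<and> cj z \<in> A"
proof
  assume "z \<in> cj ` A"
  then obtain a where a: "a \<in> A" "z = cj a" by blast
  then have "a \<in> M" using assms by blast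
  then show "z \<in> M \<and> cj z \<in> A" using a conjugation_invol[of a] conjugation_polygon[of a] by simp
next
  assume z: "z \<in> M \<and> cj z \<in> A"
  then have "z = cj (cj z)" using conjugation_invol[of z] by simp
  then show "z \<in> cj ` A" using z by blast
qed

lemma continuous_on_conjugation: "continuous_on A cj"
proof (rule continuous_on_coordinatewise_then_product)
  fix j
  show "continuous_on A (\<lambda>z. cj z j)"
  proof (cases "j \<in> {1..n-1}")
    case True
    show ?thesis unfolding conjugation_apply(1)[OF True]
      by (intro continuous_intros continuous_on_subset[OF continuous_on_product_coordinates]) simp
  next
    case False
    show ?thesis unfolding conjugation_apply(2)[OF False] by simp
  qed
qed

lemma openin_conjugation_image:
  assumes "openin (top_of_set M) A"
  shows "openin (top_of_set M) (cj ` A)"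
proof -
  have AM: "A \<subseteq> M" using openin_subset[OF assms] by simp
  have "openin (top_of_set M) (M \<inter> cj -` A)"
    by (rule continuous_openin_preimage[OF continuous_on_conjugation _ assms]) (use conjugation_polygon in auto)
  moreover have "M \<inter> cj -` A = cj ` A" using conjugation_image_iff[OF AM] by blast
  ultimately show ?thesis by simp
qed

lemma smooth_map_conjugation:
  assumes P: "openin (Euclidean_space e) P" and h: "smooth_map e P h"
  shows "smooth_map e P (\<lambda>x. cj (h x))"
  unfolding smooth_map_def
proof
  fix j
  show "smooth e P (\<lambda>x. cj (h x) j)"
  proof (cases "j \<in> {1..n-1}")
    case True
    show ?thesis unfolding conjugation_apply(1)[OF True]
      by (rule smooth_linear[OF bounded_linear_cnj P smooth_mapD[OF h]])
  next
    case False
    show ?thesis unfolding conjugation_apply(2)[OF False] by (rule smooth_const[OF P])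
  qed
qed

lemma partial_derivative_conjugation:
  assumes \<xi>: "smooth_map d P \<xi>" and x: "x \<in> P" and i: "i < d" and j: "j \<in> {1..n-1}"
  shows "partial_derivative i (\<lambda>y. cj (\<xi> y) j) x = cnj (partial_derivative i (\<lambda>y. \<xi> y j) x)"
  unfolding conjugation_apply(1)[OF j]
  by (intro partial_derivative_eqI bounded_linear.has_vector_derivative[OF bounded_linear_cnj]
      smooth_has_partial[OF smooth_mapD[OF \<xi>] x i])

abbreviation "pcharts \<equiv> charts (submanifold (n - 3) M)"

text \<open>
  Conjugation reverses the \<open>n - 3\<close> tangential rows and the row of the real part of the closing
  condition, but not the row of the imaginary part; so it multiplies the form by \<open>(-1)\<^sup>n\<close>.
\<close>

lemma conjugate_chart:
  assumes c: "(U, \<phi>) \<in> pcharts"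
  shows "(cj ` U, \<phi> \<circ> cj) \<in> pcharts"
    and "x \<in> \<phi> ` U \<Longrightarrow> form (inv_into (cj ` U) (\<phi> \<circ> cj)) x = (-1) ^ n * form (inv_into U \<phi>) x"
    and "(\<phi> \<circ> cj) ` cj ` U = \<phi> ` U"
    and "x \<in> \<phi> ` U \<Longrightarrow> inv_into (cj ` U) (\<phi> \<circ> cj) x = cj (inv_into U \<phi> x)"
proof -
  note f = chart_facts[OF c]
  let ?\<xi> = "inv_into U \<phi>" and ?\<xi>' = "inv_into (cj ` U) (\<phi> \<circ> cj)"
  show im: "(\<phi> \<circ> cj) ` cj ` U = \<phi> ` U"
    using f(4) conjugation_invol by (force simp: image_image)
  have inj: "inj_on (\<phi> \<circ> cj) (cj ` U)"
  proof (rule inj_onI)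
    fix a b assume "a \<in> cj ` U" "b \<in> cj ` U" and e: "(\<phi> \<circ> cj) a = (\<phi> \<circ> cj) b"
    then have "a \<in> M" "b \<in> M" "cj a \<in> U" "cj b \<in> U" using conjugation_image_iff[OF f(4)] by blast+
    moreover have "cj a = cj b" using inj_onD[OF f(3), of "cj a" "cj b"] e calculation by simp
    ultimately show "a = b" using conjugation_invol by metis
  qed
  have inv: "?\<xi>' y = cj (?\<xi> y)" if y: "y \<in> \<phi> ` U" for y
  proof -
    obtain z where z: "z \<in> U" "y = \<phi> z" using y by blast
    have "(\<phi> \<circ> cj) (cj z) = y" using z f(4) conjugation_invol[of z] by auto
    then have "?\<xi>' y = cj z" using inv_into_f_f[OF inj imageI[OF z(1)]] by simp
    then show ?thesis using z f(3) by simp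
  qed
  then show "x \<in> \<phi> ` U \<Longrightarrow> ?\<xi>' x = cj (?\<xi> x)" .
  have \<xi>M: "?\<xi> y \<in> U" "?\<xi> y \<in> M" if "y \<in> \<phi> ` U" for y
    using inv_into_into[OF that] f(4) by blast+
  have chart: "is_chart (n - 3) (top_of_set M) (cj ` U, \<phi> \<circ> cj)"
  proof (rule is_chartI[where \<phi> = "\<phi> \<circ> cj" and \<psi> = ?\<xi>', OF openin_conjugation_image[OF f(7)] f(2)])
    show "(\<phi> \<circ> cj) z \<in> \<phi> ` U" if "z \<in> cj ` U" for z using that im by blast
    show "?\<xi>' t \<in> cj ` U" if "t \<in> \<phi> ` U" for t using inv[OF that] \<xi>M[OF that] by blast
    show "?\<xi>' ((\<phi> \<circ> cj) z) = z" if "z \<in> cj ` U" for z by (rule inv_into_f_f[OF inj that])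
    show "(\<phi> \<circ> cj) (?\<xi>' t) = t" if "t \<in> \<phi> ` U" for t
      using f_inv_into_f[of t "\<phi> \<circ> cj" "cj ` U"] that im by simp
  next
    fix B assume B: "openin (Euclidean_space (n - 3)) B"
    have "{z \<in> cj ` U. (\<phi> \<circ> cj) z \<in> B} = cj ` {z \<in> U. \<phi> z \<in> B}"
      using f(4) conjugation_invol by force
    then show "openin (top_of_set M) {z \<in> cj ` U. (\<phi> \<circ> cj) z \<in> B}"
      using openin_conjugation_image[OF is_chart_open_preimage[OF f(1) B]] by simp
  next
    fix A assume A: "openin (top_of_set M) A" "A \<subseteq> cj ` U"
    have AM: "A \<subseteq> M" using openin_subset[OF A(1)] by simp
    have "cj ` A \<subseteq> U" using A(2) f(4) conjugation_invol by force
    moreover have "{t \<in> \<phi> ` U. ?\<xi>' t \<in> A} = \<phi> ` (cj ` A)"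
    proof (intro equalityI subsetI)
      fix t assume "t \<in> {t \<in> \<phi> ` U. ?\<xi>' t \<in> A}"
      then have t: "t \<in> \<phi> ` U" "cj (?\<xi> t) \<in> A" using inv by auto
      then have "cj (cj (?\<xi> t)) = ?\<xi> t" using conjugation_invol \<xi>M by blast
      then have "?\<xi> t \<in> cj ` A" using t(2) by (metis imageI)
      then have "\<phi> (?\<xi> t) \<in> \<phi> ` (cj ` A)" by blast
      then show "t \<in> \<phi> ` (cj ` A)" by (simp only: f_inv_into_f[OF t(1)])
    next
      fix t assume "t \<in> \<phi> ` (cj ` A)"
      then obtain a where a: "a \<in> A" "t = \<phi> (cj a)" by blast
      have "cj a \<in> U" using a(1) \<open>cj ` A \<subseteq> U\<close> by blast
      then have t: "t \<in> \<phi> ` U" using a(2) by blast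
      have "?\<xi> t = cj a" using a(2) \<open>cj a \<in> U\<close> f(3) by simp
      then have "?\<xi>' t = a" using inv[OF t] conjugation_invol[of a] a(1) AM by auto
      then show "t \<in> {t \<in> \<phi> ` U. ?\<xi>' t \<in> A}" using t a(1) by simp
    qed
    ultimately show "openin (Euclidean_space (n - 3)) {t \<in> \<phi> ` U. ?\<xi>' t \<in> A}"
      using is_chart_open_image[OF f(1) openin_conjugation_image[OF A(1)]] by simp
  qed
  have sm0: "smooth_map (n - 3) (\<phi> ` U) (\<lambda>y. cj (?\<xi> y))" by (rule smooth_map_conjugation[OF f(2,5)])
  have sm: "smooth_map (n - 3) (\<phi> ` U) ?\<xi>'" by (rule smooth_map_cong[OF f(2) _ sm0]) (simp add: inv)
  have pd: "partial_derivative i (\<lambda>y. ?\<xi>' y j) x = cnj (partial_derivative i (\<lambda>y. ?\<xi> y j) x)"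
    if "x \<in> \<phi> ` U" "i < n - 3" "j \<in> {1..n-1}" for x i j
  proof -
    have "partial_derivative i (\<lambda>y. ?\<xi>' y j) x = partial_derivative i (\<lambda>y. cj (?\<xi> y) j) x"
      by (rule partial_derivative_cong[OF f(2) _ that(1,2)]) (simp add: inv)
    then show ?thesis using partial_derivative_conjugation[OF f(5) that] by simp
  qed
  have "immersion (n - 3) (\<phi> ` U) ?\<xi>'"
    unfolding immersion_def
  proof (intro conjI ballI allI impI sm)
    fix x and v :: "nat \<Rightarrow> real" and i
    assume x: "x \<in> \<phi> ` U" and i: "i < n - 3"
      and 0: "\<forall>j. (\<Sum>i<n-3. v i *\<^sub>R partial_derivative i (\<lambda>y. ?\<xi>' y j) x) = 0"
    have "(\<Sum>i<n-3. v i *\<^sub>R partial_derivative i (\<lambda>y. ?\<xi> y j) x) = 0" for j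
    proof (cases "j \<in> {1..n-1}")
      case True
      have "(\<Sum>i<n-3. v i *\<^sub>R partial_derivative i (\<lambda>y. ?\<xi>' y j) x) =
          (\<Sum>i<n-3. cnj (v i *\<^sub>R partial_derivative i (\<lambda>y. ?\<xi> y j) x))"
        by (intro sum.cong refl) (simp add: pd[OF x _ True] scaleR_conv_of_real)
      then have "cnj (\<Sum>i<n-3. v i *\<^sub>R partial_derivative i (\<lambda>y. ?\<xi> y j) x) = 0" using 0 by (simp add: cnj_sum)
      then show ?thesis by (simp only: complex_cnj_zero_iff)
    next
      case False
      have "partial_derivative i (\<lambda>y. ?\<xi> y j) x = 0" if "i < n - 3" for i
        by (rule partial_derivative_torus(2)[OF f(2,5) _ x that False]) (use \<xi>M polygon_in_torus in blast)
      then show ?thesis by simp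
    qed
    then show "v i = 0" using immersionD[OF f(6) x _ i, where v = v] by blast
  qed
  then show "(cj ` U, \<phi> \<circ> cj) \<in> pcharts" using chart im by (simp add: submanifold_charts_iff)
  assume x: "x \<in> \<phi> ` U"
  let ?s = "\<lambda>i. if i < n - 2 then -1 else 1 :: real"
  let ?A = "\<lambda>i j. if i < n - 3 then angular_velocity ?\<xi> i (Suc j) x else polygon_frame l (i - (n - 3)) (?\<xi> x) (Suc j)"
  have "(if i < n - 3 then angular_velocity ?\<xi>' i (Suc j) x else polygon_frame l (i - (n - 3)) (?\<xi>' x) (Suc j)) = ?s i * ?A i j"
    if ij: "i < n - 1" "j < n - 1" for i j
  proof -
    have j: "Suc j \<in> {1..n-1}" using ij by auto
    have cjx: "?\<xi>' x (Suc j) = cnj (?\<xi> x (Suc j))" unfolding inv[OF x] conjugation_apply(1)[OF j] ..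
    show ?thesis
    proof (cases "i < n - 3")
      case True
      then have "i < n - 2" by simp
      then show ?thesis using True pd[OF x True j] by (simp add: angular_velocity_def cjx)
    next
      case False
      have "i < n - 2 \<longleftrightarrow> i - (n - 3) = 0" using False n3 by auto
      then show ?thesis using False by (simp add: polygon_frame_def cjx)
    qed
  qed
  then have "Matrix.mat (n - 1) (n - 1) (\<lambda>(i, j). if i < n - 3 then angular_velocity ?\<xi>' i (Suc j) x
      else polygon_frame l (i - (n - 3)) (?\<xi>' x) (Suc j)) = Matrix.mat (n - 1) (n - 1) (\<lambda>(i, j). ?s i * ?A i j)"
    by (intro cong_mat) auto
  then have "form ?\<xi>' x = (\<Prod>i<n-1. ?s i) * form ?\<xi> x"
    unfolding orientation_form_def by (simp only: det_scale_rows)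
  also have "(\<Prod>i<n-1. ?s i) = (\<Prod>i<n-2. -1)"
    by (rule prod.mono_neutral_cong_right) auto
  also have "\<dots> = (-1) ^ n"
  proof -
    have "n = (n - 2) + 2" using n3 by simp
    then have "(-1 :: real) ^ n = (-1) ^ (n - 2) * (-1)\<^sup>2" by (metis power_add)
    then show ?thesis by simp
  qed
  finally show "form ?\<xi>' x = (-1) ^ n * form ?\<xi> x" .
qed

end

section \<open>The quotient by conjugation\<close>

definition push_chart :: "nat \<Rightarrow> (nat \<Rightarrow> complex) chart \<Rightarrow> (nat \<Rightarrow> complex) set chart" where
  "push_chart n c = (isometry_class n ` fst c, snd c \<circ> inv_into (fst c) (isometry_class n))"

definition conj_chart :: "nat \<Rightarrow> (nat \<Rightarrow> complex) chart \<Rightarrow> (nat \<Rightarrow> complex) chart" where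
  "conj_chart n c = (conjugation n ` fst c, snd c \<circ> conjugation n)"

lemma overlapI: "q \<in> fst c \<Longrightarrow> q \<in> fst c' \<Longrightarrow> snd c q \<in> overlap c c'"
  by (cases c, cases c') (auto simp: overlap_def)

lemma overlapE:
  assumes "x \<in> overlap c c'" obtains q where "q \<in> fst c" "q \<in> fst c'" "x = snd c q"
  using assms by (cases c, cases c') (auto simp: overlap_def)

lemma transition_apply:
  assumes "inj_on (snd c) (fst c)" "q \<in> fst c"
  shows "transition c c' (snd c q) = snd c' q"
  using assms by (cases c, cases c') (auto simp: transition_def)

lemma is_chart_inj': "is_chart d X c \<Longrightarrow> inj_on (snd c) (fst c)"
  using is_chart_inj by (cases c) auto

lemma smooth_atlas_subset:
  assumes "smooth_atlas d X A" "B \<subseteq> A" "\<Union> (fst ` B) = topspace X"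
  shows "smooth_atlas d X B"
  using assms unfolding smooth_atlas_def by blast

lemma orientableI:
  assumes "smooth_atlas (dimension M) (topology_of M) (charts M)" "B \<subseteq> charts M"
    "smooth_atlas (dimension M) (topology_of M) B"
    "\<And>c c' x. c \<in> B \<Longrightarrow> c' \<in> B \<Longrightarrow> x \<in> overlap c c' \<Longrightarrow> jacobian_det (dimension M) (transition c c') x > 0"
  shows "orientable M"
  unfolding orientable_def oriented_atlas_def
proof (intro exI[of _ B] conjI ballI assms(3,4))
  show "compatible (dimension M) c c'" if "c \<in> B" "c' \<in> charts M" for c c'
    using that assms(1,2) unfolding smooth_atlas_def by blast
qed

context polygons
begin

abbreviation "cls \<equiv> isometry_class n"
abbreviation "Q \<equiv> quotient_topology (top_of_set M) cls"

definition small_chart :: "(nat \<Rightarrow> complex) chart \<Rightarrow> bool" where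
  "small_chart c \<longleftrightarrow> c \<in> pcharts \<and> inj_on cls (fst c)"

lemma reduced_simps [simp]:
  "dimension (reduced_polygon_space n l) = n - 3"
  "topology_of (reduced_polygon_space n l) = Q"
  "charts (reduced_polygon_space n l) = push_chart n ` {c. small_chart c}"
proof -
  show "charts (reduced_polygon_space n l) = push_chart n ` {c. small_chart c}"
  proof (intro equalityI subsetI)
    fix k assume "k \<in> charts (reduced_polygon_space n l)"
    then obtain U \<phi> where "k = (cls ` U, \<phi> \<circ> inv_into U cls)" "(U, \<phi>) \<in> pcharts" "inj_on cls U"
      by (auto simp: reduced_polygon_space_def quotient_manifold_def polygon_space_def)
    then have "k = push_chart n (U, \<phi>)" "small_chart (U, \<phi>)" by (simp_all add: push_chart_def small_chart_def)
    then show "k \<in> push_chart n ` {c. small_chart c}" by blast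
  next
    fix k assume "k \<in> push_chart n ` {c. small_chart c}"
    then obtain c where c: "small_chart c" "k = push_chart n c" by blast
    then have "k = (cls ` fst c, snd c \<circ> inv_into (fst c) cls)" "(fst c, snd c) \<in> pcharts" "inj_on cls (fst c)"
      by (simp_all add: push_chart_def small_chart_def)
    then have "\<exists>U \<phi>. k = (cls ` U, \<phi> \<circ> inv_into U cls) \<and> (U, \<phi>) \<in> pcharts \<and> inj_on cls U"
      by (intro exI[of _ "fst c"] exI[of _ "snd c"] conjI)
    then show "k \<in> charts (reduced_polygon_space n l)"
      by (simp add: reduced_polygon_space_def quotient_manifold_def polygon_space_def)
  qed
qed (simp_all add: reduced_polygon_space_def quotient_manifold_def polygon_space_def)

lemma class_conjugation: "z \<in> M \<Longrightarrow> cls (cj z) = cls z"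
  using conjugation_invol by (auto simp: isometry_class_def)

lemma class_eq_iff:
  assumes "z \<in> M" "w \<in> M" shows "cls z = cls w \<longleftrightarrow> w = z \<or> w = cj z"
proof
  assume "cls z = cls w"
  moreover have "w \<in> cls w" by (simp add: isometry_class_def)
  ultimately show "w = z \<or> w = cj z" by (auto simp: isometry_class_def)
qed (use assms class_conjugation in auto)

lemma small_chartD:
  assumes "small_chart c"
  shows "c \<in> pcharts" "inj_on cls (fst c)" "is_chart (n - 3) (top_of_set M) c"
    "fst c \<subseteq> M" "openin (top_of_set M) (fst c)" "inj_on (snd c) (fst c)"
    "q \<in> fst c \<Longrightarrow> snd (push_chart n c) (cls q) = snd c q"
proof -
  show c: "c \<in> pcharts" "inj_on cls (fst c)" using assms by (simp_all add: small_chart_def)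
  obtain U \<phi> where eq: "c = (U, \<phi>)" by (cases c)
  note f = chart_facts[OF c(1)[unfolded eq]]
  show "is_chart (n - 3) (top_of_set M) c" "fst c \<subseteq> M" "openin (top_of_set M) (fst c)" "inj_on (snd c) (fst c)"
    using f by (simp_all add: eq)
  show "q \<in> fst c \<Longrightarrow> snd (push_chart n c) (cls q) = snd c q"
    using c(2) by (simp add: push_chart_def)
qed

lemma openin_Q: "openin Q V \<longleftrightarrow> V \<subseteq> cls ` M \<and> openin (top_of_set M) {x \<in> M. cls x \<in> V}"
  by (simp add: openin_quotient_topology)

lemma openin_class_image:
  assumes "openin (top_of_set M) A" shows "openin Q (cls ` A)"
proof -
  have AM: "A \<subseteq> M" using openin_subset[OF assms] by simp
  have "{x \<in> M. cls x \<in> cls ` A} = A \<union> cj ` A"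
  proof (intro equalityI subsetI)
    fix x assume "x \<in> {x \<in> M. cls x \<in> cls ` A}"
    then obtain a where "a \<in> A" "x \<in> M" "cls x = cls a" by blast
    then have "x = a \<or> x = cj a" using class_eq_iff[of a x] AM by (auto simp: subset_iff)
    then show "x \<in> A \<union> cj ` A" using \<open>a \<in> A\<close> by blast
  next
    fix x assume "x \<in> A \<union> cj ` A"
    then obtain a where a: "a \<in> A" "x = a \<or> x = cj a" by blast
    then have "x \<in> M" "cls x = cls a" using AM conjugation_polygon[of a] class_conjugation[of a] by auto
    then show "x \<in> {x \<in> M. cls x \<in> cls ` A}" using a(1) by blast
  qed
  then show ?thesis
    unfolding openin_Q using AM openin_Un[OF assms openin_conjugation_image[OF assms]] by auto
qed

lemma push_is_chart:
  assumes "small_chart c" shows "is_chart (n - 3) Q (push_chart n c)"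
proof -
  obtain U \<phi> where eq: "c = (U, \<phi>)" by (cases c)
  note s = small_chartD[OF assms, unfolded eq, simplified]
  note f = chart_facts[OF s(1)]
  let ?\<xi> = "inv_into U \<phi>" and ?\<pi> = "inv_into U cls"
  have "is_chart (n - 3) Q (cls ` U, \<phi> \<circ> ?\<pi>)"
  proof (rule is_chartI[where \<phi> = "\<phi> \<circ> ?\<pi>" and \<psi> = "\<lambda>t. cls (?\<xi> t)", OF openin_class_image[OF f(7)] f(2)])
    fix B assume B: "openin (Euclidean_space (n - 3)) B"
    have "{x \<in> cls ` U. (\<phi> \<circ> ?\<pi>) x \<in> B} = cls ` {z \<in> U. \<phi> z \<in> B}"
      using s(2) by (auto simp: image_iff)
    then show "openin Q {x \<in> cls ` U. (\<phi> \<circ> ?\<pi>) x \<in> B}"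
      using openin_class_image[OF is_chart_open_preimage[OF f(1) B]] by simp
  next
    fix A assume A: "openin Q A"
    have "{t \<in> \<phi> ` U. cls (?\<xi> t) \<in> A} = \<phi> ` ({x \<in> M. cls x \<in> A} \<inter> U)"
      using f(3,4) by (auto simp: image_iff)
    moreover have "openin (top_of_set M) ({x \<in> M. cls x \<in> A} \<inter> U)"
      using A f(7) by (auto simp: openin_Q)
    ultimately show "openin (Euclidean_space (n - 3)) {t \<in> \<phi> ` U. cls (?\<xi> t) \<in> A}"
      using is_chart_open_image[OF f(1)] by simp
  qed (use s(2) f(3) in auto)
  then show ?thesis by (simp add: push_chart_def eq)
qed

lemma evenly_covered:
  assumes "z \<in> M" shows "\<exists>A. openin (top_of_set M) A \<and> z \<in> A \<and> inj_on cls A"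
proof -
  obtain j where j: "j \<in> {1..n-1}" "Im (z j) \<noteq> 0" using polygon_nonreal[OF assms] by blast
  define A where "A = M \<inter> {w. Im (z j) * Im (w j) > 0}"
  have "openin (top_of_set M) A" unfolding A_def
    by (intro openin_open_Int open_Collect_less continuous_intros continuous_on_product_coordinates)
  moreover have "z \<in> A" using assms j(2) by (auto simp: A_def zero_less_mult_iff linorder_neq_iff)
  moreover have "inj_on cls A"
  proof (rule inj_onI)
    fix a b assume ab: "a \<in> A" "b \<in> A" "cls a = cls b"
    then consider "b = a" | "b = cj a" using class_eq_iff[of a b] by (auto simp: A_def)
    then show "a = b"
    proof cases
      case 2
      then have "Im (b j) = - Im (a j)" using conjugation_apply(1)[OF j(1)] by simp
      then show ?thesis using ab(1,2) by (auto simp: A_def)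
    qed simp
  qed
  ultimately show ?thesis by blast
qed

lemma small_conj_chart:
  assumes "small_chart c"
  shows "small_chart (conj_chart n c)"
proof -
  obtain U \<phi> where eq: "c = (U, \<phi>)" by (cases c)
  note s = small_chartD[OF assms, unfolded eq, simplified]
  have "inj_on cls (cj ` U)"
  proof (rule inj_onI)
    fix a b assume "a \<in> cj ` U" "b \<in> cj ` U" and e: "cls a = cls b"
    then obtain a' b' where ab: "a' \<in> U" "b' \<in> U" "a = cj a'" "b = cj b'" by blast
    then have "cls a' = cls b'" using e class_conjugation[of a'] class_conjugation[of b'] s(4) by auto
    then show "a = b" using ab inj_onD[OF s(2), of a' b'] by simp
  qed
  then show ?thesis using conjugate_chart(1)[OF s(1)] by (simp add: small_chart_def conj_chart_def eq)
qed

text \<open>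
  Two points over the same class are equal or conjugate. So a coordinate change in the quotient is,
  near each point, one upstairs to either the given chart or its conjugate.
\<close>

lemma push_overlap_cases:
  assumes c: "small_chart c" and c': "small_chart c'" and x: "x \<in> overlap (push_chart n c) (push_chart n c')"
  shows "\<exists>c''\<in>{c', conj_chart n c'}. x \<in> overlap c c'' \<and>
    (\<forall>y\<in>overlap c c''. y \<in> overlap (push_chart n c) (push_chart n c') \<and>
       transition (push_chart n c) (push_chart n c') y = transition c c'' y)"
proof -
  note s = small_chartD[OF c] and s' = small_chartD[OF c']
  have same: "y \<in> overlap (push_chart n c) (push_chart n c') \<and>
       transition (push_chart n c) (push_chart n c') y = snd c' b"
    if "a \<in> fst c" "b \<in> fst c'" "cls b = cls a" "y = snd c a" for a b y
  proof -
    have "cls a \<in> fst (push_chart n c)" "cls a \<in> fst (push_chart n c')"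
      using that by (auto simp: push_chart_def image_iff)
    moreover have "snd (push_chart n c) (cls a) = y" using s(7)[OF that(1)] that(4) by simp
    moreover have "snd (push_chart n c') (cls a) = snd c' b" using s'(7)[OF that(2)] that(3) by simp
    ultimately show ?thesis
      using overlapI[of "cls a" "push_chart n c" "push_chart n c'"]
        transition_apply[OF is_chart_inj'[OF push_is_chart[OF c]], of "cls a" "push_chart n c'"] by simp
  qed
  obtain q where q: "q \<in> fst (push_chart n c)" "q \<in> fst (push_chart n c')" "x = snd (push_chart n c) q"
    using x by (rule overlapE)
  obtain a where a: "a \<in> fst c" "q = cls a" using q(1) by (auto simp: push_chart_def)
  obtain b where b: "b \<in> fst c'" "q = cls b" using q(2) by (auto simp: push_chart_def)
  have M: "a \<in> M" "b \<in> M" using a b s(4) s'(4) by auto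
  have xa: "x = snd c a" using q(3) s(7)[OF a(1)] a(2) by simp
  have "a = b \<or> a = cj b" using class_eq_iff[OF M(2,1)] a b by simp
  then show ?thesis
  proof
    assume "a = b"
    then have "x \<in> overlap c c'" using overlapI[OF a(1), of c'] b xa by simp
    moreover have "y \<in> overlap (push_chart n c) (push_chart n c') \<and>
       transition (push_chart n c) (push_chart n c') y = transition c c' y" if y: "y \<in> overlap c c'" for y
    proof -
      obtain w where w: "w \<in> fst c" "w \<in> fst c'" "y = snd c w" using y by (rule overlapE)
      then show ?thesis using same[OF w(1,2) refl w(3)] transition_apply[OF s(6) w(1), of c'] by simp
    qed
    ultimately show ?thesis by blast
  next
    assume "a = cj b"
    then have "x \<in> overlap c (conj_chart n c')"
      using overlapI[OF a(1), of "conj_chart n c'"] b xa by (auto simp: conj_chart_def)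
    moreover have "y \<in> overlap (push_chart n c) (push_chart n c') \<and>
       transition (push_chart n c) (push_chart n c') y = transition c (conj_chart n c') y"
      if y: "y \<in> overlap c (conj_chart n c')" for y
    proof -
      obtain w where w: "w \<in> fst c" "w \<in> fst (conj_chart n c')" "y = snd c w" using y by (rule overlapE)
      then obtain v where v: "v \<in> fst c'" "w = cj v" by (auto simp: conj_chart_def)
      have vM: "v \<in> M" using v s'(4) by blast
      have "cls v = cls w" using class_conjugation[OF vM] v(2) by simp
      moreover have "snd (conj_chart n c') w = snd c' v" using conjugation_invol[OF vM] v(2) by (simp add: conj_chart_def)
      ultimately show ?thesis
        using same[OF w(1) v(1) _ w(3)] transition_apply[OF s(6) w(1), of "conj_chart n c'"] w(3) by simp
    qed
    ultimately show ?thesis by blast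
  qed
qed

lemma push_smooth_transition:
  assumes c: "small_chart c" and c': "small_chart c'"
  shows "smooth_map (n - 3) (overlap (push_chart n c) (push_chart n c')) (transition (push_chart n c) (push_chart n c'))"
proof (rule smooth_map_local[OF overlap_open[OF push_is_chart[OF c] push_is_chart[OF c']]])
  fix x assume x: "x \<in> overlap (push_chart n c) (push_chart n c')"
  obtain c'' where c'': "c'' \<in> {c', conj_chart n c'}" "x \<in> overlap c c''"
    "\<forall>y\<in>overlap c c''. y \<in> overlap (push_chart n c) (push_chart n c') \<and>
       transition (push_chart n c) (push_chart n c') y = transition c c'' y"
    using push_overlap_cases[OF c c' x] by blast
  have s'': "small_chart c''" using c''(1) c' small_conj_chart by blast
  have op: "openin (Euclidean_space (n - 3)) (overlap c c'')"
    by (rule overlap_open[OF small_chartD(3)[OF c] small_chartD(3)[OF s'']])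
  have "smooth_map (n - 3) (overlap c c'') (transition c c'')"
    using submanifold_compatible[OF graph small_chartD(1)[OF c] small_chartD(1)[OF s'']] by (simp add: compatible_def)
  then have "smooth_map (n - 3) (overlap c c'') (transition (push_chart n c) (push_chart n c'))"
    by (rule smooth_map_cong[OF op, rotated]) (use c''(3) in simp)
  then show "\<exists>V. openin (Euclidean_space (n - 3)) V \<and> x \<in> V \<and>
      smooth_map (n - 3) V (transition (push_chart n c) (push_chart n c'))"
    using op c''(2) by blast
qed

lemma small_chart_at:
  assumes z: "z \<in> M" shows "\<exists>c. small_chart c \<and> z \<in> fst c"
proof -
  obtain A where A: "openin (top_of_set M) A" "z \<in> A" "inj_on cls A" using evenly_covered[OF z] by blast
  obtain U \<phi> where c: "(U, \<phi>) \<in> pcharts" "z \<in> U" using graph z unfolding locally_linear_graph_def by blast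
  have "openin (top_of_set M) (U \<inter> A)" using chart_facts(7)[OF c(1)] A(1) by (rule openin_Int)
  then have "(U \<inter> A, \<phi>) \<in> pcharts" by (rule submanifold_chart_restrict[OF c(1)]) simp
  moreover have "inj_on cls (U \<inter> A)" using A(3) by (rule inj_on_subset) simp
  ultimately show ?thesis using c(2) A(2) by (intro exI[of _ "(U \<inter> A, \<phi>)"]) (simp add: small_chart_def)
qed

lemma reduced_smooth_atlas:
  "smooth_atlas (n - 3) Q (charts (reduced_polygon_space n l))"
  unfolding smooth_atlas_def
proof (intro conjI ballI)
  show "is_chart (n - 3) Q k" if "k \<in> charts (reduced_polygon_space n l)" for k
    using that push_is_chart by auto
  show "compatible (n - 3) k k'"
    if "k \<in> charts (reduced_polygon_space n l)" "k' \<in> charts (reduced_polygon_space n l)" for k k'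
    using that push_smooth_transition by (auto simp: compatible_def)
  have "\<Union> (fst ` charts (reduced_polygon_space n l)) = cls ` M"
  proof (intro equalityI subsetI)
    fix q assume "q \<in> \<Union> (fst ` charts (reduced_polygon_space n l))"
    then obtain c where c: "small_chart c" "q \<in> fst (push_chart n c)" by auto
    then show "q \<in> cls ` M" using small_chartD(4)[OF c(1)] by (auto simp: push_chart_def)
  next
    fix q assume "q \<in> cls ` M"
    then obtain z where z: "z \<in> M" "q = cls z" by blast
    obtain c where c: "small_chart c" "z \<in> fst c" using small_chart_at[OF z(1)] by blast
    then have "q \<in> fst (push_chart n c)" using z(2) by (simp add: push_chart_def)
    then show "q \<in> \<Union> (fst ` charts (reduced_polygon_space n l))" using c(1) unfolding reduced_simps by blast
  qed
  then show "\<Union> (fst ` charts (reduced_polygon_space n l)) = topspace Q"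
    by (simp add: topspace_quotient_topology)
qed

abbreviation "cform c \<equiv> form (inv_into (fst c) (snd c))"

lemma cform_transition:
  assumes "small_chart c" "small_chart c'" "x \<in> overlap c c'"
  shows "cform c x = jacobian_det (n - 3) (transition c c') x * cform c' (transition c c' x)"
  using form_transition[of "fst c" "snd c" "fst c'" "snd c'" x] assms small_chartD(1)
  by (cases c, cases c') (auto simp: overlap_def)

lemma cform_conj:
  assumes "small_chart c" "z \<in> fst c"
  shows "cform (conj_chart n c) (snd c z) = (-1) ^ n * cform c (snd c z)"
  using conjugate_chart(2)[of "fst c" "snd c" "snd c z"] assms small_chartD(1)[OF assms(1)]
  by (simp add: conj_chart_def)

text \<open>
  A locally constant sign \<open>\<sigma>\<close> on the polygon space that transforms under conjugation like the
  form does orients the quotient: the charts on which \<open>\<sigma>\<close> times the form is positive fit together.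
\<close>

lemma orientable_if_sign:
  assumes \<sigma>: "\<And>z. z \<in> M \<Longrightarrow> \<sigma> z = 1 \<or> \<sigma> z = (-1::real)"
    and \<sigma>_open: "\<And>e. openin (top_of_set M) {z \<in> M. \<sigma> z = e}"
    and \<sigma>_conj: "\<And>z. z \<in> M \<Longrightarrow> \<sigma> (cj z) = (-1) ^ n * \<sigma> z"
  shows "orientable (reduced_polygon_space n l)"
proof (cases "n - 3 = 0")
  case True
  then show ?thesis using reduced_smooth_atlas by (intro orientable_dimension_0) auto
next
  case False
  define G where "G = {c. small_chart c \<and> (\<forall>z\<in>fst c. \<sigma> z * cform c (snd c z) > 0)}"
  have Gs: "small_chart c" if "c \<in> G" for c using that by (simp add: G_def)
  let ?B = "push_chart n ` G"
  have sub: "?B \<subseteq> charts (reduced_polygon_space n l)" using Gs by auto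
  have "topspace Q \<subseteq> \<Union> (fst ` ?B)"
  proof
    fix q assume "q \<in> topspace Q"
    then obtain z where z: "z \<in> M" "q = cls z" by (auto simp: topspace_quotient_topology)
    obtain A where A: "openin (top_of_set M) A" "z \<in> A" "inj_on cls A" using evenly_covered[OF z(1)] by blast
    let ?A = "A \<inter> {w \<in> M. \<sigma> w = \<sigma> z}"
    have "openin (top_of_set M) ?A" using A(1) \<sigma>_open by (rule openin_Int)
    then obtain U \<phi> where c: "(U, \<phi>) \<in> pcharts" "z \<in> U" "U \<subseteq> ?A"
        "\<forall>x\<in>\<phi> ` U. \<sigma> z * form (inv_into U \<phi>) x > 0"
      using chart_with_sign[of z ?A "\<sigma> z"] False A(2) z(1) \<sigma>[OF z(1)] by auto
    have "(U, \<phi>) \<in> G"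
      using c inj_on_subset[OF A(3), of U] by (auto simp: G_def small_chart_def)
    moreover have "q \<in> fst (push_chart n (U, \<phi>))" using c(2) z(2) by (simp add: push_chart_def)
    ultimately show "q \<in> \<Union> (fst ` ?B)" by blast
  qed
  moreover have "\<Union> (fst ` ?B) \<subseteq> topspace Q"
    using sub reduced_smooth_atlas unfolding smooth_atlas_def by blast
  ultimately have "\<Union> (fst ` ?B) = topspace Q" by (rule equalityI[rotated])
  then have atlas: "smooth_atlas (n - 3) Q ?B"
    by (intro smooth_atlas_subset[OF reduced_smooth_atlas sub])
  have "jacobian_det (n - 3) (transition k k') x > 0"
    if k: "k \<in> ?B" "k' \<in> ?B" and x: "x \<in> overlap k k'" for k k' x
  proof -
    obtain c c' where c: "c \<in> G" "k = push_chart n c" and c': "c' \<in> G" "k' = push_chart n c'" using k by blast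
    obtain c'' where c'': "c'' \<in> {c', conj_chart n c'}" "x \<in> overlap c c''"
      "\<forall>y\<in>overlap c c''. y \<in> overlap k k' \<and> transition k k' y = transition c c'' y"
      using push_overlap_cases[OF Gs[OF c(1)] Gs[OF c'(1)]] x c c' by blast
    have s'': "small_chart c''" using c''(1) Gs[OF c'(1)] small_conj_chart by blast
    obtain z where z: "z \<in> fst c" "z \<in> fst c''" "x = snd c z" using c''(2) by (rule overlapE)
    have zM: "z \<in> M" using z(1) small_chartD(4)[OF Gs[OF c(1)]] by blast
    have "jacobian_det (n - 3) (transition k k') x = jacobian_det (n - 3) (transition c c'') x"
      by (rule jacobian_det_local[OF overlap_open[OF small_chartD(3)[OF Gs[OF c(1)]] small_chartD(3)[OF s'']]])
        (use c'' in auto)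
    moreover have "cform c x = jacobian_det (n - 3) (transition c c'') x * cform c'' (snd c'' z)"
      using cform_transition[OF Gs[OF c(1)] s'' c''(2)]
        transition_apply[OF small_chartD(6)[OF Gs[OF c(1)]] z(1), of c''] z(3) by simp
    moreover have "\<sigma> z * cform c x > 0" using c(1) z by (simp add: G_def)
    moreover have "\<sigma> z * cform c'' (snd c'' z) > 0"
    proof (cases "c'' = c'")
      case True
      then show ?thesis using c'(1) z(2) by (simp add: G_def)
    next
      case False
      then have eq: "c'' = conj_chart n c'" using c''(1) by blast
      then obtain v where v: "v \<in> fst c'" "z = cj v" using z(2) by (auto simp: conj_chart_def)
      have vM: "v \<in> M" using v(1) small_chartD(4)[OF Gs[OF c'(1)]] by blast
      have "snd c'' z = snd c' v" using v(2) conjugation_invol[OF vM] by (simp add: eq conj_chart_def)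
      then have "\<sigma> z * cform c'' (snd c'' z) = ((-1) ^ n * \<sigma> v) * ((-1) ^ n * cform c' (snd c' v))"
        using cform_conj[OF Gs[OF c'(1)] v(1)] \<sigma>_conj[OF vM] by (simp add: eq v(2))
      also have "\<dots> = ((-1) ^ n * (-1) ^ n) * (\<sigma> v * cform c' (snd c' v))" by (simp only: mult_ac)
      also have "(-1) ^ n * (-1) ^ n = (1 :: real)" by (simp add: power_mult_distrib[symmetric])
      finally show ?thesis using c'(1) v(1) by (simp add: G_def)
    qed
    ultimately show ?thesis
      using \<sigma>[OF zM] by (auto simp: zero_less_mult_iff mult_less_0_iff)
  qed
  then show ?thesis
    using orientableI[of "reduced_polygon_space n l" ?B] atlas reduced_smooth_atlas sub
    unfolding reduced_simps by blast
qed

text \<open>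
  Conversely, an orientation of the quotient assigns to each polygon the sign by which it differs
  from the form. The sign is locally constant and, for odd \<open>n\<close>, changes under conjugation.
\<close>

lemma not_orientable_if_connected:
  assumes odd: "odd n" and C: "connected C" "C \<subseteq> M" "z \<in> C" "cj z \<in> C"
  shows "\<not> orientable (reduced_polygon_space n l)"
proof
  let ?d = "n - 3"
  assume "orientable (reduced_polygon_space n l)"
  then obtain B where atlas: "smooth_atlas ?d Q B"
    and pos: "\<And>k k' x. k \<in> B \<Longrightarrow> k' \<in> B \<Longrightarrow> x \<in> overlap k k' \<Longrightarrow> jacobian_det ?d (transition k k') x > 0"
    and comp: "\<And>k c. k \<in> B \<Longrightarrow> small_chart c \<Longrightarrow> compatible ?d k (push_chart n c)"
    unfolding orientable_def oriented_atlas_def by auto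
  have Bchart: "is_chart ?d Q k" if "k \<in> B" for k using atlas that by (simp add: smooth_atlas_def)
  have comp': "compatible ?d (push_chart n c) k" if "k \<in> B" "small_chart c" for k c
    using comp[OF that] by (simp add: compatible_def)
  have Bcover: "\<exists>k\<in>B. cls w \<in> fst k" if "w \<in> M" for w
  proof -
    have "cls w \<in> topspace Q" using that by (simp add: topspace_quotient_topology)
    then show ?thesis using atlas unfolding smooth_atlas_def by blast
  qed
  define val where "val c k x = jacobian_det ?d (transition (push_chart n c) k) x * cform c x" for c k x
  define valid where "valid c k w \<longleftrightarrow> small_chart c \<and> k \<in> B \<and> w \<in> fst c \<and> cls w \<in> fst k" for c k w
  have val_point: "snd c w \<in> overlap (push_chart n c) k" if "valid c k w" for c k w
  proof -
    have "cls w \<in> fst (push_chart n c)" using that by (auto simp: valid_def push_chart_def)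
    then show ?thesis
      using overlapI[of "cls w" "push_chart n c" k] that small_chartD(7)[of c w] by (simp add: valid_def)
  qed
  have val_nz: "val c k (snd c w) \<noteq> 0" if "valid c k w" for c k w
  proof -
    have c: "small_chart c" "k \<in> B" "w \<in> fst c" using that by (auto simp: valid_def)
    have "jacobian_det ?d (transition (push_chart n c) k) (snd c w) \<noteq> 0"
      by (rule jacobian_det_transition_nonzero[OF push_is_chart[OF c(1)] Bchart[OF c(2)] comp'[OF c(2,1)] val_point[OF that]])
    moreover have "cform c (snd c w) \<noteq> 0"
      using orientation_form_nonzero[of "fst c" "snd c" "snd c w"] small_chartD(1)[OF c(1)] c(3) by simp
    ultimately show ?thesis by (simp add: val_def)
  qed
  have consistent: "val c k (snd c w) * val c' k' (snd c' w) > 0"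
    if v: "valid c k w" and v': "valid c' k' w" for c k c' k' w
  proof -
    have c: "small_chart c" "k \<in> B" "w \<in> fst c" "cls w \<in> fst k" using v by (auto simp: valid_def)
    have c': "small_chart c'" "k' \<in> B" "w \<in> fst c'" "cls w \<in> fst k'" using v' by (auto simp: valid_def)
    let ?p = "push_chart n c" and ?p' = "push_chart n c'"
    let ?x = "snd c w" and ?x' = "snd c' w"
    let ?J = "\<lambda>k k' x. jacobian_det ?d (transition k k') x"
    note P = push_is_chart[OF c(1)] and P' = push_is_chart[OF c'(1)]
    note K = Bchart[OF c(2)] and K' = Bchart[OF c'(2)]
    have q: "cls w \<in> fst ?p" "cls w \<in> fst ?p'" using c(3) c'(3) by (auto simp: push_chart_def)
    have px: "snd ?p (cls w) = ?x" "snd ?p' (cls w) = ?x'"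
      using small_chartD(7)[OF c(1,3)] small_chartD(7)[OF c'(1,3)] by simp_all
    have ov: "?x \<in> overlap ?p ?p'" "?x \<in> overlap ?p k" "?x \<in> overlap ?p k'" "?x' \<in> overlap ?p' k'"
      using overlapI[OF q] overlapI[OF q(1) c(4)] overlapI[OF q(1) c'(4)] overlapI[OF q(2) c'(4)] px by simp_all
    have tr: "transition ?p ?p' ?x = ?x'" "transition ?p k' ?x = snd k' (cls w)"
      using transition_apply[OF is_chart_inj'[OF P] q(1)] px by simp_all
    have J1: "?J ?p k ?x = ?J k' k (snd k' (cls w)) * ?J ?p k' ?x"
      using jacobian_det_transition_chain[OF P K' K comp'[OF c'(2) c(1)] _ ov(3,2)] atlas c(2) c'(2) tr(2)
      by (simp add: smooth_atlas_def)
    have compp: "compatible ?d ?p ?p'"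
      using push_smooth_transition c(1) c'(1) by (simp add: compatible_def)
    have J2: "?J ?p k' ?x = ?J ?p' k' ?x' * ?J ?p ?p' ?x"
      using jacobian_det_transition_chain[OF P P' K' compp comp'[OF c'(2,1)] ov(1,3)] tr(1) by simp
    have x: "?x \<in> overlap c c'" by (rule overlapI[OF c(3) c'(3)])
    have op: "openin (Euclidean_space ?d) (overlap c c')"
      by (rule overlap_open[OF small_chartD(3)[OF c(1)] small_chartD(3)[OF c'(1)]])
    have J3: "?J ?p ?p' ?x = ?J c c' ?x"
    proof (rule jacobian_det_local[OF op _ x])
      fix y assume "y \<in> overlap c c'"
      then obtain v where v: "v \<in> fst c" "v \<in> fst c'" "y = snd c v" by (rule overlapE)
      then have "snd ?p (cls v) = y" "snd ?p' (cls v) = snd c' v" "cls v \<in> fst ?p"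
        using small_chartD(7)[OF c(1)] small_chartD(7)[OF c'(1)] by (auto simp: push_chart_def)
      then show "transition ?p ?p' y = transition c c' y"
        using transition_apply[OF is_chart_inj'[OF P], of "cls v" ?p']
          transition_apply[OF small_chartD(6)[OF c(1)] v(1), of c'] v(3) by simp
    qed
    have F: "cform c ?x = ?J c c' ?x * cform c' ?x'"
      using cform_transition[OF c(1) c'(1) x] transition_apply[OF small_chartD(6)[OF c(1)] c(3), of c'] by simp
    have "val c k ?x = ?J k' k (snd k' (cls w)) * (?J c c' ?x)\<^sup>2 * val c' k' ?x'"
      unfolding val_def J1 J2 J3 F by (simp add: power2_eq_square)
    moreover have "?J k' k (snd k' (cls w)) > 0" by (rule pos[OF c'(2) c(2) overlapI[OF c'(4) c(4)]])
    moreover have "?J c c' ?x \<noteq> 0"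
      using F orientation_form_nonzero[of "fst c" "snd c" ?x] small_chartD(1)[OF c(1)] c(3) by auto
    moreover have "val c' k' ?x' \<noteq> 0" by (rule val_nz[OF v'])
    ultimately have "val c k ?x * val c' k' ?x' =
        ?J k' k (snd k' (cls w)) * (?J c c' ?x)\<^sup>2 * (val c' k' ?x')\<^sup>2" by (simp add: power2_eq_square)
    then show ?thesis
      using \<open>?J k' k (snd k' (cls w)) > 0\<close> \<open>?J c c' ?x \<noteq> 0\<close> \<open>val c' k' ?x' \<noteq> 0\<close> by simp
  qed
  define D where "D s = {w \<in> M. \<exists>c k. valid c k w \<and> s * val c k (snd c w) > 0}" for s :: real
  have D_I: "w \<in> D s" if "w \<in> M" "valid c k w" "s * val c k (snd c w) > 0" for w c k s
    using that unfolding D_def by blast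
  have D_open: "openin (top_of_set M) (D s)" for s
  proof (subst openin_subopen, intro ballI)
    fix w assume "w \<in> D s"
    then obtain c k where v: "valid c k w" and s: "s * val c k (snd c w) > 0" by (auto simp: D_def)
    have c: "small_chart c" "k \<in> B" "w \<in> fst c" "cls w \<in> fst k" using v by (auto simp: valid_def)
    obtain U \<phi> where eq: "c = (U, \<phi>)" by (cases c)
    let ?O = "overlap (push_chart n c) k"
    have O: "openin (Euclidean_space ?d) ?O" by (rule overlap_open[OF push_is_chart[OF c(1)] Bchart[OF c(2)]])
    have OU: "?O \<subseteq> \<phi> ` U"
    proof
      fix y assume "y \<in> ?O"
      then obtain q where "q \<in> fst (push_chart n c)" "y = snd (push_chart n c) q" by (rule overlapE)
      then obtain v where "v \<in> fst c" "y = snd c v" using small_chartD(7)[OF c(1)] by (auto simp: push_chart_def)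
      then show "y \<in> \<phi> ` U" by (simp add: eq)
    qed
    have "continuous_on ?O (cform c)"
      using continuous_on_subset[OF continuous_on_form OU] small_chartD(1)[OF c(1)] by (simp add: eq)
    moreover have "continuous_on ?O (jacobian_det ?d (transition (push_chart n c) k))"
      using comp'[OF c(2,1)] by (intro continuous_on_jacobian_det[OF O]) (simp add: compatible_def)
    ultimately have cont: "continuous_on ?O (\<lambda>x. s * val c k x)"
      unfolding val_def by (intro continuous_intros)
    let ?O' = "{x \<in> ?O. s * val c k x \<in> {0<..}}"
    have O': "openin (Euclidean_space ?d) ?O'"
      by (rule openin_Euclidean_preimage[OF O cont, of UNIV]) auto
    let ?T = "{v \<in> U. \<phi> v \<in> ?O'}"
    have "openin (top_of_set M) ?T"
      using is_chart_open_preimage[OF _ O'] small_chartD(3)[OF c(1)] by (simp add: eq)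
    moreover have "w \<in> ?T" using c(3) s val_point[OF v] by (simp add: eq)
    moreover have "?T \<subseteq> D s"
    proof
      fix v assume v: "v \<in> ?T"
      then have vc: "v \<in> fst c" by (simp add: eq)
      have "snd c v \<in> ?O" using v by (simp add: eq)
      then obtain q where q: "q \<in> fst (push_chart n c)" "q \<in> fst k" "snd c v = snd (push_chart n c) q"
        by (rule overlapE)
      then obtain v' where v': "v' \<in> fst c" "q = cls v'" by (auto simp: push_chart_def)
      have "snd c v = snd c v'" using q(3) v' small_chartD(7)[OF c(1) v'(1)] by simp
      then have "v = v'" using inj_onD[OF small_chartD(6)[OF c(1)] _ vc v'(1)] by simp
      then have "valid c k v" using c vc q(2) v'(2) by (simp add: valid_def)
      moreover have "s * val c k (snd c v) > 0" using v by (simp add: eq)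
      moreover have "v \<in> M" using vc small_chartD(4)[OF c(1)] by blast
      ultimately show "v \<in> D s" using D_I by blast
    qed
    ultimately show "\<exists>T. openin (top_of_set M) T \<and> w \<in> T \<and> T \<subseteq> D s" by blast
  qed
  have D_disj: "D 1 \<inter> D (-1) = {}"
  proof (rule ccontr)
    assume "D 1 \<inter> D (-1) \<noteq> {}"
    then obtain w c k c' k' where "valid c k w" "val c k (snd c w) > 0" "valid c' k' w" "val c' k' (snd c' w) < 0"
      by (auto simp: D_def)
    then show False using consistent[of c k w c' k'] by (auto simp: zero_less_mult_iff)
  qed
  have D_cover: "w \<in> D 1 \<union> D (-1)" if "w \<in> M" for w
  proof -
    obtain c where c: "small_chart c" "w \<in> fst c" using small_chart_at[OF \<open>w \<in> M\<close>] by blast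
    obtain k where k: "k \<in> B" "cls w \<in> fst k" using Bcover[OF \<open>w \<in> M\<close>] by blast
    have v: "valid c k w" using c k by (simp add: valid_def)
    then have "1 * val c k (snd c w) > 0 \<or> (-1) * val c k (snd c w) > 0" using val_nz[OF v] by auto
    then show ?thesis using D_I[OF that v] by blast
  qed
  have D_conj: "cj w \<in> D (- s)" if w: "w \<in> D s" for w s
  proof -
    obtain c k where v: "valid c k w" and s: "s * val c k (snd c w) > 0" and wM: "w \<in> M" using w by (auto simp: D_def)
    have c: "small_chart c" "k \<in> B" "w \<in> fst c" "cls w \<in> fst k" using v by (auto simp: valid_def)
    let ?c = "conj_chart n c"
    have c': "small_chart ?c" by (rule small_conj_chart[OF c(1)])
    have v': "valid ?c k (cj w)"
      using c c' class_conjugation[OF wM] by (auto simp: valid_def conj_chart_def)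
    have snd': "snd ?c (cj u) = snd c u" if "u \<in> fst c" for u
      using conjugation_invol[of u] that small_chartD(4)[OF c(1)] by (auto simp: conj_chart_def)
    have "jacobian_det ?d (transition (push_chart n ?c) k) (snd c w) =
        jacobian_det ?d (transition (push_chart n c) k) (snd c w)"
    proof (rule jacobian_det_local[OF overlap_open[OF push_is_chart[OF c(1)] Bchart[OF c(2)]] _ val_point[OF v]])
      fix y assume "y \<in> overlap (push_chart n c) k"
      then obtain q where q: "q \<in> fst (push_chart n c)" "q \<in> fst k" "y = snd (push_chart n c) q" by (rule overlapE)
      then obtain u where u: "u \<in> fst c" "q = cls u" by (auto simp: push_chart_def)
      have uM: "u \<in> M" using u(1) small_chartD(4)[OF c(1)] by blast
      have cu: "cj u \<in> fst ?c" using u(1) by (simp add: conj_chart_def)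
      have qu: "q = cls (cj u)" using u(2) class_conjugation[OF uM] by simp
      have q': "q \<in> fst (push_chart n ?c)" using cu qu by (simp add: push_chart_def)
      have "snd (push_chart n ?c) q = y"
        using small_chartD(7)[OF c' cu] small_chartD(7)[OF c(1) u(1)] q(3) u(2) qu snd'[OF u(1)] by simp
      then show "transition (push_chart n ?c) k y = transition (push_chart n c) k y"
        using transition_apply[OF is_chart_inj'[OF push_is_chart[OF c']] q', of k]
          transition_apply[OF is_chart_inj'[OF push_is_chart[OF c(1)]] q(1), of k] q(3) by simp
    qed
    then have "val ?c k (snd ?c (cj w)) = - val c k (snd c w)"
      using cform_conj[OF c(1,3)] odd snd'[OF c(3)] by (simp add: val_def)
    then have "(- s) * val ?c k (snd ?c (cj w)) > 0" using s by simp
    then show ?thesis by (rule D_I[OF conjugation_polygon[OF wM] v'])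
  qed
  have "openin (top_of_set C) (C \<inter> D s)" for s
  proof -
    obtain T where "open T" "D s = M \<inter> T" using D_open[of s] by (auto simp: openin_open)
    then have "C \<inter> D s = C \<inter> T" using C(2) by blast
    then show ?thesis using \<open>open T\<close> by (simp add: openin_open_Int)
  qed
  moreover have "C \<subseteq> (C \<inter> D 1) \<union> (C \<inter> D (-1))" using D_cover C(2) by blast
  moreover have "(C \<inter> D 1) \<inter> (C \<inter> D (-1)) = {}" using D_disj by blast
  moreover have "C \<inter> D 1 \<noteq> {}" "C \<inter> D (-1) \<noteq> {}"
  proof -
    have z: "z \<in> D 1 \<union> D (-1)" using D_cover C(2,3) by blast
    have "z \<in> D 1 \<Longrightarrow> cj z \<in> D (-1)" "z \<in> D (-1) \<Longrightarrow> cj z \<in> D 1"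
      using D_conj[of z 1] D_conj[of z "-1"] by simp_all
    then show "C \<inter> D 1 \<noteq> {}" "C \<inter> D (-1) \<noteq> {}" using z C(3,4) by blast+
  qed
  ultimately show False using C(1) unfolding connected_openin by blast
qed

end

section \<open>Long and short sets of edges\<close>

text \<open>
  A closed polygon given by its edge directions is turned until the last one, which is then dropped,
  becomes \<open>-1\<close>.
\<close>

definition fix_last :: "nat \<Rightarrow> (nat \<Rightarrow> complex) \<Rightarrow> nat \<Rightarrow> complex" where
  "fix_last n u = (\<lambda>j\<in>{1..n-1}. - (u j * cnj (u n)))"

context polygons
begin

definition long :: "nat set \<Rightarrow> bool" where
  "long A \<longleftrightarrow> sum l ({1..n} - A) < sum l A"

lemma long_iff_not_long_compl:
  assumes "A \<subseteq> {1..n}" shows "long A \<longleftrightarrow> \<not> long ({1..n} - A)"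
proof -
  have "sum l A \<noteq> sum l ({1..n} - A)" using gen assms unfolding generic_def by blast
  moreover have "{1..n} - ({1..n} - A) = A" using assms by blast
  ultimately show ?thesis unfolding long_def by auto
qed

lemma long_mono:
  assumes "long A" "A \<subseteq> B" "B \<subseteq> {1..n}" shows "long B"
proof -
  have "sum l A \<le> sum l B" "sum l ({1..n} - B) \<le> sum l ({1..n} - A)"
  proof -
    have nn: "0 \<le> l j" if "j \<in> {1..n}" for j using length_pos[OF that] by (rule less_imp_le)
    show "sum l A \<le> sum l B"
      by (rule sum_mono2[OF finite_subset[OF assms(3)] assms(2)]) (use nn assms(3) in blast)+
    show "sum l ({1..n} - B) \<le> sum l ({1..n} - A)"
      by (rule sum_mono2) (use nn assms(2) in \<open>blast+\<close>)
  qed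
  then show ?thesis using assms(1) by (simp add: long_def)
qed

lemma long_sets_meet:
  assumes "long A" "long B" "A \<subseteq> {1..n}" "B \<subseteq> {1..n}" shows "A \<inter> B \<noteq> {}"
proof
  assume "A \<inter> B = {}"
  then have "B \<subseteq> {1..n} - A" using assms(4) by blast
  then have "long ({1..n} - A)" using long_mono[OF assms(2)] by blast
  then show False using long_iff_not_long_compl[OF assms(3)] assms(1) by blast
qed

lemma fix_last_in_polygon_set:
  assumes u: "\<And>j. j \<in> {1..n} \<Longrightarrow> norm (u j) = 1" and closed: "(\<Sum>j=1..n. of_real (l j) * u j) = 0"
  shows "fix_last n u \<in> M"
proof -
  have un: "norm (u n) = 1" using u n3 by simp
  have "fix_last n u \<in> torus_set (n - 1)"
    unfolding torus_set_def
  proof (rule PiE_I)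
    fix j assume "j \<in> {1..n-1}"
    then have "j \<in> {1..n}" "fix_last n u j = - (u j * cnj (u n))" by (auto simp: fix_last_def)
    then show "fix_last n u j \<in> sphere 0 1" using u un by (simp add: norm_mult)
  next
    fix j assume "j \<notin> {1..n-1}"
    then show "fix_last n u j = undefined" unfolding fix_last_def by (simp only: restrict_apply if_False)
  qed
  moreover have "(\<Sum>j=1..n-1. of_real (l j) * fix_last n u j) = of_real (l n)"
  proof -
    have "{1..n} = insert n {1..n-1}" using n3 by auto
    then have "(\<Sum>j=1..n. of_real (l j) * u j) = of_real (l n) * u n + (\<Sum>j=1..n-1. of_real (l j) * u j)"
      using n3 by simp
    then have s: "(\<Sum>j=1..n-1. of_real (l j) * u j) = - (of_real (l n) * u n)"
      using closed by (simp add: eq_neg_iff_add_eq_0 add.commute)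
    have "(\<Sum>j=1..n-1. of_real (l j) * fix_last n u j) = (\<Sum>j=1..n-1. - cnj (u n) * (of_real (l j) * u j))"
      by (intro sum.cong) (auto simp: fix_last_def)
    also have "\<dots> = - cnj (u n) * - (of_real (l n) * u n)" by (simp only: sum_distrib_left[symmetric] s)
    also have "\<dots> = of_real (l n) * (cnj (u n) * u n)" by (simp add: mult_ac)
    finally show ?thesis by (simp only: cnj_mult_unit[OF un] mult_1_right)
  qed
  ultimately show ?thesis by (simp only: polygon_set_def mem_Collect_eq simp_thms)
qed

lemma extended_polygon:
  assumes "z \<in> M"
  shows "j \<in> {1..n} \<Longrightarrow> norm ((z(n := -1)) j) = 1" "(\<Sum>j=1..n. of_real (l j) * (z(n := -1)) j) = 0"
proof -
  show "j \<in> {1..n} \<Longrightarrow> norm ((z(n := -1)) j) = 1"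
    using polygon_norm[OF assms, of j] by (cases "j = n") auto
  have "{1..n} = insert n {1..n-1}" using n3 by auto
  then have "(\<Sum>j=1..n. of_real (l j) * (z(n := -1)) j) = - of_real (l n) + (\<Sum>j=1..n-1. of_real (l j) * (z(n := -1)) j)"
    using n3 by simp
  also have "(\<Sum>j=1..n-1. of_real (l j) * (z(n := -1)) j) = (\<Sum>j=1..n-1. of_real (l j) * z j)"
    using n3 by (intro sum.cong) auto
  finally show "(\<Sum>j=1..n. of_real (l j) * (z(n := -1)) j) = 0" by (simp only: polygon_sum[OF assms] add.left_inverse)
qed

lemma single_edge_short:
  assumes "z \<in> M" "i \<in> {1..n}" shows "\<not> long {i}"
proof -
  let ?u = "z(n := -1)"
  note u = extended_polygon[OF assms(1)]
  have "(\<Sum>j\<in>{1..n}. of_real (l j) * ?u j) = of_real (l i) * ?u i + (\<Sum>j\<in>{1..n} - {i}. of_real (l j) * ?u j)"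
    by (rule sum.remove) (use assms(2) in auto)
  then have "of_real (l i) * ?u i = - (\<Sum>j\<in>{1..n} - {i}. of_real (l j) * ?u j)"
    using u(2) by (simp only: eq_neg_iff_add_eq_0)
  then have "norm (of_real (l i) * ?u i) = norm (\<Sum>j\<in>{1..n} - {i}. of_real (l j) * ?u j)" by (simp only: norm_minus_cancel)
  also have "\<dots> \<le> (\<Sum>j\<in>{1..n} - {i}. l j)"
  proof (rule sum_norm_le)
    fix j assume j: "j \<in> {1..n} - {i}"
    have "norm (of_real (l j) * ?u j) = l j"
      using u(1)[of j] j length_pos[of j] by (simp add: norm_mult del: fun_upd_apply)
    then show "norm (of_real (l j) * ?u j) \<le> l j" by simp
  qed
  also have "norm (of_real (l i) * ?u i) = l i"
    using u(1)[OF assms(2)] length_pos[OF assms(2)] by (simp add: norm_mult del: fun_upd_apply)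
  finally show ?thesis by (simp add: long_def)
qed

definition three_long_edges :: "nat \<Rightarrow> nat \<Rightarrow> nat \<Rightarrow> bool" where
  "three_long_edges i j k \<longleftrightarrow> i \<in> {1..n} \<and> j \<in> {1..n} \<and> k \<in> {1..n} \<and> i \<noteq> j \<and> i \<noteq> k \<and> j \<noteq> k \<and>
     long {i, j} \<and> long {i, k} \<and> long {j, k}"

definition foldable :: "nat set \<Rightarrow> nat \<Rightarrow> nat \<Rightarrow> nat \<Rightarrow> bool" where
  "foldable A x y w \<longleftrightarrow> A \<subseteq> {1..n} \<and> long A \<and> (\<forall>C. C \<subset> A \<longrightarrow> \<not> long C) \<and>
     x \<in> A \<and> y \<in> A \<and> w \<in> A \<and> x \<noteq> y \<and> x \<noteq> w \<and> y \<noteq> w"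

lemma minimal_long_subset:
  assumes "long A" "A \<subseteq> {1..n}"
  shows "\<exists>B\<subseteq>A. long B \<and> (\<forall>C. C \<subset> B \<longrightarrow> \<not> long C)"
  using finite_subset[OF assms(2) finite_atLeastAtMost] assms
proof (induction A rule: finite_psubset_induct)
  case (psubset A)
  show ?case
  proof (cases "\<exists>C. C \<subset> A \<and> long C")
    case True
    then obtain C where C: "C \<subset> A" "long C" by blast
    then obtain B where "B \<subseteq> C" "long B" "\<forall>C. C \<subset> B \<longrightarrow> \<not> long C"
      using psubset.IH[of C] psubset.prems by blast
    then show ?thesis using C(1) by blast
  next
    case False
    then show ?thesis using psubset.prems by blast
  qed
qed

text \<open>
  If no minimal long set has three elements then every long set contains a long pair of edges.
  Long sets meet, and the complement of a single edge is long; so the long pairs form a triangle.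
\<close>

lemma three_long_edges_or_minimal_long:
  assumes z: "z \<in> M"
  shows "(\<exists>i j k. three_long_edges i j k) \<or>
    (\<exists>A x y w. foldable A x y w)"
proof (rule ccontr)
  assume no: "\<not> ?thesis"
  have pair: "\<exists>i j. i \<in> A \<and> j \<in> A \<and> i \<noteq> j \<and> long {i, j}" if A: "long A" "A \<subseteq> {1..n}" for A
  proof -
    obtain B where B: "B \<subseteq> A" "long B" "\<forall>C. C \<subset> B \<longrightarrow> \<not> long C" using minimal_long_subset[OF A] by blast
    have "B \<noteq> {}"
    proof
      assume "B = {}"
      moreover have "sum l {1..n} \<ge> 0" using length_pos by (intro sum_nonneg) (auto intro: less_imp_le)
      ultimately show False using B(2) by (simp add: long_def)
    qed
    then obtain i where i: "i \<in> B" by blast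
    have "B \<noteq> {i}" using B(2) single_edge_short[OF z, of i] i B(1) A(2) by blast
    then obtain j where j: "j \<in> B" "j \<noteq> i" using i by blast
    have "B = {i, j}"
    proof (rule ccontr)
      assume "B \<noteq> {i, j}"
      then obtain w where "w \<in> B" "w \<noteq> i" "w \<noteq> j" using i j by blast
      then have "foldable B i j w" unfolding foldable_def using B A(2) i j by (intro conjI) blast+
      then show False using no by blast
    qed
    then show ?thesis using B(1,2) i j by blast
  qed
  have compl: "long ({1..n} - {i})" if "i \<in> {1..n}" for i
    using single_edge_short[OF z that] long_iff_not_long_compl[of "{i}"] that by blast
  have "long {1..n}" using long_mono[OF compl[of n]] n3 by simp
  then obtain i j where ij: "i \<in> {1..n}" "j \<in> {1..n}" "i \<noteq> j" "long {i, j}" using pair by blast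
  obtain a b where ab: "a \<in> {1..n} - {j}" "b \<in> {1..n} - {j}" "a \<noteq> b" "long {a, b}" using pair[OF compl[OF ij(2)]] by blast
  have "{i, j} \<inter> {a, b} \<noteq> {}" using long_sets_meet[OF ij(4) ab(4)] ij ab by blast
  then have i: "i = a \<or> i = b" using ab(1,2) by blast
  have "\<exists>k. k \<in> {1..n} \<and> k \<noteq> i \<and> k \<noteq> j \<and> long {i, k}"
  proof (cases "i = a")
    case True
    then show ?thesis using ab by (intro exI[of _ b]) simp
  next
    case False
    then have "i = b" using i by simp
    then show ?thesis using ab by (intro exI[of _ a]) (simp add: insert_commute)
  qed
  then obtain k where k: "k \<in> {1..n}" "k \<noteq> i" "k \<noteq> j" "long {i, k}" by blast
  obtain c e where ce: "c \<in> {1..n} - {i}" "e \<in> {1..n} - {i}" "c \<noteq> e" "long {c, e}" using pair[OF compl[OF ij(1)]] by blast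
  have "{i, j} \<inter> {c, e} \<noteq> {}" "{i, k} \<inter> {c, e} \<noteq> {}"
    using long_sets_meet[OF ij(4) ce(4)] long_sets_meet[OF k(4) ce(4)] ij ce k(1) by blast+
  then have "j \<in> {c, e}" "k \<in> {c, e}" using ce(1,2) by blast+
  then have "{c, e} = {j, k}" using k(3) by blast
  then have "three_long_edges i j k" using ij k ce(4) by (simp add: three_long_edges_def)
  then show False using no by blast
qed

section \<open>Folding a quadrilateral over\<close>

text \<open>
  With edges of a minimal long set grouped into three rigid bars, and the other edges into a fourth,
  longest one, the linkage is a quadrilateral \<open>p, q, r, s\<close>. Turning the bar \<open>q\<close> from one of the two
  positions in which \<open>r\<close> and \<open>s\<close> are stretched to the other one moves a polygon to its mirror image.
\<close>

lemma connected_to_conjugate: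
  assumes fold: "foldable A x y w"
  shows "\<exists>C z. connected C \<and> C \<subseteq> M \<and> z \<in> C \<and> cj z \<in> C"
proof -
  have A: "A \<subseteq> {1..n}" "long A" "\<forall>C. C \<subset> A \<longrightarrow> \<not> long C"
    and xyw: "{x, y, w} \<subseteq> A" "x \<noteq> y" "x \<noteq> w" "y \<noteq> w"
    using fold by (simp_all add: foldable_def)
  define P where "P = {1..n} - A"
  define X where "X = A - {x, y}"
  have fin: "finite A" "finite P" "finite X" using finite_subset[OF A(1)] by (auto simp: P_def X_def)
  define p where "p = sum l P"
  define s where "s = sum l X"
  let ?q = "l x" and ?r = "l y"
  have lpos: "l i > 0" if "i \<in> A" for i using A(1) that length_pos by blast
  have q: "?q > 0" and r: "?r > 0" using lpos xyw(1) by auto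
  have s: "s > 0" unfolding s_def
    by (rule sum_pos) (use fin lpos xyw in \<open>auto simp: X_def\<close>)
  have sumA: "sum l A = ?q + ?r + s"
  proof -
    have "sum l A = ?q + sum l (A - {x})" by (rule sum.remove) (use fin xyw in auto)
    also have "sum l (A - {x}) = ?r + sum l (A - {x} - {y})" by (rule sum.remove) (use fin xyw in auto)
    also have "A - {x} - {y} = X" by (auto simp: X_def)
    finally show ?thesis by (simp add: s_def)
  qed
  have short: "sum l A - sum l B < p + sum l B" if B: "B \<subseteq> A" "B \<noteq> {}" for B
  proof -
    have AB: "A - B \<subseteq> {1..n}" using A(1) by blast
    have "A - B \<subset> A" using B by blast
    then have "\<not> long (A - B)" using A(3) by blast
    then have "long ({1..n} - (A - B))" using long_iff_not_long_compl[OF AB] by blast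
    moreover have "{1..n} - ({1..n} - (A - B)) = A - B" "{1..n} - (A - B) = P \<union> B" using A(1) B(1) by (auto simp: P_def)
    ultimately have "sum l (A - B) < sum l (P \<union> B)" by (simp add: long_def)
    moreover have "sum l (A - B) = sum l A - sum l B" using fin(1) B(1) by (rule sum_diff)
    moreover have "sum l (P \<union> B) = p + sum l B"
      unfolding p_def using fin finite_subset[OF B(1)] B(1) by (intro sum.union_disjoint) (auto simp: P_def)
    ultimately show ?thesis by simp
  qed
  have ineq: "p < ?q + ?r + s" "?r + s < p + ?q" "?q + s < p + ?r" "?q + ?r < p + s"
  proof -
    show "p < ?q + ?r + s" using A(2) sumA by (simp add: long_def p_def P_def)
    show "?r + s < p + ?q" using short[of "{x}"] xyw(1) sumA by simp
    show "?q + s < p + ?r" using short[of "{y}"] xyw(1) sumA by simp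
    have "X \<noteq> {}" using xyw by (auto simp: X_def)
    then have "sum l A - sum l X < p + sum l X" by (intro short) (auto simp: X_def)
    then show "?q + ?r < p + s" using sumA unfolding s_def[symmetric] by simp
  qed
  then have p: "p > 0" using s q r by linarith
  have pq: "p - ?q > \<bar>?r - s\<bar>" using ineq by linarith
  define c0 where "c0 = (p\<^sup>2 + ?q\<^sup>2 - (?r + s)\<^sup>2) / (2 * p * ?q)"
  have "(p - ?q)\<^sup>2 < (?r + s)\<^sup>2" "(?r + s)\<^sup>2 < (p + ?q)\<^sup>2"
    using pq ineq r s p q by (auto intro!: power_strict_mono)
  then have c0: "-1 < c0" "c0 < 1" using p q by (simp_all add: c0_def field_simps power2_eq_square)
  define \<theta>0 where "\<theta>0 = arccos c0"
  have \<theta>0: "0 \<le> \<theta>0" "\<theta>0 \<le> pi" "cos \<theta>0 = c0" using c0 by (simp_all add: \<theta>0_def arccos_lbound arccos_ubound)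
  define D where "D t = of_real p - of_real ?q * cis t" for t
  have D2: "Re (D t) * Re (D t) + Im (D t) * Im (D t) = p\<^sup>2 + ?q\<^sup>2 - 2 * p * ?q * cos t" for t
  proof -
    have "a * (c * c) + a * (s' * s') = a * (c * c + s' * s')" for a c s' :: real by (rule distrib_left[symmetric])
    then have sc: "?q\<^sup>2 * (cos t * cos t) + ?q\<^sup>2 * (sin t * sin t) = ?q\<^sup>2" by (simp only: sin_cos_squared_add3 mult_1_right)
    have D: "Re (D t) = p - ?q * cos t" "Im (D t) = - (?q * sin t)" by (simp_all add: D_def)
    show ?thesis unfolding D using sc by (simp add: power2_eq_square algebra_simps)
  qed
  have nD: "(norm (D t))\<^sup>2 = p\<^sup>2 + ?q\<^sup>2 - 2 * p * ?q * cos t" for t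
    using D2[of t] cmod_power2[of "D t"] by (simp add: power2_eq_square)
  have lower: "p - ?q \<le> norm (D t)" for t
  proof (rule power2_le_imp_le)
    have "2 * p * ?q * cos t \<le> 2 * p * ?q * 1" using p q by (intro mult_left_mono) auto
    then show "(p - ?q)\<^sup>2 \<le> (norm (D t))\<^sup>2" unfolding nD by (simp add: power2_diff)
  qed simp
  have D0: "D t \<noteq> 0" for t using lower[of t] pq by auto
  have c0q: "2 * p * ?q * c0 = p\<^sup>2 + ?q\<^sup>2 - (?r + s)\<^sup>2" using p q by (simp add: c0_def)
  have upper: "norm (D t) \<le> ?r + s" if "\<bar>t\<bar> \<le> \<theta>0" for t
  proof (rule power2_le_imp_le)
    have "cos \<theta>0 \<le> cos \<bar>t\<bar>" using that \<theta>0 by (intro cos_monotone_0_pi_le) auto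
    then have "c0 \<le> cos t" using \<theta>0 by simp
    then have "2 * p * ?q * c0 \<le> 2 * p * ?q * cos t" using p q by (intro mult_left_mono) auto
    then show "(norm (D t))\<^sup>2 \<le> (?r + s)\<^sup>2" unfolding nD c0q by simp
  qed (use r s in simp)
  define v where "v t = apex 1 ?r s (D t)" for t
  have v: "norm (v t) = 1" "norm (D t - of_real ?r * v t) = s" if "\<bar>t\<bar> \<le> \<theta>0" for t
    unfolding v_def
    by (rule apex_norms[OF r s D0 _ triangle_discriminant[OF r s D0]];
        use pq lower[of t] upper[OF that] in linarith)+
  define u where "u t = (\<lambda>j. if j \<in> P then -1 else if j = x then cis t else if j = y then v t
      else of_real (inverse s) * (D t - of_real ?r * v t))" for t
  have u_norm: "norm (u t j) = 1" if "\<bar>t\<bar> \<le> \<theta>0" for t j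
    using v[OF that] s by (simp add: u_def norm_mult norm_inverse)
  have u_sum: "(\<Sum>j=1..n. of_real (l j) * u t j) = 0" for t
  proof -
    have "(\<Sum>j\<in>{1..n}. of_real (l j) * u t j) = (\<Sum>j\<in>P. of_real (l j) * u t j) + (\<Sum>j\<in>A. of_real (l j) * u t j)"
      unfolding P_def by (rule sum.subset_diff) (use A(1) in auto)
    also have "(\<Sum>j\<in>P. of_real (l j) * u t j) = - of_real p"
      by (simp add: u_def p_def sum_negf)
    also have "(\<Sum>j\<in>A. of_real (l j) * u t j) = of_real ?q * u t x + (\<Sum>j\<in>A - {x}. of_real (l j) * u t j)"
      by (rule sum.remove) (use fin xyw in auto)
    also have "(\<Sum>j\<in>A - {x}. of_real (l j) * u t j) = of_real ?r * u t y + (\<Sum>j\<in>A - {x} - {y}. of_real (l j) * u t j)"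
      by (rule sum.remove) (use fin xyw in auto)
    also have "A - {x} - {y} = X" by (auto simp: X_def)
    also have "(\<Sum>j\<in>X. of_real (l j) * u t j) = (\<Sum>j\<in>X. of_real (l j) * (of_real (inverse s) * (D t - of_real ?r * v t)))"
      by (intro sum.cong) (auto simp: u_def X_def P_def)
    also have "\<dots> = of_real s * (of_real (inverse s) * (D t - of_real ?r * v t))"
      unfolding s_def of_real_sum sum_distrib_right ..
    also have "\<dots> = D t - of_real ?r * v t"
      using s by (simp add: mult.assoc[symmetric] of_real_mult[symmetric] del: of_real_mult)
    also have "u t x = cis t" using xyw by (auto simp: u_def P_def)
    also have "u t y = v t" using xyw by (auto simp: u_def P_def)
    finally show ?thesis by (simp add: D_def)
  qed
  define I where "I = {- \<theta>0..\<theta>0}"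
  have I: "\<bar>t\<bar> \<le> \<theta>0" if "t \<in> I" for t using that by (auto simp: I_def)
  define \<gamma> where "\<gamma> t = fix_last n (u t)" for t
  have \<gamma>M: "\<gamma> t \<in> M" if "t \<in> I" for t
    unfolding \<gamma>_def by (rule fix_last_in_polygon_set[OF u_norm[OF I[OF that]] u_sum])
  have contD: "continuous_on I D" unfolding D_def by (intro continuous_intros)
  have nz: "Re (D t) * Re (D t) + Im (D t) * Im (D t) \<noteq> 0" for t
    using D0[of t] by (simp add: complex_eq_iff)
  then have nz': "2 * ?r * (Re (D t) * Re (D t) + Im (D t) * Im (D t)) \<noteq> 0" for t
    using r by (simp only: mult_eq_0_iff) simp
  have contv: "continuous_on I v"
    unfolding v_def apex_def Let_def by (intro continuous_intros contD ballI nz nz')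
  have contu: "continuous_on I (\<lambda>t. u t j)" for j
    unfolding u_def
    by (cases "j \<in> P"; cases "j = x"; cases "j = y") (auto intro!: continuous_intros contD contv)
  have "continuous_on I \<gamma>"
  proof (rule continuous_on_coordinatewise_then_product)
    fix j
    show "continuous_on I (\<lambda>t. \<gamma> t j)"
      unfolding \<gamma>_def fix_last_def
      by (cases "j \<in> {1..n-1}") (auto intro!: continuous_intros contu)
  qed
  then have conn: "connected (\<gamma> ` I)" by (rule connected_continuous_image) (simp add: I_def)
  have "\<gamma> (- \<theta>0) = cj (\<gamma> \<theta>0)"
  proof -
    have D': "D (- \<theta>0) = cnj (D \<theta>0)" by (simp add: D_def cis_cnj)
    define R where "R = (?r + s)\<^sup>2"
    have R: "Re (D \<theta>0) * Re (D \<theta>0) + Im (D \<theta>0) * Im (D \<theta>0) = R" unfolding D2 \<theta>0 c0q R_def by simp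
    have R0: "R > 0" using r s by (simp add: R_def)
    define B where "B = (R + (?r * ?r - s * s)) * inverse (2 * ?r * R)"
    have "B = inverse (?r + s)"
    proof -
      have "R + (?r * ?r - s * s) = 2 * ?r * (?r + s)" by (simp add: R_def power2_eq_square algebra_simps)
      moreover have "(2 * a * t) * inverse (2 * a * t\<^sup>2) = inverse t" if "a > 0" "t > 0" for a t :: real
        using that by (simp add: power2_eq_square field_simps)
      ultimately show ?thesis using r s by (simp only: B_def R_def add_pos_pos)
    qed
    then have "inverse R - B * B = 0" by (simp add: R_def power2_eq_square)
    then have "v \<theta>0 = D \<theta>0 * of_real B" "v (- \<theta>0) = cnj (D \<theta>0) * of_real B"
      unfolding v_def apex_def Let_def D' R complex_cnj minus_mult_minus cnj.sel B_def[symmetric] by simp_all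
    then have v': "v (- \<theta>0) = cnj (v \<theta>0)" by simp
    have "u (- \<theta>0) j = cnj (u \<theta>0 j)" for j by (simp add: u_def D' v' cis_cnj)
    then show ?thesis
      unfolding \<gamma>_def fix_last_def conjugation_def by (auto simp: fun_eq_iff)
  qed
  moreover have "\<theta>0 \<in> I" "- \<theta>0 \<in> I" using \<theta>0(1) by (auto simp: I_def)
  ultimately have "\<gamma> \<theta>0 \<in> \<gamma> ` I" "cj (\<gamma> \<theta>0) \<in> \<gamma> ` I" by (blast, metis imageI)
  then show ?thesis using conn \<gamma>M by blast
qed

end

section \<open>Three long edges\<close>

text \<open>
  When any two of the edges \<open>i\<close>, \<open>j\<close>, \<open>k\<close> are long, the directions of all other edges can be prescribed
  relative to that of \<open>k\<close>, and the edges \<open>i\<close> and \<open>j\<close> close the polygon up in two ways, which are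
  distinguished by the sense in which \<open>j\<close> turns relative to \<open>i\<close> and exchanged by conjugation.
\<close>

locale torus_polygons = polygons +
  fixes i j k :: nat and e :: "nat \<Rightarrow> nat"
  assumes three_long: "three_long_edges i j k" and e: "bij_betw e {1..n-3} ({1..n} - {i, j, k})"
begin

definition "R = {1..n} - {i, j, k}"
definition "e' = the_inv_into {1..n-3} e"

lemma idx: "i \<in> {1..n}" "j \<in> {1..n}" "k \<in> {1..n}" "i \<noteq> j" "i \<noteq> k" "j \<noteq> k"
  using three_long by (simp_all add: three_long_edges_def)

lemma e'R: "m \<in> R \<Longrightarrow> e' m \<in> {1..n-3}" "m \<in> R \<Longrightarrow> e (e' m) = m"
  using bij_betw_apply[OF bij_betw_the_inv_into[OF e]] f_the_inv_into_f_bij_betw[OF e]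
  by (auto simp: e'_def R_def)

lemma eR: "m \<in> {1..n-3} \<Longrightarrow> e m \<in> R" "m \<in> {1..n-3} \<Longrightarrow> e' (e m) = m"
  using bij_betw_apply[OF e] the_inv_into_f_f[of e "{1..n-3}" m] e
  by (auto simp: e'_def R_def bij_betw_def)

lemma sum_split:
  fixes f :: "nat \<Rightarrow> 'b::comm_monoid_add"
  shows "(\<Sum>m=1..n. f m) = f i + (f j + (f k + (\<Sum>m\<in>R. f m)))"
proof -
  have eq: "{1..n} = insert i (insert j (insert k R))" using idx by (auto simp: R_def)
  have "i \<notin> insert j (insert k R)" "j \<notin> insert k R" "k \<notin> R" "finite R" using idx by (auto simp: R_def)
  then show ?thesis unfolding eq by simp
qed

text \<open>
  The three inequalities say precisely that, whatever the directions of the other edges, the chord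
  left for the edges \<open>i\<close> and \<open>j\<close> closes to a nondegenerate triangle.
\<close>

lemma base_bounds:
  fixes a :: "nat \<Rightarrow> complex"
  assumes "norm b = 1" "\<And>m. m \<in> R \<Longrightarrow> norm (a m) = 1"
  defines "D \<equiv> of_real (l k) * b + (\<Sum>m\<in>R. of_real (l m) * a m)"
  shows "\<bar>l i - l j\<bar> < norm D" "norm D < l i + l j"
proof -
  have R: "finite R" "{1..n} - {i, j} = insert k R" "{1..n} - {i, k} = insert j R" "{1..n} - {j, k} = insert i R"
    "i \<notin> R" "j \<notin> R" "k \<notin> R"
    using idx by (auto simp: R_def)
  have long: "long {i, j}" "long {i, k}" "long {j, k}" using three_long by (simp_all add: three_long_edges_def)
  have ineq: "l k + sum l R < l i + l j" "l j + sum l R < l i + l k" "l i + sum l R < l j + l k"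
    using long R idx unfolding long_def by simp_all
  let ?s = "\<Sum>m\<in>R. of_real (l m) * a m"
  have s: "norm ?s \<le> sum l R"
  proof (rule sum_norm_le)
    fix m assume m: "m \<in> R"
    then have "m \<in> {1..n}" by (simp add: R_def)
    then show "norm (of_real (l m) * a m) \<le> l m" using assms(2)[OF m] length_pos[of m] by (simp add: norm_mult)
  qed
  have b: "norm (of_real (l k) * b) = l k" using assms(1) length_pos[OF idx(3)] by (simp add: norm_mult)
  show "norm D < l i + l j"
    using norm_triangle_ineq[of "of_real (l k) * b" ?s] s b ineq unfolding D_def by linarith
  show "\<bar>l i - l j\<bar> < norm D"
    using norm_diff_ineq[of "of_real (l k) * b" ?s] s b ineq unfolding D_def by linarith
qed

definition turn :: "(nat \<Rightarrow> complex) \<Rightarrow> real" where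
  "turn u = Im (cnj (u i) * u j)"

abbreviation ext :: "(nat \<Rightarrow> complex) \<Rightarrow> nat \<Rightarrow> complex" where
  "ext z \<equiv> z(n := -1)"

text \<open>
  If the edges \<open>i\<close> and \<open>j\<close> were parallel, the length of their sum would be the sum or the difference of
  their lengths.
\<close>

lemma turn_nonzero:
  assumes z: "z \<in> M" shows "turn (ext z) \<noteq> 0"
proof
  assume 0: "turn (ext z) = 0"
  let ?u = "ext z"
  note u = extended_polygon[OF z]
  let ?D = "of_real (l k) * ?u k + (\<Sum>m\<in>R. of_real (l m) * ?u m)"
  have bounds: "\<bar>l i - l j\<bar> < norm ?D" "norm ?D < l i + l j"
    using base_bounds[of "?u k" ?u] u(1) idx(3) by (auto simp: R_def)
  let ?E = "of_real (l i) * ?u i + of_real (l j) * ?u j"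
  have "?E + ?D = 0" using u(2) unfolding sum_split by (simp only: add.assoc)
  then have "?D = - ?E" by (rule add_eq_0_iff[THEN iffD1])
  then have nE: "norm ?D = norm ?E" by (simp only: norm_minus_cancel)
  define c where "c = cnj (?u i) * ?u j"
  have ui: "norm (?u i) = 1" "norm (?u j) = 1" using u(1) idx by blast+
  have "norm c = 1" using ui by (simp only: c_def norm_mult complex_mod_cnj mult_1)
  moreover have "Im c = 0" using 0 by (simp only: turn_def c_def)
  ultimately have "Re c = 1 \<or> Re c = -1" using cmod_power2[of c] by (simp add: power2_eq_1_iff)
  have "?u i * c = (cnj (?u i) * ?u i) * ?u j" by (simp only: c_def mult_ac)
  then have uj: "?u j = ?u i * c" by (simp only: cnj_mult_unit[OF ui(1)] mult_1_left)
  have "c = of_real (Re c)" using \<open>Im c = 0\<close> by (simp add: complex_eq_iff)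
  then have "?E = of_real (l i) * ?u i + of_real (l j) * (?u i * of_real (Re c))" using uj by (simp only:)
  moreover have "of_real p * a + of_real q * (a * of_real r) = a * of_real (p + q * r)" for p q r and a :: complex
    by (simp add: algebra_simps)
  ultimately have "?E = ?u i * of_real (l i + l j * Re c)" by (simp only:)
  then have "norm ?E = \<bar>l i + l j * Re c\<bar>" by (simp only: norm_mult ui(1) norm_of_real mult_1_left)
  then show False using bounds \<open>Re c = 1 \<or> Re c = -1\<close> unfolding nE by auto
qed

lemma turn_conjugation: "turn (ext (cj z)) = - turn (ext z)"
proof -
  have "ext (cj z) m = cnj (ext z m)" if "m \<in> {1..n}" for m
    using conjugation_apply(1)[of m z] that by (cases "m = n") auto
  then have "turn (ext (cj z)) = Im (cnj (cnj (ext z i)) * cnj (ext z j))"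
    using idx unfolding turn_def by simp
  also have "\<dots> = - turn (ext z)" unfolding turn_def complex_cnj_mult[symmetric] cnj.sel by simp
  finally show ?thesis .
qed

text \<open>
  The polygon is turned so that the edge \<open>k\<close> points in the direction 1; the directions of the free edges
  are then the coordinates on the torus. The last edge of a polygon has direction \<open>-1\<close>, which \<open>ext\<close>
  restores as an additional entry.
\<close>

definition to_torus :: "(nat \<Rightarrow> complex) \<Rightarrow> nat \<Rightarrow> complex" where
  "to_torus z = (\<lambda>m\<in>{1..n-3}. ext z (e m) * cnj (ext z k))"

definition base :: "(nat \<Rightarrow> complex) \<Rightarrow> complex" where
  "base w = - (of_real (l k) + (\<Sum>m\<in>R. of_real (l m) * w (e' m)))"

definition config :: "(nat \<Rightarrow> complex) \<Rightarrow> nat \<Rightarrow> complex" where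
  "config w m = (if m = k then 1 else if m = i then apex (-1) (l i) (l j) (base w)
     else if m = j then of_real (inverse (l j)) * (base w - of_real (l i) * apex (-1) (l i) (l j) (base w))
     else w (e' m))"

definition of_torus :: "(nat \<Rightarrow> complex) \<Rightarrow> nat \<Rightarrow> complex" where
  "of_torus w = fix_last n (config w)"

lemma li: "l i > 0" and lj: "l j > 0" using length_pos idx by blast+

lemma base_triangle:
  assumes "w \<in> torus_set (n - 3)" shows "triangle_condition (l i) (l j) (base w)"
proof -
  have "norm (w (e' m)) = 1" if "m \<in> R" for m using torus_setD(1)[OF assms e'R(1)[OF that]] .
  then show ?thesis
    using base_bounds[of 1 "\<lambda>m. w (e' m)"] triangle_conditionI[OF li lj, of "base w"]
    unfolding base_def norm_minus_cancel by simp
qed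

lemma config_props:
  assumes w: "w \<in> torus_set (n - 3)"
  shows "m \<in> {1..n} \<Longrightarrow> norm (config w m) = 1" "(\<Sum>m=1..n. of_real (l m) * config w m) = 0" "turn (config w) > 0"
proof -
  note ap = apex_props[OF li lj base_triangle[OF w], of "-1"]
  let ?a = "apex (-1) (l i) (l j) (base w)"
  have c: "config w k = 1" "config w i = ?a" "config w j = of_real (inverse (l j)) * (base w - of_real (l i) * ?a)"
    "\<And>m. m \<in> R \<Longrightarrow> config w m = w (e' m)"
    using idx by (auto simp: config_def R_def)
  show "norm (config w m) = 1" if m: "m \<in> {1..n}"
  proof -
    consider "m = k" | "m = i" | "m = j" | "m \<in> R" unfolding R_def using m by blast
    then show ?thesis
    proof cases
      case 3
      then show ?thesis using ap(2) lj by (simp add: c norm_mult norm_inverse)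
    next
      case 4
      then show ?thesis using torus_setD(1)[OF w e'R(1)[OF 4]] by (simp add: c)
    qed (use ap(1) in \<open>simp_all add: c\<close>)
  qed
  have "of_real (l j) * config w j = base w - of_real (l i) * ?a"
    using lj by (simp add: c mult.assoc[symmetric] of_real_mult[symmetric] del: of_real_mult)
  moreover have "(\<Sum>m\<in>R. of_real (l m) * config w m) = - base w - of_real (l k)"
    by (simp add: base_def c)
  ultimately show "(\<Sum>m=1..n. of_real (l m) * config w m) = 0"
    unfolding sum_split by (simp add: c(1,2))
  have "cnj ?a * config w j = of_real (inverse (l j)) * (cnj ?a * base w - of_real (l i) * (cnj ?a * ?a))"
    by (simp add: c(3) algebra_simps)
  also have "cnj ?a * ?a = 1" by (rule cnj_mult_unit) (use ap(1) in simp)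
  finally have "turn (config w) = inverse (l j) * Im (cnj ?a * base w)"
    unfolding turn_def c(2) by (simp only: Im_affine)
  also have "Im (cnj ?a * base w) = - 1 * Im (cnj (base w) * ?a)" by simp
  also have "inverse (l j) * (- 1 * Im (cnj (base w) * ?a)) > 0"
    by (rule mult_pos_pos) (use lj ap(3) in \<open>simp_all only: positive_imp_inverse_positive simp_thms\<close>)
  finally show "turn (config w) > 0" .
qed

lemma of_torus_in_polygons: "w \<in> torus_set (n - 3) \<Longrightarrow> of_torus w \<in> M"
  unfolding of_torus_def using config_props by (intro fix_last_in_polygon_set) auto

lemma ext_fix_last:
  assumes "norm (u n) = 1" "m \<in> {1..n}"
  shows "ext (fix_last n u) m = - (u m * cnj (u n))"
proof (cases "m = n")
  case True
  then show ?thesis using cnj_mult_unit[OF assms(1)] by (simp add: mult.commute)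
next
  case False
  then have "m \<in> {1..n-1}" using assms(2) by auto
  then show ?thesis using False by (simp add: fix_last_def)
qed

lemma rotate_unit: "norm c = 1 \<Longrightarrow> cnj (a * c) * (b * c) = cnj a * b"
  using cnj_mult_unit[of c] by (simp add: mult_ac)

lemma to_torus_of_torus:
  assumes w: "w \<in> torus_set (n - 3)" shows "to_torus (of_torus w) = w" "turn (ext (of_torus w)) > 0"
proof -
  note c = config_props[OF w]
  have un: "norm (config w n) = 1" by (rule c(1)) (use n3 in simp)
  have ext: "ext (of_torus w) m = config w m * - cnj (config w n)" if "m \<in> {1..n}" for m
    unfolding of_torus_def using ext_fix_last[where u = "config w", OF un that] by simp
  have un': "norm (- cnj (config w n)) = 1" using un by simp
  have "turn (ext (of_torus w)) = turn (config w)"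
    unfolding turn_def ext[OF idx(1)] ext[OF idx(2)] by (simp only: rotate_unit[OF un'])
  then show "turn (ext (of_torus w)) > 0" using c(3) by simp
  show "to_torus (of_torus w) = w"
  proof
    fix m
    show "to_torus (of_torus w) m = w m"
    proof (cases "m \<in> {1..n-3}")
      case True
      then have em: "e m \<in> R" "e m \<in> {1..n}" using eR by (auto simp: R_def)
      have "to_torus (of_torus w) m = cnj (config w k * - cnj (config w n)) * (config w (e m) * - cnj (config w n))"
        using True unfolding to_torus_def by (simp only: restrict_apply if_True ext[OF em(2)] ext[OF idx(3)] mult.commute)
      also have "\<dots> = cnj (config w k) * config w (e m)" by (rule rotate_unit[OF un'])
      also have "\<dots> = w m" using em(1) eR(2)[OF True] by (auto simp: config_def R_def)
      finally show ?thesis .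
    next
      case False
      then show ?thesis using torus_setD(2)[OF w False] unfolding to_torus_def by (simp only: restrict_apply if_False)
    qed
  qed
qed

lemma to_torus_in_torus:
  assumes z: "z \<in> M" shows "to_torus z \<in> torus_set (n - 3)"
  unfolding torus_set_def
proof (rule PiE_I)
  note u = extended_polygon[OF z]
  show "to_torus z m \<in> sphere 0 1" if m: "m \<in> {1..n-3}" for m
  proof -
    have "e m \<in> {1..n}" using eR(1)[OF m] by (simp add: R_def)
    then have "norm (ext z (e m) * cnj (ext z k)) = 1" using u(1) idx(3) by (simp only: norm_mult complex_mod_cnj mult_1)
    then show ?thesis using m by (simp add: to_torus_def del: fun_upd_apply)
  qed
  show "to_torus z m = undefined" if "m \<notin> {1..n-3}" for m
    using that unfolding to_torus_def by (simp only: restrict_apply if_False)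
qed

lemma of_torus_to_torus:
  assumes z: "z \<in> M" and t: "turn (ext z) > 0" shows "of_torus (to_torus z) = z"
proof -
  note u = extended_polygon[OF z]
  let ?c = "cnj (ext z k)"
  have c: "norm ?c = 1" using u(1)[OF idx(3)] by (simp only: complex_mod_cnj)
  define v where "v m = ext z m * ?c" for m
  have v1: "norm (v m) = 1" if "m \<in> {1..n}" for m using u(1)[OF that] c by (simp only: v_def norm_mult mult_1)
  have vk: "v k = 1" using cnj_mult_unit[OF u(1)[OF idx(3)]] by (simp only: v_def mult.commute)
  have "(\<Sum>m=1..n. of_real (l m) * v m) = (\<Sum>m=1..n. of_real (l m) * ext z m) * ?c"
    by (simp only: v_def sum_distrib_right mult.assoc)
  then have vsum: "(\<Sum>m=1..n. of_real (l m) * v m) = 0" by (simp only: u(2) mult_zero_left)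
  have vR: "to_torus z (e' m) = v m" if "m \<in> R" for m
    using e'R[OF that] unfolding to_torus_def v_def by (simp only: restrict_apply if_True)
  have "base (to_torus z) = - (of_real (l k) + (\<Sum>m\<in>R. of_real (l m) * v m))"
    unfolding base_def by (intro arg_cong[where f = uminus] arg_cong2[where f = "(+)"] sum.cong refl) (simp add: vR)
  then have base: "base (to_torus z) = of_real (l i) * v i + of_real (l j) * v j"
  proof -
    let ?S = "\<Sum>m\<in>R. of_real (l m) * v m"
    have "(of_real (l i) * v i + of_real (l j) * v j) + (of_real (l k) + ?S) = 0"
      using vsum unfolding sum_split vk by (simp only: add.assoc mult_1_right)
    then have "of_real (l i) * v i + of_real (l j) * v j = - (of_real (l k) + ?S)"
      by (rule eq_neg_iff_add_eq_0[THEN iffD2])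
    then show ?thesis using \<open>base (to_torus z) = - (of_real (l k) + ?S)\<close> by (simp only:)
  qed
  have "norm (base (to_torus z) - of_real (l i) * v i) = l j"
    using v1[OF idx(2)] lj by (simp add: base norm_mult)
  moreover have "- 1 * Im (cnj (base (to_torus z)) * v i) > 0"
  proof -
    have "cnj (base (to_torus z)) * v i = of_real (l i) * (cnj (v i) * v i) + of_real (l j) * (cnj (v j) * v i)"
      by (simp add: base algebra_simps)
    also have "cnj (v i) * v i = 1" by (rule cnj_mult_unit[OF v1[OF idx(1)]])
    finally have "Im (cnj (base (to_torus z)) * v i) = l j * Im (cnj (v j) * v i)" by (simp only: Im_affine)
    moreover have "cnj (v j) * v i = cnj (ext z j) * ext z i" unfolding v_def by (rule rotate_unit[OF c])
    moreover have "Im (cnj (ext z j) * ext z i) = - turn (ext z)" by (simp add: turn_def)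
    ultimately show ?thesis using t lj by simp
  qed
  ultimately have ap: "apex (-1) (l i) (l j) (base (to_torus z)) = v i"
    by (intro apex_unique(2)[OF li _ v1[OF idx(1)]]) simp_all
  have conf: "config (to_torus z) m = v m" if m: "m \<in> {1..n}" for m
  proof -
    consider "m = k" | "m = i" | "m = j" | "m \<in> R" unfolding R_def using m by blast
    then show ?thesis
    proof cases
      case 3
      have "of_real (inverse (l j)) * (of_real (l j) * v j) = v j"
        using lj by (simp add: mult.assoc[symmetric] of_real_mult[symmetric] del: of_real_mult)
      moreover have "config (to_torus z) j = of_real (inverse (l j)) * (base (to_torus z) - of_real (l i) * v i)"
        using idx by (simp add: config_def ap)
      ultimately show ?thesis unfolding 3 by (simp only: base add_diff_cancel_left')
    next
      case 4
      then have "config (to_torus z) m = to_torus z (e' m)" by (auto simp: config_def R_def)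
      then show ?thesis using vR[OF 4] by simp
    qed (use idx in \<open>simp_all add: config_def ap vk\<close>)
  qed
  show ?thesis
  proof
    fix m
    show "of_torus (to_torus z) m = z m"
    proof (cases "m \<in> {1..n-1}")
      case True
      then have m: "m \<in> {1..n}" "m \<noteq> n" by auto
      have nn: "n \<in> {1..n}" using n3 by simp
      have "of_torus (to_torus z) m = - (v m * cnj (v n))"
        using True unfolding of_torus_def fix_last_def by (simp only: restrict_apply if_True conf[OF m(1)] conf[OF nn])
      also have "\<dots> = - (cnj (v n) * v m)" by (simp only: mult.commute)
      also have "cnj (v n) * v m = cnj (ext z n) * ext z m" unfolding v_def by (rule rotate_unit[OF c])
      finally show ?thesis using m(2) by simp
    next
      case False
      then show ?thesis using polygon_outside[OF z False] unfolding of_torus_def fix_last_def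
        by (simp only: restrict_apply if_False)
    qed
  qed
qed

subsection \<open>Continuity and smoothness\<close>

lemma continuous_on_ext: "continuous_on A (\<lambda>z. ext z m)"
  by (cases "m = n") (auto intro: continuous_on_subset[OF continuous_on_product_coordinates])

lemma continuous_on_turn: "continuous_on A (\<lambda>z. turn (ext z))"
  unfolding turn_def by (intro continuous_intros continuous_on_ext)

lemma continuous_on_to_torus: "continuous_on A to_torus"
proof (rule continuous_on_coordinatewise_then_product)
  fix m
  show "continuous_on A (\<lambda>z. to_torus z m)"
  proof (cases "m \<in> {1..n-3}")
    case True
    show ?thesis unfolding to_torus_def restrict_apply if_P[OF True]
      by (intro continuous_intros continuous_on_ext)
  next
    case False
    show ?thesis unfolding to_torus_def restrict_apply if_not_P[OF False] by simp
  qed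
qed

lemma smooth_map_to_torus:
  assumes P: "openin (Euclidean_space d) P" and h: "smooth_map d P h"
  shows "smooth_map d P (\<lambda>x. to_torus (h x))"
proof -
  have ext: "smooth d P (\<lambda>x. ext (h x) m)" for m
    by (cases "m = n") (simp_all add: smooth_const[OF P] smooth_mapD[OF h])
  show ?thesis
    unfolding smooth_map_def
  proof
    fix m
    show "smooth d P (\<lambda>x. to_torus (h x) m)"
    proof (cases "m \<in> {1..n-3}")
      case True
      show ?thesis unfolding to_torus_def restrict_apply if_P[OF True]
        by (rule smooth_mult[OF P ext smooth_linear[OF bounded_linear_cnj P ext]])
    next
      case False
      show ?thesis unfolding to_torus_def restrict_apply if_not_P[OF False] by (rule smooth_const[OF P])
    qed
  qed
qed

lemma smooth_map_of_torus:
  assumes P: "openin (Euclidean_space d) P" and h: "smooth_map d P h" and T: "\<And>x. x \<in> P \<Longrightarrow> h x \<in> torus_set (n - 3)"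
  shows "smooth_map d P (\<lambda>x. of_torus (h x))"
proof -
  have base: "smooth d P (\<lambda>x. base (h x))"
    unfolding base_def
    by (intro smooth_minus[OF P] smooth_add[OF P] smooth_sum[OF P] smooth_mult[OF P] smooth_const[OF P] smooth_mapD[OF h])
  have ap: "smooth d P (\<lambda>x. apex (-1) (l i) (l j) (base (h x)))"
    by (rule smooth_apex[OF P base li]) (rule base_triangle[OF T])
  have conf: "smooth d P (\<lambda>x. config (h x) m)" for m
  proof -
    consider "m = k" | "m \<noteq> k" "m = i" | "m \<noteq> k" "m \<noteq> i" "m = j" | "m \<noteq> k" "m \<noteq> i" "m \<noteq> j" by blast
    then show ?thesis
    proof cases
      case 3
      then show ?thesis unfolding config_def
        using smooth_mult[OF P smooth_const[OF P] smooth_diff[OF P base smooth_mult[OF P smooth_const[OF P] ap]]] by simp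
    qed (simp_all add: config_def smooth_const[OF P] ap smooth_mapD[OF h])
  qed
  show ?thesis
    unfolding smooth_map_def
  proof
    fix m
    show "smooth d P (\<lambda>x. of_torus (h x) m)"
    proof (cases "m \<in> {1..n-1}")
      case True
      show ?thesis unfolding of_torus_def fix_last_def restrict_apply if_P[OF True]
        by (rule smooth_minus[OF P smooth_mult[OF P conf smooth_linear[OF bounded_linear_cnj P conf]]])
    next
      case False
      show ?thesis unfolding of_torus_def fix_last_def restrict_apply if_not_P[OF False] by (rule smooth_const[OF P])
    qed
  qed
qed

lemma continuous_on_of_torus: "continuous_on (torus_set (n - 3)) of_torus"
proof -
  let ?T = "torus_set (n - 3)"
  have coord: "continuous_on ?T (\<lambda>w. w m)" for m by (rule continuous_on_subset[OF continuous_on_product_coordinates]) simp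
  have base: "continuous_on ?T base" unfolding base_def[abs_def] by (intro continuous_intros coord)
  have pos: "Re (base w) * Re (base w) + Im (base w) * Im (base w) > 0" if "w \<in> ?T" for w
    by (rule triangle_condition_pos(1)[OF li base_triangle[OF that]])
  have nz: "Re (base w) * Re (base w) + Im (base w) * Im (base w) \<noteq> 0"
    "2 * l i * (Re (base w) * Re (base w) + Im (base w) * Im (base w)) \<noteq> 0" if "w \<in> ?T" for w
  proof -
    show "Re (base w) * Re (base w) + Im (base w) * Im (base w) \<noteq> 0" using pos[OF that] by (rule less_imp_neq[symmetric])
    then show "2 * l i * (Re (base w) * Re (base w) + Im (base w) * Im (base w)) \<noteq> 0"
      using li by (simp only: mult_eq_0_iff) simp
  qed
  have ap: "continuous_on ?T (\<lambda>w. apex (-1) (l i) (l j) (base w))"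
    unfolding apex_def Let_def by (intro continuous_intros base ballI nz)
  have conf: "continuous_on ?T (\<lambda>w. config w m)" for m
  proof -
    consider "m = k" | "m \<noteq> k" "m = i" | "m \<noteq> k" "m \<noteq> i" "m = j" | "m \<noteq> k" "m \<noteq> i" "m \<noteq> j" by blast
    then show ?thesis
    proof cases
      case 3
      then show ?thesis unfolding config_def
        using continuous_on_mult[OF continuous_on_const continuous_on_diff[OF base continuous_on_mult[OF continuous_on_const ap]]]
        by simp
    qed (simp_all add: config_def ap coord)
  qed
  show ?thesis
  proof (rule continuous_on_coordinatewise_then_product)
    fix m
    show "continuous_on ?T (\<lambda>w. of_torus w m)"
    proof (cases "m \<in> {1..n-1}")
      case True
      show ?thesis unfolding of_torus_def fix_last_def restrict_apply if_P[OF True] by (intro continuous_intros conf)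
    next
      case False
      show ?thesis unfolding of_torus_def fix_last_def restrict_apply if_not_P[OF False] by simp
    qed
  qed
qed

end

lemma smooth_betweenI:
  assumes "continuous_map (topology_of M) (topology_of N) f"
    and "\<And>c c'. c \<in> charts M \<Longrightarrow> c' \<in> charts N \<Longrightarrow>
      smooth_map (dimension M) (snd c ` (fst c \<inter> f -` fst c')) (snd c' \<circ> f \<circ> inv_into (fst c) (snd c))"
  shows "smooth_between M N f"
proof -
  have "smooth_map (dimension M) (\<phi> ` (U \<inter> f -` V)) (\<psi> \<circ> f \<circ> inv_into U \<phi>)"
    if "(U, \<phi>) \<in> charts M" "(V, \<psi>) \<in> charts N" for U \<phi> V \<psi>
    using assms(2)[OF that] by simp
  then show ?thesis using assms(1) unfolding smooth_between_def by auto
qed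

lemma smooth_betweenD:
  assumes "smooth_between M N f" "c \<in> charts M" "c' \<in> charts N"
  shows "smooth_map (dimension M) (snd c ` (fst c \<inter> f -` fst c')) (snd c' \<circ> f \<circ> inv_into (fst c) (snd c))"
  using assms by (cases c, cases c') (auto simp: smooth_between_def)

subsection \<open>The diffeomorphism with the torus\<close>

context torus_polygons
begin

definition positive :: "(nat \<Rightarrow> complex) \<Rightarrow> nat \<Rightarrow> complex" where
  "positive z = (if turn (ext z) > 0 then z else cj z)"

text \<open>
  A class consists of two conjugate polygons, which turn in opposite senses. The one that turns
  positively represents it.
\<close>

definition class_to_torus :: "(nat \<Rightarrow> complex) set \<Rightarrow> nat \<Rightarrow> complex" where
  "class_to_torus q = to_torus (THE z. z \<in> q \<and> turn (ext z) > 0)"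

lemma positive_props:
  assumes z: "z \<in> M"
  shows "positive z \<in> M" "turn (ext (positive z)) > 0" "cls (positive z) = cls z"
    "class_to_torus (cls z) = to_torus (positive z)"
proof -
  have nz: "turn (ext z) \<noteq> 0" and cjt: "turn (ext (cj z)) = - turn (ext z)"
    using turn_nonzero[OF z] turn_conjugation by blast+
  show "positive z \<in> M" using z conjugation_polygon[OF z] by (simp add: positive_def)
  show pos: "turn (ext (positive z)) > 0"
  proof (cases "turn (ext z) > 0")
    case False
    then show ?thesis unfolding positive_def if_not_P[OF False] cjt using nz by linarith
  qed (simp add: positive_def)
  show "cls (positive z) = cls z" using class_conjugation[OF z] by (simp add: positive_def)
  have "(THE w. w \<in> cls z \<and> turn (ext w) > 0) = positive z"
  proof (rule the_equality)
    show "positive z \<in> cls z \<and> turn (ext (positive z)) > 0"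
      using pos by (auto simp: positive_def isometry_class_def)
    fix w assume w: "w \<in> cls z \<and> turn (ext w) > 0"
    then consider "w = z" | "w = cj z" by (auto simp: isometry_class_def)
    then show "w = positive z"
    proof cases
      case 1
      then show ?thesis using w unfolding positive_def by (simp only: if_True)
    next
      case 2
      then have "\<not> turn (ext z) > 0" using w cjt by simp
      then show ?thesis unfolding positive_def 2 by (simp only: if_False)
    qed
  qed
  then show "class_to_torus (cls z) = to_torus (positive z)" by (simp only: class_to_torus_def)
qed

lemma class_maps_inverse:
  "q \<in> cls ` M \<Longrightarrow> cls (of_torus (class_to_torus q)) = q"
  "w \<in> torus_set (n - 3) \<Longrightarrow> class_to_torus (cls (of_torus w)) = w"
  "q \<in> cls ` M \<Longrightarrow> class_to_torus q \<in> torus_set (n - 3)"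
proof -
  assume "q \<in> cls ` M"
  then obtain z where z: "z \<in> M" "q = cls z" by blast
  note p = positive_props[OF z(1)]
  show "cls (of_torus (class_to_torus q)) = q"
    unfolding z(2) p(4) of_torus_to_torus[OF p(1,2)] by (rule p(3))
  show "class_to_torus q \<in> torus_set (n - 3)" unfolding z(2) p(4) by (rule to_torus_in_torus[OF p(1)])
next
  assume w: "w \<in> torus_set (n - 3)"
  note p = positive_props[OF of_torus_in_polygons[OF w]]
  have "positive (of_torus w) = of_torus w"
    using to_torus_of_torus(2)[OF w] unfolding positive_def by (simp only: if_True)
  then show "class_to_torus (cls (of_torus w)) = w" unfolding p(4) using to_torus_of_torus(1)[OF w] by simp
qed

lemma continuous_map_class_to_torus:
  "continuous_map Q (top_of_set (torus_set (n - 3))) class_to_torus"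
  unfolding continuous_map_def
proof (intro conjI allI impI)
  show "class_to_torus \<in> topspace Q \<rightarrow> topspace (top_of_set (torus_set (n - 3)))"
    using class_maps_inverse(3) by (auto simp: topspace_quotient_topology)
  fix V assume "openin (top_of_set (torus_set (n - 3))) V"
  then obtain T where T: "open T" "V = torus_set (n - 3) \<inter> T" by (auto simp: openin_open)
  let ?W = "{q \<in> topspace Q. class_to_torus q \<in> V}"
  have "open ({z. turn (ext z) > 0} \<inter> to_torus -` T)"
    by (intro open_Int open_Collect_less continuous_on_const continuous_on_turn
        open_vimage[OF T(1)] continuous_on_to_torus)
  moreover have "open ({z. turn (ext z) < 0} \<inter> (\<lambda>z. to_torus (cj z)) -` T)"
    by (intro open_Int open_Collect_less continuous_on_const continuous_on_turn
        open_vimage[OF T(1)] continuous_on_compose2[OF continuous_on_to_torus continuous_on_conjugation subset_UNIV])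
  moreover have "{z \<in> M. cls z \<in> ?W} = M \<inter> (({z. turn (ext z) > 0} \<inter> to_torus -` T) \<union>
      ({z. turn (ext z) < 0} \<inter> (\<lambda>z. to_torus (cj z)) -` T))"
  proof (intro equalityI subsetI)
    fix z assume "z \<in> {z \<in> M. cls z \<in> ?W}"
    then have z: "z \<in> M" "to_torus (positive z) \<in> T" using positive_props(4)[of z] T(2) by auto
    then show "z \<in> M \<inter> (({z. turn (ext z) > 0} \<inter> to_torus -` T) \<union>
      ({z. turn (ext z) < 0} \<inter> (\<lambda>z. to_torus (cj z)) -` T))"
      using turn_nonzero[OF z(1)] unfolding positive_def by (cases "turn (ext z) > 0") (simp_all del: fun_upd_apply)
  next
    fix z assume z: "z \<in> M \<inter> (({z. turn (ext z) > 0} \<inter> to_torus -` T) \<union>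
      ({z. turn (ext z) < 0} \<inter> (\<lambda>z. to_torus (cj z)) -` T))"
    then have zM: "z \<in> M" and "to_torus (positive z) \<in> T" unfolding positive_def by (auto simp del: fun_upd_apply)
    then have "class_to_torus (cls z) \<in> V"
      using to_torus_in_torus[OF positive_props(1)[OF zM]] unfolding positive_props(4)[OF zM] T(2) by blast
    then show "z \<in> {z \<in> M. cls z \<in> ?W}" using zM by (simp add: topspace_quotient_topology)
  qed
  ultimately have "openin (top_of_set M) {z \<in> M. cls z \<in> ?W}" by (simp add: openin_open_Int open_Un)
  then show "openin Q ?W" unfolding openin_Q by (simp add: topspace_quotient_topology)
qed

lemma continuous_map_class_of_torus:
  "continuous_map (top_of_set (torus_set (n - 3))) Q (\<lambda>w. cls (of_torus w))"
  unfolding continuous_map_def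
proof (intro conjI allI impI)
  show "(\<lambda>w. cls (of_torus w)) \<in> topspace (top_of_set (torus_set (n - 3))) \<rightarrow> topspace Q"
    using of_torus_in_polygons by (auto simp: topspace_quotient_topology)
  fix V assume "openin Q V"
  then have V: "openin (top_of_set M) {x \<in> M. cls x \<in> V}" by (simp add: openin_Q)
  have "openin (top_of_set (torus_set (n - 3))) (torus_set (n - 3) \<inter> of_torus -` {x \<in> M. cls x \<in> V})"
    by (rule continuous_openin_preimage[OF continuous_on_of_torus _ V]) (use of_torus_in_polygons in blast)
  moreover have "torus_set (n - 3) \<inter> of_torus -` {x \<in> M. cls x \<in> V} =
      {w \<in> topspace (top_of_set (torus_set (n - 3))). cls (of_torus w) \<in> V}"
    using of_torus_in_polygons by auto
  ultimately show "openin (top_of_set (torus_set (n - 3)))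
      {w \<in> topspace (top_of_set (torus_set (n - 3))). cls (of_torus w) \<in> V}" by simp
qed

lemma smooth_map_to_torus_positive:
  assumes P: "openin (Euclidean_space d) P" and h: "smooth_map d P h" and M: "\<And>x. x \<in> P \<Longrightarrow> h x \<in> M"
  shows "smooth_map d P (\<lambda>x. to_torus (positive (h x)))"
proof (rule smooth_map_local[OF P])
  fix x assume x: "x \<in> P"
  have ct: "continuous_on P (\<lambda>x. turn (ext (h x)))"
    by (rule continuous_on_compose2[OF continuous_on_turn smooth_map_continuous_on[OF h] subset_UNIV])
  have op: "openin (Euclidean_space d) {y \<in> P. turn (ext (h y)) \<in> A}" if "open A" for A
    using openin_Euclidean_preimage[OF P ct, of UNIV A] that by simp
  consider "turn (ext (h x)) > 0" | "turn (ext (h x)) < 0" using turn_nonzero[OF M[OF x]] by linarith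
  then show "\<exists>V. openin (Euclidean_space d) V \<and> x \<in> V \<and> smooth_map d V (\<lambda>x. to_torus (positive (h x)))"
  proof cases
    case 1
    let ?V = "{y \<in> P. turn (ext (h y)) \<in> {0<..}}"
    have V: "openin (Euclidean_space d) ?V" by (rule op) simp
    have hV: "smooth_map d ?V h" using h by (rule smooth_map_subset) blast
    have "smooth_map d ?V (\<lambda>x. to_torus (positive (h x)))"
      by (rule smooth_map_cong[OF V _ smooth_map_to_torus[OF V hV]]) (simp add: positive_def del: fun_upd_apply)
    then show ?thesis using V x 1 by blast
  next
    case 2
    let ?V = "{y \<in> P. turn (ext (h y)) \<in> {..<0}}"
    have V: "openin (Euclidean_space d) ?V" by (rule op) simp
    have hV: "smooth_map d ?V h" using h by (rule smooth_map_subset) blast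
    have "smooth_map d ?V (\<lambda>x. to_torus (positive (h x)))"
      by (rule smooth_map_cong[OF V _ smooth_map_to_torus[OF V smooth_map_conjugation[OF V hV]]])
        (simp add: positive_def del: fun_upd_apply)
    then show ?thesis using V x 2 by blast
  qed
qed

lemma smooth_between_class_to_torus:
  "smooth_between (reduced_polygon_space n l) (torus (n - 3)) class_to_torus"
proof (rule smooth_betweenI)
  let ?T = "torus_set (n - 3)"
  show "continuous_map (topology_of (reduced_polygon_space n l)) (topology_of (torus (n - 3))) class_to_torus"
    using continuous_map_class_to_torus by (simp add: torus_def)
  fix c c' assume "c \<in> charts (reduced_polygon_space n l)" and c': "c' \<in> charts (torus (n - 3))"
  then obtain c0 where c0: "small_chart c0" "c = push_chart n c0" by auto
  have V: "(fst c', snd c') \<in> charts (submanifold (n - 3) ?T)" using c' by (simp add: torus_def)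
  have "is_chart (n - 3) (top_of_set ?T) (fst c', snd c')" by (rule conjunct1[OF V[unfolded submanifold_charts_iff]])
  then have V_open: "openin (top_of_set ?T) (fst c')" by (rule is_chart_open)
  have "(fst c0, snd c0) \<in> pcharts" using small_chartD(1)[OF c0(1)] by (simp only: prod.collapse)
  note f = chart_facts[OF this]
  let ?U = "fst c0" and ?\<phi> = "snd c0" and ?\<xi> = "inv_into (fst c0) (snd c0)"
  define h where "h x = to_torus (positive (?\<xi> x))" for x
  have \<xi>: "?\<xi> (?\<phi> z) = z" if "z \<in> ?U" for z using f(3) that by simp
  have UM: "z \<in> M" if "z \<in> ?U" for z using f(4) that by blast
  have h_smooth: "smooth_map (n - 3) (?\<phi> ` ?U) h"
    unfolding h_def by (rule smooth_map_to_torus_positive[OF f(2,5)]) (use \<xi> UM in auto)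
  have hT: "h x \<in> ?T" if "x \<in> ?\<phi> ` ?U" for x
    using that \<xi> to_torus_in_torus positive_props(1) UM by (auto simp: h_def)
  let ?O = "{x \<in> ?\<phi> ` ?U. h x \<in> fst c'}"
  have O: "openin (Euclidean_space (n - 3)) ?O"
    by (rule openin_Euclidean_preimage[OF f(2) smooth_map_continuous_on[OF h_smooth] V_open]) (use hT in blast)
  have point: "class_to_torus (cls z) = h (?\<phi> z)" "snd c (cls z) = ?\<phi> z" "cls z \<in> fst c"
    "inv_into (fst c) (snd c) (?\<phi> z) = cls z" if z: "z \<in> ?U" for z
  proof -
    show "class_to_torus (cls z) = h (?\<phi> z)" using positive_props(4)[OF UM[OF z]] \<xi>[OF z] by (simp add: h_def)
    show 1: "snd c (cls z) = ?\<phi> z" using small_chartD(7)[OF c0(1) z] by (simp add: c0(2))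
    show 2: "cls z \<in> fst c" using z by (simp add: c0(2) push_chart_def)
    have "inj_on (snd c) (fst c)" using is_chart_inj'[OF push_is_chart[OF c0(1)]] by (simp add: c0(2))
    from inv_into_f_f[OF this 2] show "inv_into (fst c) (snd c) (?\<phi> z) = cls z" by (simp only: 1)
  qed
  have dom: "snd c ` (fst c \<inter> class_to_torus -` fst c') = ?O"
  proof (intro equalityI subsetI)
    fix x assume "x \<in> snd c ` (fst c \<inter> class_to_torus -` fst c')"
    then obtain q where q: "q \<in> fst c" "class_to_torus q \<in> fst c'" "x = snd c q" by blast
    then obtain z where "z \<in> ?U" "q = cls z" by (auto simp: c0(2) push_chart_def)
    then show "x \<in> ?O" using q point[of z] by auto
  next
    fix x assume "x \<in> ?O"
    then obtain z where z: "z \<in> ?U" "x = ?\<phi> z" "h x \<in> fst c'" by blast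
    then have "x = snd c (cls z)" "cls z \<in> fst c \<inter> class_to_torus -` fst c'" using point[OF z(1)] by auto
    then show "x \<in> snd c ` (fst c \<inter> class_to_torus -` fst c')" by blast
  qed
  have "smooth_map (n - 3) ?O h" using h_smooth by (rule smooth_map_subset) blast
  then have "smooth_map (n - 3) ?O (\<lambda>x. snd c' (h x))"
    by (rule smooth_map_chart_comp[OF locally_linear_graph_torus V O]) blast
  then have "smooth_map (n - 3) ?O (snd c' \<circ> class_to_torus \<circ> inv_into (fst c) (snd c))"
    by (rule smooth_map_cong[OF O, rotated]) (use point in auto)
  then show "smooth_map (dimension (reduced_polygon_space n l)) (snd c ` (fst c \<inter> class_to_torus -` fst c'))
      (snd c' \<circ> class_to_torus \<circ> inv_into (fst c) (snd c))"
    unfolding dom by simp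
qed

lemma smooth_between_class_of_torus:
  "smooth_between (torus (n - 3)) (reduced_polygon_space n l) (\<lambda>w. cls (of_torus w))"
proof (rule smooth_betweenI)
  let ?T = "torus_set (n - 3)" and ?g = "\<lambda>w. cls (of_torus w)"
  show "continuous_map (topology_of (torus (n - 3))) (topology_of (reduced_polygon_space n l)) ?g"
    using continuous_map_class_of_torus by (simp add: torus_def)
  fix c' c assume c': "c' \<in> charts (torus (n - 3))" and "c \<in> charts (reduced_polygon_space n l)"
  then obtain c0 where c0: "small_chart c0" "c = push_chart n c0" by auto
  have V: "(fst c', snd c') \<in> charts (submanifold (n - 3) ?T)" using c' by (simp add: torus_def)
  have \<psi>: "is_chart (n - 3) (top_of_set ?T) (fst c', snd c')"
    by (rule conjunct1[OF V[unfolded submanifold_charts_iff]])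
  let ?V = "fst c'" and ?\<psi> = "snd c'" and ?\<eta> = "inv_into (fst c') (snd c')"
  have \<eta>: "?\<eta> (?\<psi> w) = w" if "w \<in> ?V" for w using is_chart_inj[OF \<psi>] that by simp
  have VT: "w \<in> ?T" if "w \<in> ?V" for w using chart_image_subset[OF \<psi>] that by blast
  note P = is_chart_image_open[OF \<psi>]
  have "(fst c0, snd c0) \<in> pcharts" using small_chartD(1)[OF c0(1)] by (simp only: prod.collapse)
  note f = chart_facts[OF this]
  let ?U = "fst c0" and ?\<phi> = "snd c0"
  define h where "h t = of_torus (?\<eta> t)" for t
  have h: "smooth_map (n - 3) (?\<psi> ` ?V) h"
    unfolding h_def by (rule smooth_map_of_torus[OF P submanifold_inverse_smooth[OF V]]) (use \<eta> VT in auto)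
  have hM: "h t \<in> M" if "t \<in> ?\<psi> ` ?V" for t using that \<eta> VT of_torus_in_polygons by (auto simp: h_def)
  have h': "smooth_map (n - 3) (?\<psi> ` ?V) (\<lambda>t. cj (h t))" by (rule smooth_map_conjugation[OF P h])
  let ?F = "snd c \<circ> ?g \<circ> ?\<eta>"
  have F: "?F t = snd c (cls (h t))" for t by (simp add: h_def)
  have piece: "openin (Euclidean_space (n - 3)) {t \<in> ?\<psi> ` ?V. k t \<in> ?U} \<and>
      smooth_map (n - 3) {t \<in> ?\<psi> ` ?V. k t \<in> ?U} ?F"
    if k: "smooth_map (n - 3) (?\<psi> ` ?V) k" "\<And>t. t \<in> ?\<psi> ` ?V \<Longrightarrow> k t \<in> M \<and> cls (k t) = cls (h t)" for k
  proof -
    let ?O = "{t \<in> ?\<psi> ` ?V. k t \<in> ?U}"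
    have O: "openin (Euclidean_space (n - 3)) ?O"
      by (rule openin_Euclidean_preimage[OF P smooth_map_continuous_on[OF k(1)] f(7)]) (use k(2) in blast)
    have "smooth_map (n - 3) ?O k" using k(1) by (rule smooth_map_subset) blast
    then have "smooth_map (n - 3) ?O (\<lambda>t. ?\<phi> (k t))"
      by (rule smooth_map_chart_comp[OF graph _ O, rotated]) (use small_chartD(1)[OF c0(1)] in auto)
    moreover have "?\<phi> (k t) = ?F t" if "t \<in> ?O" for t
    proof -
      have "cls (k t) = cls (h t)" using that k(2) by blast
      then have "?\<phi> (k t) = snd c (cls (h t))" using small_chartD(7)[OF c0(1), of "k t"] that by (simp add: c0(2))
      then show ?thesis unfolding F .
    qed
    ultimately have "smooth_map (n - 3) ?O ?F" by (intro smooth_map_cong[OF O, of "\<lambda>t. ?\<phi> (k t)" ?F])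
    then show ?thesis using O by blast
  qed
  have p1: "openin (Euclidean_space (n - 3)) {t \<in> ?\<psi> ` ?V. h t \<in> ?U} \<and> smooth_map (n - 3) {t \<in> ?\<psi> ` ?V. h t \<in> ?U} ?F"
    by (rule piece[OF h]) (use hM in blast)
  have p2: "openin (Euclidean_space (n - 3)) {t \<in> ?\<psi> ` ?V. cj (h t) \<in> ?U} \<and>
      smooth_map (n - 3) {t \<in> ?\<psi> ` ?V. cj (h t) \<in> ?U} ?F"
    by (rule piece[OF h']) (use hM conjugation_polygon class_conjugation in blast)
  have dom: "?\<psi> ` (?V \<inter> ?g -` fst c) = {t \<in> ?\<psi> ` ?V. h t \<in> ?U} \<union> {t \<in> ?\<psi> ` ?V. cj (h t) \<in> ?U}"
  proof -
    have "cls (of_torus w) \<in> fst c \<longleftrightarrow> of_torus w \<in> ?U \<or> cj (of_torus w) \<in> ?U" if w: "w \<in> ?V" for w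
    proof
      have wM: "of_torus w \<in> M" by (rule of_torus_in_polygons[OF VT[OF w]])
      assume "cls (of_torus w) \<in> fst c"
      then obtain z where z: "z \<in> ?U" "cls (of_torus w) = cls z" by (auto simp: c0(2) push_chart_def)
      have "z = of_torus w \<or> z = cj (of_torus w)" using class_eq_iff[OF wM, of z] z f(4) by blast
      then show "of_torus w \<in> ?U \<or> cj (of_torus w) \<in> ?U" using z(1) by blast
    next
      have wM: "of_torus w \<in> M" by (rule of_torus_in_polygons[OF VT[OF w]])
      assume "of_torus w \<in> ?U \<or> cj (of_torus w) \<in> ?U"
      then have "cls (of_torus w) \<in> cls ` ?U"
        using class_conjugation[OF wM] by (metis imageI)
      then show "cls (of_torus w) \<in> fst c" by (simp add: c0(2) push_chart_def)
    qed
    then show ?thesis using \<eta> by (auto simp: h_def)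
  qed
  have "smooth_map (n - 3) (?\<psi> ` (?V \<inter> ?g -` fst c)) ?F"
  proof (rule smooth_map_local)
    show "openin (Euclidean_space (n - 3)) (?\<psi> ` (?V \<inter> ?g -` fst c))"
      unfolding dom by (rule openin_Un[OF conjunct1[OF p1] conjunct1[OF p2]])
    fix x assume "x \<in> ?\<psi> ` (?V \<inter> ?g -` fst c)"
    then have "x \<in> {t \<in> ?\<psi> ` ?V. h t \<in> ?U} \<or> x \<in> {t \<in> ?\<psi> ` ?V. cj (h t) \<in> ?U}" unfolding dom by (rule UnE) blast+
    then show "\<exists>V. openin (Euclidean_space (n - 3)) V \<and> x \<in> V \<and> smooth_map (n - 3) V ?F"
    proof
      assume "x \<in> {t \<in> ?\<psi> ` ?V. h t \<in> ?U}"
      then show ?thesis by (intro exI[of _ "{t \<in> ?\<psi> ` ?V. h t \<in> ?U}"] conjI conjunct1[OF p1] conjunct2[OF p1])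
    next
      assume "x \<in> {t \<in> ?\<psi> ` ?V. cj (h t) \<in> ?U}"
      then show ?thesis by (intro exI[of _ "{t \<in> ?\<psi> ` ?V. cj (h t) \<in> ?U}"] conjI conjunct1[OF p2] conjunct2[OF p2])
    qed
  qed
  then show "smooth_map (dimension (torus (n - 3))) (?\<psi> ` (?V \<inter> ?g -` fst c)) ?F" by (simp add: torus_def)
qed

lemma diffeomorphic_torus: "diffeomorphic (reduced_polygon_space n l) (torus (n - 3))"
proof -
  have "homeomorphic_maps Q (top_of_set (torus_set (n - 3))) class_to_torus (\<lambda>w. cls (of_torus w))"
    unfolding homeomorphic_maps_def
    using continuous_map_class_to_torus continuous_map_class_of_torus class_maps_inverse
    by (simp add: topspace_quotient_topology)
  then have "homeomorphic_maps (topology_of (reduced_polygon_space n l)) (topology_of (torus (n - 3)))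
      class_to_torus (\<lambda>w. cls (of_torus w))"
    by (simp add: torus_def)
  then show ?thesis
    unfolding diffeomorphic_def using smooth_between_class_to_torus smooth_between_class_of_torus by blast
qed

end

section \<open>Orientability is invariant under diffeomorphisms\<close>

text \<open>
  The charts on which the form is positive suffice, since small charts can be reflected. In dimension
  0 every atlas is oriented, the determinant of the empty matrix being 1.
\<close>

lemma (in framed_submanifold) oriented_subatlas:
  "\<exists>B\<subseteq>charts (submanifold d S). oriented_atlas d (top_of_set S) B"
proof (cases "d = 0")
  case True
  have "oriented_atlas d (top_of_set S) (charts (submanifold d S))"
    unfolding oriented_atlas_def using submanifold_smooth_atlas[OF graph] True by (simp add: jacobian_det_def)
  then show ?thesis by (intro exI[of _ "charts (submanifold d S)"] conjI subset_refl)
next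
  case False
  then have d: "d > 0" by simp
  let ?B = "{(U, \<phi>) \<in> charts (submanifold d S). \<forall>x\<in>\<phi> ` U. form (inv_into U \<phi>) x > 0}"
  have "\<Union> (fst ` ?B) = S"
  proof
    show "\<Union> (fst ` ?B) \<subseteq> S" using chart_facts(4) by fastforce
    show "S \<subseteq> \<Union> (fst ` ?B)"
    proof
      fix z assume "z \<in> S"
      then obtain U \<phi> where "(U, \<phi>) \<in> charts (submanifold d S)" "z \<in> U" "\<forall>x\<in>\<phi> ` U. 1 * form (inv_into U \<phi>) x > 0"
        using chart_with_sign[OF d, of z S 1] by auto
      then show "z \<in> \<Union> (fst ` ?B)" by force
    qed
  qed
  then have "smooth_atlas d (top_of_set S) ?B"
    using submanifold_smooth_atlas[OF graph] unfolding smooth_atlas_def by auto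
  moreover have "jacobian_det d (transition c c') x > 0"
    if "c \<in> ?B" "c' \<in> ?B" "x \<in> overlap c c'" for c c' x
  proof -
    obtain U \<phi> V \<psi> where eq: "c = (U, \<phi>)" "c' = (V, \<psi>)" by (cases c, cases c')
    have c: "(U, \<phi>) \<in> charts (submanifold d S)" "(V, \<psi>) \<in> charts (submanifold d S)"
      and x: "x \<in> \<phi> ` (U \<inter> V)" using that by (auto simp: eq overlap_def)
    have "transition c c' x \<in> \<psi> ` V" using x chart_facts(3)[OF c(1)] by (auto simp: eq transition_def)
    then have "form (inv_into V \<psi>) (transition c c' x) > 0" using that(2) by (auto simp: eq)
    moreover have "form (inv_into U \<phi>) x > 0" using that(1) x by (auto simp: eq)
    ultimately show ?thesis using form_transition[OF c x]
      by (simp add: eq zero_less_mult_iff)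
  qed
  ultimately have oriented: "oriented_atlas d (top_of_set S) ?B" unfolding oriented_atlas_def by blast
  show ?thesis
  proof (intro exI[of _ ?B] conjI oriented)
    show "?B \<subseteq> charts (submanifold d S)" by (rule subsetI) (simp add: case_prod_unfold)
  qed
qed

text \<open>
  An oriented atlas is pulled back along the diffeomorphism. Its members are compatible with the given
  charts by smoothness of the diffeomorphism in both directions, and the coordinate changes among the
  pulled back charts are literally the old ones.
\<close>

lemma orientable_if_diffeomorphic:
  assumes dif: "diffeomorphic M N" and dim: "dimension M = d" "dimension N = d"
    and B: "B \<subseteq> charts N" "oriented_atlas d (topology_of N) B"
    and M: "\<And>c. c \<in> charts M \<Longrightarrow> is_chart d (topology_of M) c"
  shows "orientable M"
proof -
  let ?X = "topology_of M" and ?Y = "topology_of N"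
  obtain f g where hom: "homeomorphic_maps ?X ?Y f g" and f: "smooth_between M N f" and g: "smooth_between N M g"
    using dif unfolding diffeomorphic_def by blast
  have fc: "continuous_map ?X ?Y f" and gc: "continuous_map ?Y ?X g" and gf: "\<And>x. x \<in> topspace ?X \<Longrightarrow> g (f x) = x"
    and fg: "\<And>y. y \<in> topspace ?Y \<Longrightarrow> f (g y) = y" using hom by (auto simp: homeomorphic_maps_def)
  have fX: "f x \<in> topspace ?Y" if "x \<in> topspace ?X" for x using fc that continuous_map_image_subset_topspace by blast
  have gY: "g y \<in> topspace ?X" if "y \<in> topspace ?Y" for y using gc that continuous_map_image_subset_topspace by blast
  have atlas: "smooth_atlas d ?Y B"
    and pos: "\<And>c c' x. c \<in> B \<Longrightarrow> c' \<in> B \<Longrightarrow> x \<in> overlap c c' \<Longrightarrow> jacobian_det d (transition c c') x > 0"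
    using B(2) by (auto simp: oriented_atlas_def)
  have BY: "is_chart d ?Y c" if "c \<in> B" for c using atlas that by (simp add: smooth_atlas_def)
  define pull where "pull c = ({x \<in> topspace ?X. f x \<in> fst c}, snd c \<circ> f)" for c :: "'b chart"
  have cY: "v \<in> topspace ?Y" if "c \<in> B" "v \<in> fst c" for c v
    using is_chart_subset[of d ?Y "fst c" "snd c"] BY[OF that(1)] that(2) by auto
  have g_pull: "g v \<in> fst (pull c)" "snd (pull c) (g v) = snd c v" if "c \<in> B" "v \<in> fst c" for c v
    using cY[OF that] gY fg that(2) by (simp_all add: pull_def)
  have inv_pull: "inv_into (fst (pull c)) (snd (pull c)) (snd c v) = g v" if c: "c \<in> B" "v \<in> fst c" for c v
  proof -
    have "inj_on (snd (pull c)) (fst (pull c))"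
    proof (rule inj_onI)
      fix a b assume ab: "a \<in> fst (pull c)" "b \<in> fst (pull c)" "snd (pull c) a = snd (pull c) b"
      then have "f a = f b" using inj_onD[OF is_chart_inj'[OF BY[OF c(1)]], of "f a" "f b"] by (simp add: pull_def)
      have ga: "g (f a) = a" "g (f b) = b" using gf ab(1,2) by (simp_all add: pull_def)
      show "a = b" using arg_cong[OF \<open>f a = f b\<close>, of g] unfolding ga .
    qed
    from inv_into_f_f[OF this g_pull(1)[OF c]] show ?thesis by (simp only: g_pull(2)[OF c])
  qed
  have inv_c: "inv_into (fst c) (snd c) (snd c v) = v" if "c \<in> B" "v \<in> fst c" for c v
    using is_chart_inj'[OF BY[OF that(1)]] that(2) by simp
  have chart: "is_chart d ?X (pull c)" if c: "c \<in> B" for c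
  proof -
    have cc: "is_chart d ?Y (fst c, snd c)" using BY[OF c] by simp
    let ?U = "{x \<in> topspace ?X. f x \<in> fst c}" and ?\<eta> = "inv_into (fst c) (snd c)"
    have "is_chart d ?X (?U, snd c \<circ> f)"
    proof (rule is_chartI[where \<phi> = "snd c \<circ> f" and \<psi> = "\<lambda>t. g (?\<eta> t)" and P = "snd c ` fst c"])
      show "openin ?X ?U" by (rule openin_continuous_map_preimage[OF fc is_chart_open[OF cc]])
      show "openin (Euclidean_space d) (snd c ` fst c)" by (rule is_chart_image_open[OF cc])
      fix A assume A: "openin (Euclidean_space d) A"
      have "{x \<in> ?U. (snd c \<circ> f) x \<in> A} = {x \<in> topspace ?X. f x \<in> {v \<in> fst c. snd c v \<in> A}}" by auto
      then show "openin ?X {x \<in> ?U. (snd c \<circ> f) x \<in> A}"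
        using openin_continuous_map_preimage[OF fc is_chart_open_preimage[OF cc A]] by simp
    next
      fix A assume A: "openin ?X A"
      have "{t \<in> snd c ` fst c. g (?\<eta> t) \<in> A} = snd c ` ({y \<in> topspace ?Y. g y \<in> A} \<inter> fst c)"
        using inv_c[OF c] cY[OF c] by auto
      moreover have "openin ?Y ({y \<in> topspace ?Y. g y \<in> A} \<inter> fst c)"
        using openin_continuous_map_preimage[OF gc A] is_chart_open[OF cc] by (rule openin_Int)
      ultimately show "openin (Euclidean_space d) {t \<in> snd c ` fst c. g (?\<eta> t) \<in> A}"
        using is_chart_open_image[OF cc] by simp
    qed (use inv_c[OF c] cY[OF c] gY fg gf in auto)
    then show ?thesis by (simp add: pull_def)
  qed
  have trans: "overlap (pull c) (pull c') = overlap c c' \<and>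
      (\<forall>x\<in>overlap c c'. transition (pull c) (pull c') x = transition c c' x)" if c: "c \<in> B" "c' \<in> B" for c c'
  proof (intro conjI ballI equalityI subsetI)
    fix x assume "x \<in> overlap (pull c) (pull c')"
    then obtain q where q: "q \<in> fst (pull c)" "q \<in> fst (pull c')" "x = snd (pull c) q" by (rule overlapE)
    then show "x \<in> overlap c c'" using overlapI[of "f q" c c'] by (simp add: pull_def)
  next
    fix x assume "x \<in> overlap c c'"
    then obtain v where v: "v \<in> fst c" "v \<in> fst c'" "x = snd c v" by (rule overlapE)
    show "x \<in> overlap (pull c) (pull c')"
      using overlapI[OF g_pull(1)[OF c(1) v(1)] g_pull(1)[OF c(2) v(2)]] g_pull(2)[OF c(1) v(1)] v(3) by simp
  next
    fix x assume "x \<in> overlap c c'"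
    then obtain v where v: "v \<in> fst c" "v \<in> fst c'" "x = snd c v" by (rule overlapE)
    show "transition (pull c) (pull c') x = transition c c' x"
      using transition_apply[OF is_chart_inj'[OF chart[OF c(1)]] g_pull(1)[OF c(1) v(1)], of "pull c'"]
        transition_apply[OF is_chart_inj'[OF BY[OF c(1)]] v(1), of c'] g_pull(2)[OF c(1) v(1)] g_pull(2)[OF c(2) v(2)] v(3)
      by simp
  qed
  have op: "openin (Euclidean_space d) (overlap c c')" if "c \<in> B" "c' \<in> B" for c c'
    by (rule overlap_open[OF BY[OF that(1)] BY[OF that(2)]])
  have smooth_trans: "smooth_map d (overlap (pull c) (pull c')) (transition (pull c) (pull c'))"
    if c: "c \<in> B" "c' \<in> B" for c c'
  proof -
    have "smooth_map d (overlap c c') (transition c c')" using atlas c by (simp add: smooth_atlas_def compatible_def)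
    then have "smooth_map d (overlap c c') (transition (pull c) (pull c'))"
      by (rule smooth_map_cong[OF op[OF c], rotated]) (use trans[OF c] in simp)
    then show ?thesis using trans[OF c] by simp
  qed
  have "smooth_atlas d ?X (pull ` B)"
    unfolding smooth_atlas_def
  proof (intro conjI ballI)
    show "is_chart d ?X k" if "k \<in> pull ` B" for k using that chart by blast
    show "compatible d k k'" if "k \<in> pull ` B" "k' \<in> pull ` B" for k k'
      using that smooth_trans unfolding compatible_def by blast
    have cover: "\<Union> (fst ` B) = topspace ?Y" using atlas by (simp add: smooth_atlas_def)
    show "\<Union> (fst ` (pull ` B)) = topspace ?X"
    proof (intro equalityI subsetI)
      fix x assume x: "x \<in> topspace ?X"
      then obtain c where "c \<in> B" "f x \<in> fst c" using fX[OF x] cover by blast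
      then have "x \<in> fst (pull c)" using x by (simp add: pull_def)
      then show "x \<in> \<Union> (fst ` pull ` B)" using \<open>c \<in> B\<close> by blast
    qed (auto simp: pull_def)
  qed
  moreover have "jacobian_det d (transition k k') x > 0"
    if k: "k \<in> pull ` B" "k' \<in> pull ` B" and x: "x \<in> overlap k k'" for k k' x
  proof -
    obtain c c' where c: "c \<in> B" "c' \<in> B" "k = pull c" "k' = pull c'" using k by blast
    have x': "x \<in> overlap c c'" using x trans[OF c(1,2)] c(3,4) by simp
    have "jacobian_det d (transition k k') x = jacobian_det d (transition c c') x"
      by (rule jacobian_det_local[OF op[OF c(1,2)] _ x']) (use trans[OF c(1,2)] c(3,4) in simp)
    then show ?thesis using pos[OF c(1,2) x'] by simp
  qed
  moreover have "compatible d k c'" if k: "k \<in> pull ` B" and c': "c' \<in> charts M" for k c'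
  proof -
    obtain c where c: "c \<in> B" "k = pull c" using k by blast
    have c'X: "v \<in> topspace ?X" if "v \<in> fst c'" for v
      using is_chart_subset[of d ?X "fst c'" "snd c'"] M[OF c'] that by auto
    have cN: "c \<in> charts N" using B(1) c(1) by blast
    have "smooth_map d (snd c ` (fst c \<inter> g -` fst c')) (snd c' \<circ> g \<circ> inv_into (fst c) (snd c))"
      using smooth_betweenD[OF g cN c'] dim by simp
    moreover have eq1: "overlap k c' = snd c ` (fst c \<inter> g -` fst c')"
    proof (intro equalityI subsetI)
      fix x assume "x \<in> overlap k c'"
      then obtain q where q: "q \<in> fst k" "q \<in> fst c'" "x = snd k q" by (rule overlapE)
      then have "f q \<in> fst c" "g (f q) = q" "x = snd c (f q)" using gf by (auto simp: c(2) pull_def)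
      then show "x \<in> snd c ` (fst c \<inter> g -` fst c')" using q(2) by auto
    next
      fix x assume "x \<in> snd c ` (fst c \<inter> g -` fst c')"
      then obtain v where v: "v \<in> fst c" "g v \<in> fst c'" "x = snd c v" by blast
      show "x \<in> overlap k c'"
        using overlapI[OF g_pull(1)[OF c(1) v(1)] v(2)] g_pull(2)[OF c(1) v(1)] v(3) by (simp add: c(2))
    qed
    moreover have "(snd c' \<circ> g \<circ> inv_into (fst c) (snd c)) x = transition k c' x" if x: "x \<in> overlap k c'" for x
    proof -
      obtain v where v: "v \<in> fst c" "x = snd c v" using x unfolding eq1 by blast
      show ?thesis
        using transition_apply[OF is_chart_inj'[OF chart[OF c(1)]] g_pull(1)[OF c(1) v(1)], of c']
          g_pull(2)[OF c(1) v(1)] inv_c[OF c(1) v(1)] v(2) by (simp add: c(2))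
    qed
    ultimately have 1: "smooth_map d (overlap k c') (transition k c')"
      using smooth_map_cong[OF overlap_open[OF chart[OF c(1)] M[OF c']],
          of "snd c' \<circ> g \<circ> inv_into (fst c) (snd c)" "transition k c'"] by (simp add: c(2))
    have "overlap c' k = snd c' ` (fst c' \<inter> f -` fst c)"
      using c'X by (cases c') (auto simp: overlap_def c(2) pull_def)
    moreover have "transition c' k = snd c \<circ> f \<circ> inv_into (fst c') (snd c')"
      by (cases c') (simp add: transition_def c(2) pull_def)
    ultimately have "smooth_map d (overlap c' k) (transition c' k)"
      using smooth_betweenD[OF f c' cN] dim by simp
    then show ?thesis using 1 by (simp add: compatible_def)
  qed
  ultimately have "oriented_atlas d ?X (pull ` B) \<and> (\<forall>k\<in>pull ` B. \<forall>c'\<in>charts M. compatible d k c')"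
    unfolding oriented_atlas_def by blast
  then show ?thesis unfolding orientable_def dim(1) by blast
qed

lemma (in polygons) orientable_if_diffeomorphic_torus:
  assumes "diffeomorphic (reduced_polygon_space n l) (torus (n - 3))"
  shows "orientable (reduced_polygon_space n l)"
proof -
  interpret T: framed_submanifold "n - 3" "n - 3" "torus_set (n - 3)" "\<lambda>_ _ _. 0" by (rule framed_torus)
  obtain B where B: "B \<subseteq> charts (submanifold (n - 3) (torus_set (n - 3)))"
    "oriented_atlas (n - 3) (top_of_set (torus_set (n - 3))) B" using T.oriented_subatlas by blast
  show ?thesis
  proof (rule orientable_if_diffeomorphic[OF assms])
    show "is_chart (n - 3) (topology_of (reduced_polygon_space n l)) c"
      if "c \<in> charts (reduced_polygon_space n l)" for c
      using that push_is_chart by auto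
  qed (use B in \<open>simp_all add: torus_def\<close>)
qed

section \<open>Which reduced polygon spaces are orientable\<close>

theorem corollary1p3:
  fixes n :: nat and l :: "nat \<Rightarrow> real"
  assumes "n \<ge> 3"
    and "length_vector n l"
    and "generic n l"
    and "topspace (topology_of (reduced_polygon_space n l)) \<noteq> {}"
  shows "orientable (reduced_polygon_space n l) \<longleftrightarrow>
           even n \<or> diffeomorphic (reduced_polygon_space n l) (torus (n - 3))"
proof -
  interpret polygons n l by standard (use assms(1-3) in auto)
  obtain z where z: "z \<in> polygon_set n l"
    using assms(4) by (auto simp: topspace_quotient_topology)
  show ?thesis
  proof (cases "even n")
    case True
    have "openin (top_of_set (polygon_set n l)) {z \<in> polygon_set n l. 1 = e}" for e :: real
      by (cases "e = 1") simp_all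
    then have "orientable (reduced_polygon_space n l)"
      by (intro orientable_if_sign[of "\<lambda>_. 1"]) (use True in simp_all)
    then show ?thesis using True by simp
  next
    case False
    consider i j k where "three_long_edges i j k" | A x y w where "foldable A x y w"
      using three_long_edges_or_minimal_long[OF z] by blast
    then show ?thesis
    proof cases
      case 1
      then have "card ({1..n} - {i, j, k}) = n - 3"
        by (simp add: three_long_edges_def card_Diff_subset)
      then obtain e where "bij_betw e {1..n-3} ({1..n} - {i, j, k})"
        using ex_bij_betw_nat_finite_1[of "{1..n} - {i, j, k}"] by auto
      then interpret torus_polygons n l i j k e using 1 by unfold_locales
      show ?thesis using diffeomorphic_torus orientable_if_diffeomorphic_torus by blast
    next
      case 2
      then have "\<not> orientable (reduced_polygon_space n l)"
        using connected_to_conjugate not_orientable_if_connected False by blast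
      then show ?thesis using orientable_if_diffeomorphic_torus False by blast
    qed
  qed
qed

end
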